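(* Let $N\ge 2$, $s\in(0,1)$, and let $\Omega\subset\mathbb{R}^N$ be a bounded domain with $C^2$ boundary. The map $\rho\mapsto\widetilde{\mu}_1(\rho)$ from $L^\infty(\Omega)$ to $\mathbb{R}$ defined in the context is Gâteaux differentiable at any $\rho\in L^\infty(\Omega)$ such that $\widetilde{\mu}_1(\rho)>0$, with Gâteaux differential equal to $u_\rho^2$. In other words, for every direction $v\in L^\infty(\Omega)$, $$\widetilde{\mu}_1'(\rho;v)=\lim_{t\to0}\frac{\widetilde{\mu}_1(\rho+tv)-\widetilde{\mu}_1(\rho)}{t}=\int_\Omega u_\rho^2\,v\,dx.$$
   Context: $H_0^s(\Omega)=\{u\in H^s(\mathbb{R}^N): u=0 \text{ a.e. in } \mathbb{R}^N\setminus\Omega\}$ is a Hilbert space with inner product $\langle u,v\rangle_{H_0^s(\Omega)}=\int_{\mathbb{R}^{2N}}\frac{(u(x)-u(y))(v(x)-v(y))}{|x-y|^{N+2s}}\,dx\,dy$ and associated norm. For $\rho\in L^\infty(\Omega)$, $G_\rho:H_0^s(\Omega)\to H_0^s(\Omega)$ is the self-adjoint compact linear operator determined by $\langle G_\rho(f),\varphi\rangle_{H_0^s(\Omega)}=\int_\Omega\rho f\varphi\,dx$ for all $f,\varphi\in H_0^s(\Omega)$. If $|\{\rho>0\}|>0$ (where $\{\rho>0\}=\{x\in\Omega:\rho(x)>0\}$ and $|\cdot|$ is Lebesgue measure), $\mu_1(\rho)>0$ denotes the largest positive eigenvalue of $G_\rho$, i.e. $\mu_1(\rho)=\max_{f\in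 H_0^s(\Omega),\,f\neq0}\frac{\int_\Omega\rho f^2\,dx}{\|f\|^2_{H_0^s(\Omega)}}$. It is known to be simple with eigenfunctions of one sign in $\Omega$; $u_\rho$ denotes the positive eigenfunction of $G_\rho$ for $\mu_1(\rho)$ normalized by $\|u_\rho\|_{H_0^s(\Omega)}=1$. (Equivalently $u_\rho$ is the positive normalized first eigenfunction of $(-\Delta)^su=\lambda\rho u$ in $\Omega$, $u=0$ in $\mathbb{R}^N\setminus\Omega$, for the smallest positive eigenvalue $\lambda_1(\rho)=1/\mu_1(\rho)$.) Set $\widetilde{\mu}_1(\rho)=\mu_1(\rho)$ if $|\{\rho>0\}|>0$ and $\widetilde{\mu}_1(\rho)=0$ if $|\{\rho>0\}|=0$. *)

theory Defs
  imports "HOL-Analysis.Analysis"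
begin

definition C2_function :: "('a::euclidean_space \<Rightarrow> real) \<Rightarrow> bool" where
  "C2_function g \<longleftrightarrow>
     (\<exists>(g' :: 'a \<Rightarrow> 'a \<Rightarrow>\<^sub>L real) (g'' :: 'a \<Rightarrow> 'a \<Rightarrow>\<^sub>L ('a \<Rightarrow>\<^sub>L real)).
        (\<forall>x. (g has_derivative blinfun_apply (g' x)) (at x)) \<and>
        (\<forall>x. (g' has_derivative blinfun_apply (g'' x)) (at x)) \<and>
        continuous_on UNIV g'')"

text \<open>Near each boundary point, the set is the strict epigraph of a \<open>C\<^sup>2\<close> function over a
  hyperplane, in the direction of some unit vector \<open>e\<close>. The function \<open>g\<close> is declared on the
  whole space but is only evaluated at the orthogonal projection of \<open>x\<close> onto the
  hyperplane orthogonal to \<open>e\<close>.\<close>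

definition C2_boundary :: "'a::euclidean_space set \<Rightarrow> bool" where
  "C2_boundary \<Omega> \<longleftrightarrow>
     (\<forall>z\<in>frontier \<Omega>. \<exists>r>0. \<exists>e g. norm e = 1 \<and> C2_function g \<and>
        \<Omega> \<inter> ball z r = {x \<in> ball z r. x \<bullet> e > g (x - (x \<bullet> e) *\<^sub>R e)})"

definition bounded_C2_domain :: "'a::euclidean_space set \<Rightarrow> bool" where
  "bounded_C2_domain \<Omega> \<longleftrightarrow>
     open \<Omega> \<and> connected \<Omega> \<and> \<Omega> \<noteq> {} \<and> bounded \<Omega> \<and> C2_boundary \<Omega>"

text \<open>Elements of Lebesgue and Sobolev spaces are represented by functions on the whole space,
  not by equivalence classes; equality in these spaces is equality almost everywhere. For
  \<open>Linf \<Omega>\<close> the values outside \<open>\<Omega>\<close> are irrelevant.\<close>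

definition Linf :: "'a::euclidean_space set \<Rightarrow> ('a \<Rightarrow> real) set" where
  "Linf \<Omega> = {\<rho>. \<rho> \<in> borel_measurable (lebesgue_on \<Omega>) \<and>
                 (\<exists>C. AE x in lebesgue_on \<Omega>. \<bar>\<rho> x\<bar> \<le> C)}"

definition Hs :: "real \<Rightarrow> ('a::euclidean_space \<Rightarrow> real) set" where
  "Hs s = {u. u \<in> borel_measurable lebesgue \<and>
              integrable lebesgue (\<lambda>x. (u x)\<^sup>2) \<and>
              integrable (lebesgue :: ('a \<times> 'a) measure)
                (\<lambda>(x, y). (u x - u y)\<^sup>2 / norm (x - y) powr (real DIM('a) + 2 * s))}"

definition H0s :: "'a::euclidean_space set \<Rightarrow> real \<Rightarrow> ('a \<Rightarrow> real) set" where
  "H0s \<Omega> s = {u \<in> Hs s. AE x in lebesgue. x \<notin> \<Omega> \<longrightarrow> u x = 0}"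

definition H0s_inner ::
    "real \<Rightarrow> ('a::euclidean_space \<Rightarrow> real) \<Rightarrow> ('a \<Rightarrow> real) \<Rightarrow> real" where
  "H0s_inner s u v =
     integral\<^sup>L (lebesgue :: ('a \<times> 'a) measure)
       (\<lambda>(x, y). (u x - u y) * (v x - v y) / norm (x - y) powr (real DIM('a) + 2 * s))"

definition H0s_norm :: "real \<Rightarrow> ('a::euclidean_space \<Rightarrow> real) \<Rightarrow> real" where
  "H0s_norm s u = sqrt (H0s_inner s u u)"

text \<open>The image \<open>G_op \<Omega> s \<rho> f\<close> is determined only up to a null set, hence the choice operator.\<close>

definition G_op ::
    "'a::euclidean_space set \<Rightarrow> real \<Rightarrow> ('a \<Rightarrow> real) \<Rightarrow> ('a \<Rightarrow> real) \<Rightarrow> 'a \<Rightarrow> real" where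
  "G_op \<Omega> s \<rho> f =
     (SOME g. g \<in> H0s \<Omega> s \<and>
        (\<forall>\<phi>\<in>H0s \<Omega> s. H0s_inner s g \<phi> = (\<integral>x. \<rho> x * f x * \<phi> x \<partial>lebesgue_on \<Omega>)))"

definition eigenfunction_of ::
    "'a::euclidean_space set \<Rightarrow> real \<Rightarrow> ('a \<Rightarrow> real) \<Rightarrow> real \<Rightarrow> ('a \<Rightarrow> real) \<Rightarrow> bool" where
  "eigenfunction_of \<Omega> s \<rho> \<mu> f \<longleftrightarrow>
     f \<in> H0s \<Omega> s \<and> \<not> (AE x in lebesgue. f x = 0) \<and>
     (AE x in lebesgue. G_op \<Omega> s \<rho> f x = \<mu> * f x)"

definition mu1 :: "'a::euclidean_space set \<Rightarrow> real \<Rightarrow> ('a \<Rightarrow> real) \<Rightarrow> real" where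
  "mu1 \<Omega> s \<rho> = (GREATEST \<mu>. \<mu> > 0 \<and> (\<exists>f. eigenfunction_of \<Omega> s \<rho> \<mu> f))"

definition mu1_tilde :: "'a::euclidean_space set \<Rightarrow> real \<Rightarrow> ('a \<Rightarrow> real) \<Rightarrow> real" where
  "mu1_tilde \<Omega> s \<rho> =
     (if emeasure lebesgue {x \<in> \<Omega>. \<rho> x > 0} > 0 then mu1 \<Omega> s \<rho> else 0)"

text \<open>The positive normalized first eigenfunction is unique only up to a null set; any
  representative may be chosen.\<close>

definition u_first :: "'a::euclidean_space set \<Rightarrow> real \<Rightarrow> ('a \<Rightarrow> real) \<Rightarrow> 'a \<Rightarrow> real" where
  "u_first \<Omega> s \<rho> =
     (SOME u. eigenfunction_of \<Omega> s \<rho> (mu1 \<Omega> s \<rho>) u \<and>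
        (AE x in lebesgue_on \<Omega>. u x > 0) \<and> H0s_norm s u = 1)"

text \<open>The differential is given by a density \<open>w\<close> in \<open>L\<^sup>1(\<Omega>)\<close>, identified with the bounded
  linear functional on \<open>L\<^sup>\<infinity>(\<Omega>)\<close> that maps \<open>v\<close> to the integral of \<open>w v\<close> over \<open>\<Omega>\<close>.\<close>

definition has_gateaux_differential ::
    "'a::euclidean_space set \<Rightarrow> (('a \<Rightarrow> real) \<Rightarrow> real) \<Rightarrow> ('a \<Rightarrow> real) \<Rightarrow> ('a \<Rightarrow> real) \<Rightarrow> bool"
  where
  "has_gateaux_differential \<Omega> F \<rho> w \<longleftrightarrow>
     integrable (lebesgue_on \<Omega>) w \<and>
     (\<forall>v\<in>Linf \<Omega>.
        ((\<lambda>t. (F (\<lambda>x. \<rho> x + t * v x) - F \<rho>) / t) \<longlongrightarrow> (\<integral>x. w x * v x \<partial>lebesgue_on \<Omega>)) (at 0))"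

end

theory Submission
  imports Defs "HOL-Library.Diagonal_Subsequence"
begin

text \<open>Write \<open>W \<rho> f g\<close> for the integral of \<open>\<rho> f g\<close> over \<open>\<Omega>\<close> and \<open>B\<close> for the inner product of the space. The first
eigenvalue is a maximum of Rayleigh quotients, and for a fixed \<open>f\<close> with \<open>B f f = 1\<close> the quotient
\<open>W \<rho> f f\<close> is linear in \<open>\<rho>\<close>. Let \<open>u\<close> and \<open>u\<^sub>t\<close> be normalized first eigenfunctions for \<open>\<rho>\<close> and
\<open>\<rho> + t v\<close>. Testing the maximum for \<open>\<rho> + t v\<close> with \<open>u\<close>, and the maximum for \<open>\<rho>\<close> with \<open>u\<^sub>t\<close>, encloses
the difference quotient between \<open>W v u u\<close> and \<open>W v u\<^sub>t u\<^sub>t\<close>. So the theorem amounts to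
\<open>W v u\<^sub>t u\<^sub>t \<longlonglongrightarrow> W v u u\<close> as \<open>t\<close> tends to \<open>0\<close>, which is \<open>extremal_stability\<close>: by the compact
embedding (\<open>Rellich\<close>) a subsequence of the \<open>u\<^sub>t\<close> converges in \<open>L\<^sup>2\<close>, its limit is a normalized
maximizer for \<open>\<rho>\<close>, and by \<open>extremal_simple\<close> the square of that limit is \<open>u\<^sup>2\<close>.

Compactness is obtained from dyadic cells. On a cell \<open>Q\<close> the double integral of
\<open>(u x - u y)\<^sup>2\<close> is both an explicit combination of the integrals of \<open>u\<^sup>2\<close> and \<open>u\<close> over \<open>Q\<close> and, since
\<open>Q\<close> is small, a small multiple of the energy. Hence an energy-bounded sequence whose integrals over
all cells converge is a Cauchy sequence in \<open>L\<^sup>2\<close>, and a diagonal subsequence has this property.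

One existence result by the direct method, \<open>form_maximizer\<close>, is used twice. For the form \<open>W \<rho>\<close>
it yields a first eigenfunction. For the rank-one form \<open>l f * l g\<close> with a functional \<open>l\<close> it yields
the Riesz representative of \<open>l\<close>, so that the operator \<open>G_op\<close>, which is given by a choice, has its
defining property (\<open>G_op_properties\<close>) and eigenfunctions are the solutions of a weak equation.

Taking absolute values does not increase the energy, strictly so if \<open>w\<close> takes both signs, because
the kernel is positive everywhere. So maximizers have one sign, and simplicity follows since some
combination of two maximizers has integral zero. Strict positivity is needed for the choice that defines
\<open>u_first\<close> to be a choice from a nonempty set. If \<open>u\<close> vanished on a set of positive measure, the
test function \<open>max 0 (\<epsilon> \<eta> - u)\<close> with a cutoff \<open>\<eta>\<close> would lead to a contradiction: the interaction of that set
with the region where \<open>u > 0\<close> contributes a term of order \<open>\<epsilon>\<close>, all others are of order \<open>\<epsilon>\<^sup>2\<close>.\<close>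

section \<open>Square-integrable functions\<close>

definition sq_integrable :: "'b measure \<Rightarrow> ('b \<Rightarrow> real) \<Rightarrow> bool" where
  "sq_integrable M f \<longleftrightarrow> f \<in> borel_measurable M \<and> integrable M (\<lambda>x. (f x)\<^sup>2)"

lemma sq_integrable_measurable [dest]: "sq_integrable M f \<Longrightarrow> f \<in> borel_measurable M"
  by (simp add: sq_integrable_def)

lemma sq_integrable_bound:
  assumes f: "sq_integrable M f" and g: "sq_integrable M g" and h: "h \<in> borel_measurable M"
    and bd: "AE x in M. \<bar>h x\<bar> \<le> a * \<bar>f x\<bar> + b * \<bar>g x\<bar>"
  shows "sq_integrable M h"
proof -
  have "integrable M (\<lambda>x. 2 * a\<^sup>2 * (f x)\<^sup>2 + 2 * b\<^sup>2 * (g x)\<^sup>2)"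
    using f g by (simp add: sq_integrable_def)
  moreover have "AE x in M. norm ((h x)\<^sup>2) \<le> norm (2 * a\<^sup>2 * (f x)\<^sup>2 + 2 * b\<^sup>2 * (g x)\<^sup>2)"
    using bd
  proof eventually_elim
    case (elim x)
    then have "(h x)\<^sup>2 \<le> (a * \<bar>f x\<bar> + b * \<bar>g x\<bar>)\<^sup>2"
      using abs_le_square_iff by fastforce
    also have "\<dots> \<le> 2 * (a * \<bar>f x\<bar>)\<^sup>2 + 2 * (b * \<bar>g x\<bar>)\<^sup>2"
      using sum_squares_bound[of "a * \<bar>f x\<bar>" "b * \<bar>g x\<bar>"] by (simp add: power2_sum)
    finally show ?case by (simp add: power_mult_distrib)
  qed
  moreover have "(\<lambda>x. (h x)\<^sup>2) \<in> borel_measurable M" using h by simp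
  ultimately have "integrable M (\<lambda>x. (h x)\<^sup>2)"
    using Bochner_Integration.integrable_bound by blast
  then show ?thesis using h by (simp add: sq_integrable_def)
qed

lemma sq_integrable_diff:
  "sq_integrable M f \<Longrightarrow> sq_integrable M g \<Longrightarrow> sq_integrable M (\<lambda>x. f x - g x)"
  by (rule sq_integrable_bound[of M f g _ 1 1]) (auto intro: borel_measurable_diff)

lemma sq_integrable_mult_integrable:
  assumes f: "sq_integrable M f" and g: "sq_integrable M g"
  shows "integrable M (\<lambda>x. f x * g x)"
proof (rule Bochner_Integration.integrable_bound)
  show "integrable M (\<lambda>x. (f x)\<^sup>2 + (g x)\<^sup>2)"
    using f g by (simp add: sq_integrable_def)
  show "(\<lambda>x. f x * g x) \<in> borel_measurable M"
    using f g by (auto intro: borel_measurable_times)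
  have "\<bar>f x * g x\<bar> \<le> (f x)\<^sup>2 + (g x)\<^sup>2" for x
  proof -
    have "2 * (\<bar>f x\<bar> * \<bar>g x\<bar>) \<le> (f x)\<^sup>2 + (g x)\<^sup>2"
      using sum_squares_bound[of "\<bar>f x\<bar>" "\<bar>g x\<bar>"] by simp
    moreover have "0 \<le> \<bar>f x\<bar> * \<bar>g x\<bar>" by simp
    ultimately show ?thesis unfolding abs_mult by linarith
  qed
  then show "AE x in M. norm (f x * g x) \<le> norm ((f x)\<^sup>2 + (g x)\<^sup>2)"
    by (auto intro!: AE_I2)
qed

lemma Cauchy_Schwarz_integral:
  assumes f: "sq_integrable M f" and g: "sq_integrable M g"
  shows "\<bar>\<integral>x. f x * g x \<partial>M\<bar> \<le> sqrt (\<integral>x. (f x)\<^sup>2 \<partial>M) * sqrt (\<integral>x. (g x)\<^sup>2 \<partial>M)"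
proof -
  have [measurable]: "f \<in> borel_measurable M" "g \<in> borel_measurable M"
    using f g by auto
  have i: "integrable M (\<lambda>x. (f x)\<^sup>2)" "integrable M (\<lambda>x. (g x)\<^sup>2)"
     "integrable M (\<lambda>x. \<bar>f x\<bar> * \<bar>g x\<bar>)"
    using f g sq_integrable_mult_integrable[OF f g]
    by (auto simp: sq_integrable_def simp flip: abs_mult)
  have "(\<integral>\<^sup>+x. ennreal \<bar>f x\<bar> * ennreal \<bar>g x\<bar> \<partial>M)\<^sup>2
      \<le> (\<integral>\<^sup>+x. (ennreal \<bar>f x\<bar>)\<^sup>2 \<partial>M) * (\<integral>\<^sup>+x. (ennreal \<bar>g x\<bar>)\<^sup>2 \<partial>M)"
    by (rule Cauchy_Schwarz_nn_integral) auto
  then have "(ennreal (\<integral>x. \<bar>f x\<bar> * \<bar>g x\<bar> \<partial>M))\<^sup>2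
      \<le> ennreal (\<integral>x. (f x)\<^sup>2 \<partial>M) * ennreal (\<integral>x. (g x)\<^sup>2 \<partial>M)"
    using i by (simp add: ennreal_power nn_integral_eq_integral flip: ennreal_mult)
  then have "(\<integral>x. \<bar>f x\<bar> * \<bar>g x\<bar> \<partial>M)\<^sup>2 \<le> (\<integral>x. (f x)\<^sup>2 \<partial>M) * (\<integral>x. (g x)\<^sup>2 \<partial>M)"
    by (simp add: ennreal_power flip: ennreal_mult)
  then have "(\<integral>x. \<bar>f x\<bar> * \<bar>g x\<bar> \<partial>M) \<le> sqrt ((\<integral>x. (f x)\<^sup>2 \<partial>M) * (\<integral>x. (g x)\<^sup>2 \<partial>M))"
    by (rule real_le_rsqrt)
  moreover have "\<bar>\<integral>x. f x * g x \<partial>M\<bar> \<le> (\<integral>x. \<bar>f x\<bar> * \<bar>g x\<bar> \<partial>M)"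
    using integral_abs_bound[of M "\<lambda>x. f x * g x"] by (simp add: abs_mult)
  ultimately show ?thesis by (simp add: real_sqrt_mult)
qed

lemma L2_tendsto_product:
  assumes f: "\<And>n. sq_integrable M (f n)" "sq_integrable M f'" "(\<lambda>n. \<integral>x. (f n x - f' x)\<^sup>2 \<partial>M) \<longlonglongrightarrow> 0"
    and g: "\<And>n. sq_integrable M (g n)" "sq_integrable M g'" "(\<lambda>n. \<integral>x. (g n x - g' x)\<^sup>2 \<partial>M) \<longlonglongrightarrow> 0"
  shows "(\<lambda>n. \<integral>x. f n x * g n x \<partial>M) \<longlonglongrightarrow> (\<integral>x. f' x * g' x \<partial>M)"
proof -
  let ?n = "\<lambda>h. sqrt (\<integral>x. (h x)\<^sup>2 \<partial>M)"
  have "\<bar>(\<integral>x. f n x * g n x \<partial>M) - (\<integral>x. f' x * g' x \<partial>M)\<bar> \<le>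
      ?n (\<lambda>x. f n x - f' x) * ?n (\<lambda>x. g n x - g' x) + ?n (\<lambda>x. f n x - f' x) * ?n g'
      + ?n f' * ?n (\<lambda>x. g n x - g' x)" for n
  proof -
    have "(\<integral>x. f n x * g n x \<partial>M) - (\<integral>x. f' x * g' x \<partial>M) =
      (\<integral>x. (f n x - f' x) * (g n x - g' x) + (f n x - f' x) * g' x + f' x * (g n x - g' x) \<partial>M)"
      by (subst Bochner_Integration.integral_diff[symmetric])
        (auto intro!: sq_integrable_mult_integrable f g Bochner_Integration.integral_cong simp: algebra_simps)
    also have "\<dots> = (\<integral>x. (f n x - f' x) * (g n x - g' x) \<partial>M)
       + (\<integral>x. (f n x - f' x) * g' x \<partial>M) + (\<integral>x. f' x * (g n x - g' x) \<partial>M)"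
      by (simp add: sq_integrable_mult_integrable sq_integrable_diff f g)
    finally show ?thesis
      using Cauchy_Schwarz_integral[OF sq_integrable_diff[OF f(1,2)] sq_integrable_diff[OF g(1,2)], of n n]
        Cauchy_Schwarz_integral[OF sq_integrable_diff[OF f(1,2)] g(2), of n]
        Cauchy_Schwarz_integral[OF f(2) sq_integrable_diff[OF g(1,2)], of n]
      by linarith
  qed
  then have le: "\<forall>n. norm ((\<integral>x. f n x * g n x \<partial>M) - (\<integral>x. f' x * g' x \<partial>M)) \<le>
      ?n (\<lambda>x. f n x - f' x) * ?n (\<lambda>x. g n x - g' x) + ?n (\<lambda>x. f n x - f' x) * ?n g'
      + ?n f' * ?n (\<lambda>x. g n x - g' x)" by simp
  have lim: "(\<lambda>n. ?n (\<lambda>x. f n x - f' x) * ?n (\<lambda>x. g n x - g' x) + ?n (\<lambda>x. f n x - f' x) * ?n g'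
      + ?n f' * ?n (\<lambda>x. g n x - g' x)) \<longlonglongrightarrow> sqrt 0 * sqrt 0 + sqrt 0 * ?n g' + ?n f' * sqrt 0"
    by (intro tendsto_add tendsto_mult tendsto_real_sqrt tendsto_const f(3) g(3))
  have "(\<lambda>n. (\<integral>x. f n x * g n x \<partial>M) - (\<integral>x. f' x * g' x \<partial>M)) \<longlonglongrightarrow> 0"
    by (rule Lim_null_comparison[OF always_eventually[OF le]]) (use lim in simp)
  then show ?thesis by (rule LIM_zero_cancel)
qed

text \<open>Fatou's lemma as lower semicontinuity. It gives the pointwise limit in the completeness
proof and controls the energy of limits of minimizing and maximizing sequences.\<close>

lemma integral_sq_Fatou:
  assumes f: "\<And>n. sq_integrable M (f n)" and g: "g \<in> borel_measurable M"
    and lim: "AE x in M. (\<lambda>n. f n x) \<longlonglongrightarrow> g x"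
    and bd: "\<forall>\<^sub>F n in sequentially. (\<integral>x. (f n x)\<^sup>2 \<partial>M) \<le> D"
  shows "sq_integrable M g \<and> (\<integral>x. (g x)\<^sup>2 \<partial>M) \<le> D"
proof -
  have [measurable]: "f n \<in> borel_measurable M" for n using f by auto
  obtain n where n: "(\<integral>x. (f n x)\<^sup>2 \<partial>M) \<le> D"
    using eventually_happens'[OF sequentially_bot bd] by blast
  have "0 \<le> (\<integral>x. (f n x)\<^sup>2 \<partial>M)" by simp
  with n have D: "0 \<le> D" by linarith
  have "(\<integral>\<^sup>+x. ennreal ((g x)\<^sup>2) \<partial>M) = (\<integral>\<^sup>+x. liminf (\<lambda>n. ennreal ((f n x)\<^sup>2)) \<partial>M)"
  proof (rule nn_integral_cong_AE, use lim in eventually_elim)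
    fix x assume "(\<lambda>n. f n x) \<longlonglongrightarrow> g x"
    then have "(\<lambda>n. ennreal ((f n x)\<^sup>2)) \<longlonglongrightarrow> ennreal ((g x)\<^sup>2)"
      by (intro tendsto_ennrealI tendsto_power)
    then show "ennreal ((g x)\<^sup>2) = liminf (\<lambda>n. ennreal ((f n x)\<^sup>2))"
      by (rule lim_imp_Liminf[OF sequentially_bot, symmetric])
  qed
  also have "\<dots> \<le> liminf (\<lambda>n. \<integral>\<^sup>+x. ennreal ((f n x)\<^sup>2) \<partial>M)"
    by (rule nn_integral_liminf) auto
  also have "\<dots> = liminf (\<lambda>n. ennreal (\<integral>x. (f n x)\<^sup>2 \<partial>M))"
    using f by (simp add: nn_integral_eq_integral sq_integrable_def)
  also have "\<dots> \<le> limsup (\<lambda>n. ennreal (\<integral>x. (f n x)\<^sup>2 \<partial>M))"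
    by (rule Liminf_le_Limsup) simp
  also have "\<dots> \<le> ennreal D"
    using bd by (intro Limsup_bounded) (auto elim!: eventually_mono intro: ennreal_leI)
  finally have *: "(\<integral>\<^sup>+x. ennreal ((g x)\<^sup>2) \<partial>M) \<le> ennreal D" .
  have "integrable M (\<lambda>x. (g x)\<^sup>2)"
    using * g by (intro integrableI_bounded) (auto simp: le_less_trans)
  then show ?thesis
    using * g D by (simp add: nn_integral_eq_integral sq_integrable_def)
qed

text \<open>Along a subsequence with increments \<open>d k\<close> of squared norm at most \<open>1 / 4 ^ k\<close>, the series of
the \<open>2 ^ k * (d k)\<^sup>2\<close> is integrable, hence finite almost everywhere. Since
\<open>\<bar>d k\<bar> \<le> (1/2) ^ k + 2 ^ k * (d k)\<^sup>2\<close>, the subsequence converges almost everywhere.\<close>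

lemma L2_complete:
  fixes f :: "nat \<Rightarrow> 'b \<Rightarrow> real"
  assumes f: "\<And>n. sq_integrable M (f n)"
    and cau: "\<And>e. e > 0 \<Longrightarrow> \<exists>N. \<forall>m\<ge>N. \<forall>n\<ge>N. (\<integral>x. (f m x - f n x)\<^sup>2 \<partial>M) \<le> e"
  obtains r g where "strict_mono (r :: nat \<Rightarrow> nat)" "sq_integrable M g"
    "AE x in M. (\<lambda>n. f (r n) x) \<longlonglongrightarrow> g x" "(\<lambda>n. \<integral>x. (f n x - g x)\<^sup>2 \<partial>M) \<longlonglongrightarrow> 0"
proof -
  have [measurable]: "f n \<in> borel_measurable M" for n using f by auto
  obtain N where N: "\<And>e m n. e > 0 \<Longrightarrow> m \<ge> N e \<Longrightarrow> n \<ge> N e \<Longrightarrow> (\<integral>x. (f m x - f n x)\<^sup>2 \<partial>M) \<le> e"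
    using cau by metis
  define r where "r = rec_nat (N 1) (\<lambda>k p. max (Suc p) (N (1 / 4 ^ Suc k)))"
  have r: "r (Suc k) > r k" "r k \<ge> N (1 / 4 ^ k)" for k
  proof -
    show "r (Suc k) > r k" by (simp add: r_def less_max_iff_disj)
    show "r k \<ge> N (1 / 4 ^ k)" by (cases k) (simp_all add: r_def)
  qed
  have sm: "strict_mono r" using r(1) by (simp add: strict_mono_Suc_iff)
  define d where "d k x = f (r (Suc k)) x - f (r k) x" for k x
  have [measurable]: "d k \<in> borel_measurable M" for k unfolding d_def by simp
  have dint: "sq_integrable M (d k)" for k
    unfolding d_def by (intro sq_integrable_diff f)
  have d: "(\<integral>x. (d k x)\<^sup>2 \<partial>M) \<le> 1 / 4 ^ k" for k
    unfolding d_def using r[of k] by (intro N) auto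
  have "(\<integral>\<^sup>+x. (\<Sum>k. ennreal (2 ^ k * (d k x)\<^sup>2)) \<partial>M) = (\<Sum>k. \<integral>\<^sup>+x. ennreal (2 ^ k * (d k x)\<^sup>2) \<partial>M)"
    by (rule nn_integral_suminf) simp
  also have "\<dots> = (\<Sum>k. ennreal (2 ^ k * (\<integral>x. (d k x)\<^sup>2 \<partial>M)))"
    using dint by (subst nn_integral_eq_integral) (auto simp: sq_integrable_def)
  also have "\<dots> \<le> (\<Sum>k. ennreal ((1/2) ^ k))"
  proof (intro suminf_le ennreal_leI)
    fix k
    have "2 ^ k * (\<integral>x. (d k x)\<^sup>2 \<partial>M) \<le> 2 ^ k * (1 / 4 ^ k)" using d by (intro mult_left_mono) auto
    also have "\<dots> = (1/2 :: real) ^ k" by (simp add: power_divide field_simps flip: power_mult_distrib)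
    finally show "2 ^ k * (\<integral>x. (d k x)\<^sup>2 \<partial>M) \<le> (1/2) ^ k" .
  qed auto
  also have "\<dots> < \<infinity>"
    by (subst suminf_ennreal2) (auto intro: summable_geometric)
  finally have "AE x in M. (\<Sum>k. ennreal (2 ^ k * (d k x)\<^sup>2)) \<noteq> \<infinity>"
    by (intro nn_integral_PInf_AE) auto
  then have conv: "AE x in M. convergent (\<lambda>k. f (r k) x)"
  proof eventually_elim
    case (elim x)
    then have s: "summable (\<lambda>k. 2 ^ k * (d k x)\<^sup>2)"
      by (intro summable_suminf_not_top) auto
    have "summable (\<lambda>k. d k x)"
    proof (rule summable_comparison_test)
      show "summable (\<lambda>k. (1/2) ^ k + 2 ^ k * (d k x)\<^sup>2)"
        by (intro summable_add s summable_geometric) auto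
      have "\<bar>d k x\<bar> \<le> (1/2) ^ k + 2 ^ k * (d k x)\<^sup>2" for k
      proof -
        have "0 \<le> 2 ^ k * \<bar>d k x\<bar>" by simp
        then have "2 ^ k * \<bar>d k x\<bar> \<le> 1 + (2 ^ k * \<bar>d k x\<bar>)\<^sup>2"
          using sum_squares_bound[of 1 "2 ^ k * \<bar>d k x\<bar>"] unfolding mult_1_right power_one by linarith
        also have "\<dots> = 2 ^ k * ((1/2) ^ k + 2 ^ k * (d k x)\<^sup>2)"
          by (simp add: distrib_left power_mult_distrib power_one_over power2_eq_square)
        finally have "2 ^ k * \<bar>d k x\<bar> \<le> 2 ^ k * ((1/2) ^ k + 2 ^ k * (d k x)\<^sup>2)" .
        then show ?thesis by simp
      qed
      then show "\<exists>N. \<forall>k\<ge>N. norm (d k x) \<le> (1/2) ^ k + 2 ^ k * (d k x)\<^sup>2" by auto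
    qed
    then have "convergent (\<lambda>n. \<Sum>k<n. d k x)" by (simp add: summable_iff_convergent)
    moreover have "(\<Sum>k<n. d k x) = f (r n) x - f (r 0) x" for n
      unfolding d_def by (rule sum_lessThan_telescope)
    ultimately have "convergent (\<lambda>n. (f (r n) x - f (r 0) x) + f (r 0) x)"
      by (intro convergent_add convergent_const) simp
    then show ?case by simp
  qed
  define g where "g x = lim (\<lambda>k. f (r k) x)" for x
  have [measurable]: "g \<in> borel_measurable M" unfolding g_def by measurable
  have lim: "AE x in M. (\<lambda>n. f (r n) x) \<longlonglongrightarrow> g x"
    using conv by eventually_elim (simp add: g_def convergent_LIMSEQ_iff)
  have close: "sq_integrable M (\<lambda>x. f n x - g x) \<and> (\<integral>x. (f n x - g x)\<^sup>2 \<partial>M) \<le> e"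
    if "n \<ge> N e" "e > 0" for n e
  proof (rule integral_sq_Fatou)
    show "sq_integrable M (\<lambda>x. f n x - f (r k) x)" for k by (intro sq_integrable_diff f)
    show "AE x in M. (\<lambda>k. f n x - f (r k) x) \<longlonglongrightarrow> f n x - g x"
      using lim by eventually_elim (intro tendsto_intros)
    have "\<forall>\<^sub>F k in sequentially. k \<ge> N e" by simp
    then show "\<forall>\<^sub>F k in sequentially. (\<integral>x. (f n x - f (r k) x)\<^sup>2 \<partial>M) \<le> e"
      by eventually_elim (use that seq_suble[OF sm] in \<open>auto intro!: N intro: order_trans\<close>)
  qed simp
  have "sq_integrable M (\<lambda>x. f (N 1) x - (f (N 1) x - g x))"
    by (rule sq_integrable_diff[OF f]) (use close[of 1 "N 1"] in simp)
  then have "sq_integrable M g" by simp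
  moreover have "(\<lambda>n. \<integral>x. (f n x - g x)\<^sup>2 \<partial>M) \<longlonglongrightarrow> 0"
  proof (rule LIMSEQ_I)
    fix e :: real assume "e > 0"
    then have "\<forall>n\<ge>N (e/2). norm ((\<integral>x. (f n x - g x)\<^sup>2 \<partial>M) - 0) < e"
      using close[of "e/2"] by (fastforce simp: le_less_trans)
    then show "\<exists>N. \<forall>n\<ge>N. norm ((\<integral>x. (f n x - g x)\<^sup>2 \<partial>M) - 0) < e" by blast
  qed
  ultimately show thesis using that sm lim by blast
qed

section \<open>Lebesgue measure on a product\<close>

lemma AE_lebesgue_fst:
  fixes P :: "'a::euclidean_space \<Rightarrow> bool"
  assumes "AE x in lebesgue. P x"
  shows "AE z in (lebesgue :: ('a \<times> 'b::euclidean_space) measure). P (fst z)"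
proof -
  have "AE x in lborel. P x" using assms by (simp add: AE_completion_iff)
  then obtain N where N: "N \<in> null_sets lborel" "{x \<in> space lborel. \<not> P x} \<subseteq> N"
    by (auto simp: eventually_ae_filter)
  have "N \<times> (UNIV :: 'b set) \<in> null_sets (lborel \<Otimes>\<^sub>M lborel)"
    using N(1) by (intro lborel.times_in_null_sets1) auto
  then have "N \<times> (UNIV :: 'b set) \<in> null_sets lborel" by (simp add: lborel_prod)
  then have "AE z in (lborel :: ('a \<times> 'b) measure). P (fst z)"
    by (rule AE_I') (use N in auto)
  then show ?thesis by (rule AE_completion)
qed

lemma AE_lebesgue_snd:
  fixes P :: "'b::euclidean_space \<Rightarrow> bool"
  assumes "AE x in lebesgue. P x"
  shows "AE z in (lebesgue :: ('a::euclidean_space \<times> 'b) measure). P (snd z)"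
proof -
  have "AE x in lborel. P x" using assms by (simp add: AE_completion_iff)
  then obtain N where N: "N \<in> null_sets lborel" "{x \<in> space lborel. \<not> P x} \<subseteq> N"
    by (auto simp: eventually_ae_filter)
  have "(UNIV :: 'a set) \<times> N \<in> null_sets (lborel \<Otimes>\<^sub>M lborel)"
    using N(1) by (intro lborel.times_in_null_sets2) auto
  then have "(UNIV :: 'a set) \<times> N \<in> null_sets lborel" by (simp add: lborel_prod)
  then have "AE z in (lborel :: ('a \<times> 'b) measure). P (snd z)"
    by (rule AE_I') (use N in auto)
  then show ?thesis by (rule AE_completion)
qed

lemma borel_measurable_lebesgue_AE_cong:
  fixes f g :: "'a::euclidean_space \<Rightarrow> real"
  assumes f: "f \<in> borel_measurable lebesgue" and ae: "AE x in lebesgue. f x = g x"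
  shows "g \<in> borel_measurable lebesgue"
proof (rule measurableI)
  fix A :: "real set" assume A: "A \<in> sets borel"
  have "AE x in lebesgue. x \<in> f -` A \<longleftrightarrow> x \<in> g -` A"
    using ae by eventually_elim auto
  moreover have "f -` A \<in> sets lebesgue"
    using measurable_sets[OF f A] by simp
  ultimately show "g -` A \<inter> space lebesgue \<in> sets lebesgue"
    by (simp add: completion.in_sets_AE[where A="f -` A"])
qed simp

lemma lebesgue_Borel_representative:
  fixes f :: "'a::euclidean_space \<Rightarrow> real"
  assumes "f \<in> borel_measurable lebesgue"
  obtains g where "g \<in> borel_measurable borel" "AE x in lebesgue. f x = g x"
  using completion_ex_borel_measurable_real[OF assms] AE_completion by auto

lemma borel_measurable_lebesgue_fst:
  fixes f :: "'a::euclidean_space \<Rightarrow> real"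
  assumes "f \<in> borel_measurable lebesgue"
  shows "(\<lambda>z. f (fst z)) \<in> borel_measurable (lebesgue :: ('a \<times> 'b::euclidean_space) measure)"
proof -
  obtain g where g: "g \<in> borel_measurable borel" "AE x in lebesgue. f x = g x"
    using lebesgue_Borel_representative[OF assms] .
  have "(\<lambda>z. g (fst z)) \<in> borel_measurable (borel :: ('a \<times> 'b) measure)"
    using g(1) by (intro measurable_compose[OF _ g(1)]) (simp add: borel_prod[symmetric])
  then have "(\<lambda>z. g (fst z)) \<in> borel_measurable (lebesgue :: ('a \<times> 'b) measure)"
    by (intro measurable_completion) simp
  then show ?thesis
    by (rule borel_measurable_lebesgue_AE_cong)
      (use AE_lebesgue_fst[OF g(2), where 'b='b] in \<open>auto elim: eventually_mono\<close>)
qed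

lemma borel_measurable_lebesgue_snd:
  fixes f :: "'b::euclidean_space \<Rightarrow> real"
  assumes "f \<in> borel_measurable lebesgue"
  shows "(\<lambda>z. f (snd z)) \<in> borel_measurable (lebesgue :: ('a::euclidean_space \<times> 'b) measure)"
proof -
  obtain g where g: "g \<in> borel_measurable borel" "AE x in lebesgue. f x = g x"
    using lebesgue_Borel_representative[OF assms] .
  have "(\<lambda>z. g (snd z)) \<in> borel_measurable (borel :: ('a \<times> 'b) measure)"
    using g(1) by (intro measurable_compose[OF _ g(1)]) (simp add: borel_prod[symmetric])
  then have "(\<lambda>z. g (snd z)) \<in> borel_measurable (lebesgue :: ('a \<times> 'b) measure)"
    by (intro measurable_completion) simp
  then show ?thesis
    by (rule borel_measurable_lebesgue_AE_cong)
      (use AE_lebesgue_snd[OF g(2), where 'a='a] in \<open>auto elim: eventually_mono\<close>)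
qed

text \<open>Lebesgue measure on a product is the completion of the product of the Lebesgue measures, so
Fubini's theorem has to be applied to Borel representatives. The energy estimates below only meet
integrands that are sums of such tensor products.\<close>

lemma lebesgue_integral_tensor:
  fixes f :: "'a::euclidean_space \<Rightarrow> real" and g :: "'b::euclidean_space \<Rightarrow> real"
  assumes f: "integrable lebesgue f" and g: "integrable lebesgue g"
  shows "integrable lebesgue (\<lambda>z. f (fst z) * g (snd z))"
    and "(\<integral>z. f (fst z) * g (snd z) \<partial>lebesgue) = (\<integral>x. f x \<partial>lebesgue) * (\<integral>y. g y \<partial>lebesgue)"
proof -
  obtain f' where f': "f' \<in> borel_measurable borel" "AE x in lebesgue. f x = f' x"
    using lebesgue_Borel_representative f by blast
  obtain g' where g': "g' \<in> borel_measurable borel" "AE x in lebesgue. g x = g' x"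
    using lebesgue_Borel_representative g by blast
  have [measurable]: "f' \<in> borel_measurable lborel" "g' \<in> borel_measurable lborel"
    using f' g' by auto
  have meas: "(\<lambda>z. f (fst z) * g (snd z)) \<in> borel_measurable lebesgue"
    using f g by (intro borel_measurable_times borel_measurable_lebesgue_fst borel_measurable_lebesgue_snd) auto
  have if': "integrable lborel f'" "integral\<^sup>L lborel f' = integral\<^sup>L lebesgue f"
    using f f' integrable_cong_AE[of f lebesgue f'] integral_cong_AE[of f lebesgue f']
    by (auto simp: integrable_completion integral_completion measurable_completion)
  have ig': "integrable lborel g'" "integral\<^sup>L lborel g' = integral\<^sup>L lebesgue g"
    using g g' integrable_cong_AE[of g lebesgue g'] integral_cong_AE[of g lebesgue g']
    by (auto simp: integrable_completion integral_completion measurable_completion)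
  let ?h = "\<lambda>z. f' (fst z) * g' (snd z)"
  have ae: "AE z in lebesgue. f (fst z) * g (snd z) = ?h z"
    using AE_lebesgue_fst[OF f'(2), where 'b='b] AE_lebesgue_snd[OF g'(2), where 'a='a]
    by eventually_elim simp
  have i: "integrable (lborel \<Otimes>\<^sub>M lborel) ?h"
  proof (rule lborel_pair.Fubini_integrable)
    show "integrable lborel (\<lambda>x. \<integral>y. norm (?h (x, y)) \<partial>lborel)"
      using if' ig' by (simp add: abs_mult)
  qed (use if' ig' in auto)
  have "(\<integral>x. \<integral>y. ?h (x, y) \<partial>lborel \<partial>lborel) = integral\<^sup>L (lborel \<Otimes>\<^sub>M lborel) ?h"
    by (rule lborel_pair.integral_fst'[OF i])
  then have e: "integral\<^sup>L (lborel \<Otimes>\<^sub>M lborel) ?h = integral\<^sup>L lebesgue f * integral\<^sup>L lebesgue g"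
    using if' ig' by simp
  have i': "integrable lborel ?h" and e': "integral\<^sup>L lborel ?h = integral\<^sup>L lebesgue f * integral\<^sup>L lebesgue g"
    using i e by (simp_all add: lborel_prod)
  have il: "integrable lebesgue ?h" 
    using i' by (simp add: integrable_completion)
  show "integrable lebesgue (\<lambda>z. f (fst z) * g (snd z))"
    using integrable_cong_AE[OF meas _ ae] il by auto
  show "(\<integral>z. f (fst z) * g (snd z) \<partial>lebesgue) = (\<integral>x. f x \<partial>lebesgue) * (\<integral>y. g y \<partial>lebesgue)"
    using integral_cong_AE[OF meas _ ae] il e' i' by (simp add: integral_completion)
qed

section \<open>The fractional Sobolev space\<close>

text \<open>A square root of the energy density. It is linear in \<open>u\<close> and turns the inner product of the
fractional Sobolev space into an \<open>L\<^sup>2\<close> inner product; on the diagonal it is \<open>0\<close>.\<close>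

definition gagliardo :: "real \<Rightarrow> ('a::euclidean_space \<Rightarrow> real) \<Rightarrow> 'a \<times> 'a \<Rightarrow> real" where
  "gagliardo s u z = (u (fst z) - u (snd z)) / norm (fst z - snd z) powr ((real DIM('a) + 2 * s) / 2)"

lemma gagliardo_mult:
  fixes u v :: "'a::euclidean_space \<Rightarrow> real"
  shows "gagliardo s u z * gagliardo s v z =
    (u (fst z) - u (snd z)) * (v (fst z) - v (snd z)) / norm (fst z - snd z) powr (real DIM('a) + 2 * s)"
proof -
  have "norm (fst z - snd z) powr (real DIM('a) + 2 * s) =
     norm (fst z - snd z) powr ((real DIM('a) + 2 * s) / 2) * norm (fst z - snd z) powr ((real DIM('a) + 2 * s) / 2)"
    by (simp flip: powr_add)
  then show ?thesis by (simp add: gagliardo_def)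
qed

lemma gagliardo_add: "gagliardo s (\<lambda>x. u x + v x) z = gagliardo s u z + gagliardo s v z"
  and gagliardo_diff: "gagliardo s (\<lambda>x. u x - v x) z = gagliardo s u z - gagliardo s v z"
  and gagliardo_cmult: "gagliardo s (\<lambda>x. c * u x) z = c * gagliardo s u z"
  by (simp_all add: gagliardo_def add_divide_distrib diff_divide_distrib algebra_simps)

lemma gagliardo_measurable:
  fixes u :: "'a::euclidean_space \<Rightarrow> real"
  assumes "u \<in> borel_measurable lebesgue"
  shows "gagliardo s u \<in> borel_measurable lebesgue"
proof -
  have "(\<lambda>z::'a\<times>'a. norm (fst z - snd z) powr ((real DIM('a) + 2 * s) / 2)) \<in> borel_measurable borel"
    by (simp add: borel_prod[symmetric])
  then have "(\<lambda>z::'a\<times>'a. norm (fst z - snd z) powr ((real DIM('a) + 2 * s) / 2)) \<in> borel_measurable lebesgue"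
    by (intro measurable_completion) simp
  then show ?thesis unfolding gagliardo_def
    by (intro borel_measurable_divide borel_measurable_diff borel_measurable_lebesgue_fst
        borel_measurable_lebesgue_snd assms)
qed

lemma Hs_iff: "u \<in> Hs s \<longleftrightarrow> sq_integrable lebesgue u \<and> sq_integrable lebesgue (gagliardo s u)"
  using gagliardo_mult[of s u _ u, folded power2_eq_square] gagliardo_measurable[of u s]
  by (auto simp: Hs_def sq_integrable_def case_prod_unfold)

lemma H0s_inner_gagliardo:
  "H0s_inner s u v = (\<integral>z. gagliardo s u z * gagliardo s v z \<partial>lebesgue)"
  by (simp add: H0s_inner_def gagliardo_mult case_prod_unfold)

lemma H0s_inner_self: "H0s_inner s u u = (\<integral>z. (gagliardo s u z)\<^sup>2 \<partial>lebesgue)"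
  by (simp add: H0s_inner_gagliardo power2_eq_square)

lemma H0s_inner_commute: "H0s_inner s u v = H0s_inner s v u"
  by (simp add: H0s_inner_gagliardo mult.commute)

lemma H0s_inner_nonneg: "0 \<le> H0s_inner s u u"
  by (simp add: H0s_inner_self)

lemma gagliardo_AE_cong:
  assumes "AE x in lebesgue. u x = v x"
  shows "AE z in lebesgue. gagliardo s u z = gagliardo s v z"
  using AE_lebesgue_fst[OF assms] AE_lebesgue_snd[OF assms]
  by eventually_elim (simp add: gagliardo_def)

lemma H0s_inner_cong:
  assumes "u \<in> borel_measurable lebesgue" "v \<in> borel_measurable lebesgue" "w \<in> borel_measurable lebesgue"
    and "AE x in lebesgue. u x = v x"
  shows "H0s_inner s u w = H0s_inner s v w"
proof -
  have [measurable]: "gagliardo s u \<in> borel_measurable lebesgue" "gagliardo s v \<in> borel_measurable lebesgue"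
    "gagliardo s w \<in> borel_measurable lebesgue"
    using assms gagliardo_measurable by auto
  show ?thesis unfolding H0s_inner_gagliardo
    using gagliardo_AE_cong[OF assms(4), of s]
    by (intro integral_cong_AE borel_measurable_times) (auto elim: eventually_mono)
qed

text \<open>The pointwise form of the fact that absolute values do not increase the energy.\<close>

lemma gagliardo_abs_le: "(gagliardo s (\<lambda>x. \<bar>w x\<bar>) z)\<^sup>2 \<le> (gagliardo s w z)\<^sup>2"
proof -
  have "\<bar>\<bar>w (fst z)\<bar> - \<bar>w (snd z)\<bar>\<bar> \<le> \<bar>w (fst z) - w (snd z)\<bar>" by (rule abs_triangle_ineq3)
  then have "\<bar>gagliardo s (\<lambda>x. \<bar>w x\<bar>) z\<bar> \<le> \<bar>gagliardo s w z\<bar>"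
    by (simp add: gagliardo_def abs_divide divide_right_mono)
  then show ?thesis by (simp add: abs_le_square_iff)
qed

lemma H0s_D:
  assumes "u \<in> H0s \<Omega> s"
  shows "sq_integrable lebesgue u" "sq_integrable lebesgue (gagliardo s u)"
    "AE x in lebesgue. x \<notin> \<Omega> \<longrightarrow> u x = 0" "u \<in> borel_measurable lebesgue"
  using assms by (auto simp: H0s_def Hs_iff)

lemma H0s_I:
  "sq_integrable lebesgue u \<Longrightarrow> sq_integrable lebesgue (gagliardo s u) \<Longrightarrow>
    AE x in lebesgue. x \<notin> \<Omega> \<longrightarrow> u x = 0 \<Longrightarrow> u \<in> H0s \<Omega> s"
  by (auto simp: H0s_def Hs_iff)

text \<open>Every closure property of the space reduces to dominating a function and its
increments pointwise by those of members.\<close>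

lemma H0s_Lipschitz_image:
  assumes u: "u \<in> H0s \<Omega> s" and v: "v \<in> H0s \<Omega> s" and w: "w \<in> borel_measurable lebesgue"
    and bd: "\<And>x. \<bar>w x\<bar> \<le> a * \<bar>u x\<bar> + b * \<bar>v x\<bar>"
    and lip: "\<And>x y. \<bar>w x - w y\<bar> \<le> a * \<bar>u x - u y\<bar> + b * \<bar>v x - v y\<bar>"
  shows "w \<in> H0s \<Omega> s"
proof (rule H0s_I)
  show "sq_integrable lebesgue w"
    by (rule sq_integrable_bound[OF H0s_D(1)[OF u] H0s_D(1)[OF v] w AE_I2[OF bd]])
  have "\<bar>gagliardo s w z\<bar> \<le> a * \<bar>gagliardo s u z\<bar> + b * \<bar>gagliardo s v z\<bar>" for z
    using divide_right_mono[OF lip[of "fst z" "snd z"], of "norm (fst z - snd z) powr ((real DIM('a) + 2 * s) / 2)"]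
    by (simp add: gagliardo_def abs_divide add_divide_distrib)
  then show "sq_integrable lebesgue (gagliardo s w)"
    by (intro sq_integrable_bound[OF H0s_D(2)[OF u] H0s_D(2)[OF v]] gagliardo_measurable w AE_I2)
  show "AE x in lebesgue. x \<notin> \<Omega> \<longrightarrow> w x = 0"
    using H0s_D(3)[OF u] H0s_D(3)[OF v]
  proof eventually_elim
    case (elim x)
    then show ?case using bd[of x] by auto
  qed
qed

lemma H0s_cong:
  assumes "u \<in> H0s \<Omega> s" "AE x in lebesgue. u x = v x"
  shows "v \<in> H0s \<Omega> s"
proof (rule H0s_I)
  note u = H0s_D[OF assms(1)]
  have v: "v \<in> borel_measurable lebesgue"
    using borel_measurable_lebesgue_AE_cong[OF u(4) assms(2)] .
  show "sq_integrable lebesgue v"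
    by (rule sq_integrable_bound[OF u(1) u(1) v, of 1 0]) (use assms(2) in \<open>auto elim: eventually_mono\<close>)
  show "sq_integrable lebesgue (gagliardo s v)"
    by (rule sq_integrable_bound[OF u(2) u(2) gagliardo_measurable[OF v], where a = 1 and b = 0])
      (use gagliardo_AE_cong[OF assms(2), of s] in \<open>auto elim: eventually_mono\<close>)
  show "AE x in lebesgue. x \<notin> \<Omega> \<longrightarrow> v x = 0"
    using u(3) assms(2) by eventually_elim auto
qed

lemma H0s_add: "u \<in> H0s \<Omega> s \<Longrightarrow> v \<in> H0s \<Omega> s \<Longrightarrow> (\<lambda>x. u x + v x) \<in> H0s \<Omega> s"
  by (rule H0s_Lipschitz_image[of u \<Omega> s v _ 1 1]) (auto intro: borel_measurable_add H0s_D(4))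

lemma H0s_diff: "u \<in> H0s \<Omega> s \<Longrightarrow> v \<in> H0s \<Omega> s \<Longrightarrow> (\<lambda>x. u x - v x) \<in> H0s \<Omega> s"
  by (rule H0s_Lipschitz_image[of u \<Omega> s v _ 1 1]) (auto intro: borel_measurable_diff H0s_D(4))

lemma H0s_cmult: "u \<in> H0s \<Omega> s \<Longrightarrow> (\<lambda>x. c * u x) \<in> H0s \<Omega> s"
  by (rule H0s_Lipschitz_image[of u \<Omega> s u _ "\<bar>c\<bar>" 0])
    (auto intro: borel_measurable_times H0s_D(4) simp: abs_mult simp flip: right_diff_distrib)

lemma H0s_abs: "u \<in> H0s \<Omega> s \<Longrightarrow> (\<lambda>x. \<bar>u x\<bar>) \<in> H0s \<Omega> s"
  by (rule H0s_Lipschitz_image[of u \<Omega> s u _ 1 0]) (auto intro: borel_measurable_abs H0s_D(4))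

lemma H0s_pos_part: "u \<in> H0s \<Omega> s \<Longrightarrow> (\<lambda>x. max 0 (u x)) \<in> H0s \<Omega> s"
  by (rule H0s_Lipschitz_image[of u \<Omega> s u _ 1 0]) (auto intro: borel_measurable_max H0s_D(4))

lemma gagliardo_mult_integrable:
  "u \<in> H0s \<Omega> s \<Longrightarrow> v \<in> H0s \<Omega> s \<Longrightarrow> integrable lebesgue (\<lambda>z. gagliardo s u z * gagliardo s v z)"
  by (intro sq_integrable_mult_integrable H0s_D(2))

lemma H0s_inner_add:
  "u \<in> H0s \<Omega> s \<Longrightarrow> v \<in> H0s \<Omega> s \<Longrightarrow> w \<in> H0s \<Omega> s \<Longrightarrow>
   H0s_inner s (\<lambda>x. u x + v x) w = H0s_inner s u w + H0s_inner s v w"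
  by (simp add: H0s_inner_gagliardo gagliardo_add distrib_right gagliardo_mult_integrable)

lemma H0s_inner_diff:
  "u \<in> H0s \<Omega> s \<Longrightarrow> v \<in> H0s \<Omega> s \<Longrightarrow> w \<in> H0s \<Omega> s \<Longrightarrow>
   H0s_inner s (\<lambda>x. u x - v x) w = H0s_inner s u w - H0s_inner s v w"
  by (simp add: H0s_inner_gagliardo gagliardo_diff left_diff_distrib gagliardo_mult_integrable)

lemma H0s_inner_cmult: "H0s_inner s (\<lambda>x. c * u x) w = c * H0s_inner s u w"
  by (simp add: H0s_inner_gagliardo gagliardo_cmult mult.assoc)

lemma H0s_inner_perturb:
  assumes "u \<in> H0s \<Omega> s" "v \<in> H0s \<Omega> s"
  shows "H0s_inner s (\<lambda>x. u x + t * v x) (\<lambda>x. u x + t * v x) =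
    H0s_inner s u u + 2 * t * H0s_inner s u v + t\<^sup>2 * H0s_inner s v v"
proof -
  have "H0s_inner s (\<lambda>x. u x + t * v x) (\<lambda>x. u x + t * v x) =
    (\<integral>z. gagliardo s u z * gagliardo s u z + 2 * t * (gagliardo s u z * gagliardo s v z)
      + t\<^sup>2 * (gagliardo s v z * gagliardo s v z) \<partial>lebesgue)"
    by (simp add: H0s_inner_gagliardo gagliardo_add gagliardo_cmult algebra_simps power2_eq_square)
  also have "\<dots> = H0s_inner s u u + 2 * t * H0s_inner s u v + t\<^sup>2 * H0s_inner s v v"
    by (simp add: H0s_inner_gagliardo gagliardo_mult_integrable[OF assms(1,1)]
        gagliardo_mult_integrable[OF assms] gagliardo_mult_integrable[OF assms(2,2)])
  finally show ?thesis .
qed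

lemma H0s_inner_diff_le:
  assumes "u \<in> H0s \<Omega> s" "v \<in> H0s \<Omega> s"
  shows "H0s_inner s (\<lambda>x. u x - v x) (\<lambda>x. u x - v x) \<le> 2 * H0s_inner s u u + 2 * H0s_inner s v v"
  using H0s_inner_perturb[OF assms, of "-1"] H0s_inner_perturb[OF assms, of 1]
    H0s_inner_nonneg[of s "\<lambda>x. u x + v x"]
  by simp

locale fractional_domain =
  fixes \<Omega> :: "'a::euclidean_space set" and s :: real
  assumes s_pos: "0 < s" and s_lt_1: "s < 1"
    and open_\<Omega>: "open \<Omega>" and bounded_\<Omega>: "bounded \<Omega>"
begin

abbreviation "V \<equiv> H0s \<Omega> s"
abbreviation "B \<equiv> H0s_inner s"

section \<open>Poincare inequality\<close>

text \<open>A function of the space vanishes on a unit ball \<open>E\<close> placed outside \<open>\<Omega>\<close>. The pairs in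
\<open>\<Omega> \<times> E\<close> alone already contribute a multiple of the integral of \<open>u\<^sup>2\<close> to the energy, because their
distance is bounded.\<close>

lemma Poincare:
  obtains C where "C > 0" "\<And>u. u \<in> V \<Longrightarrow> (\<integral>x. (u x)\<^sup>2 \<partial>lebesgue) \<le> C * B u u"
proof -
  obtain R where R: "R > 0" "\<Omega> \<subseteq> ball 0 R"
    using bounded_subset_ballD[OF bounded_\<Omega>, of 0] by auto
  obtain b :: 'a where b: "b \<in> Basis" using nonempty_Basis by blast
  define E where "E = ball ((R + 1) *\<^sub>R b) 1"
  have E: "R \<le> norm y" "norm y \<le> R + 2" if "y \<in> E" for y
  proof -
    have "norm ((R + 1) *\<^sub>R b) = R + 1" using R b by simp
    then show "R \<le> norm y" "norm y \<le> R + 2"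
      using that norm_triangle_ineq2[of "(R + 1) *\<^sub>R b" y] norm_triangle_ineq3[of "(R + 1) *\<^sub>R b" y]
      unfolding E_def mem_ball dist_norm by linarith+
  qed
  define p where "p = real DIM('a) + 2 * s"
  have p: "p > 0" using s_pos by (simp add: p_def add_nonneg_pos)
  define D where "D = (2 * R + 2) powr p"
  have D: "D > 0" using R by (simp add: D_def)
  have mE: "measure lebesgue E > 0" "E \<in> lmeasurable"
    unfolding E_def using content_ball_pos[of 1] by auto
  have main: "measure lebesgue E * (\<integral>x. (u x)\<^sup>2 \<partial>lebesgue) \<le> D * B u u" if u: "u \<in> V" for u
  proof -
    note u' = H0s_D[OF u]
    have iu: "integrable lebesgue (\<lambda>x. (u x)\<^sup>2)" "integrable lebesgue (indicator E :: 'a \<Rightarrow> real)"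
      using u'(1) mE(2) by (auto simp: sq_integrable_def fmeasurable_def less_top)
    have "(\<integral>x. (u x)\<^sup>2 \<partial>lebesgue) * measure lebesgue E
      = (\<integral>z. (u (fst z))\<^sup>2 * indicator E (snd z) \<partial>lebesgue)"
      using lebesgue_integral_tensor(2)[OF iu] by simp
    also have "\<dots> \<le> (\<integral>z. D * (gagliardo s u z)\<^sup>2 \<partial>lebesgue)"
    proof (rule integral_mono_AE)
      show "integrable lebesgue (\<lambda>z. (u (fst z))\<^sup>2 * indicator E (snd z))"
        by (rule lebesgue_integral_tensor(1)[OF iu])
      show "integrable lebesgue (\<lambda>z. D * (gagliardo s u z)\<^sup>2)"
        using u'(2) by (simp add: sq_integrable_def)
      show "AE z in lebesgue. (u (fst z))\<^sup>2 * indicator E (snd z) \<le> D * (gagliardo s u z)\<^sup>2"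
        using AE_lebesgue_fst[OF u'(3), where 'b='a] AE_lebesgue_snd[OF u'(3), where 'a='a]
      proof eventually_elim
        case (elim z)
        show ?case
        proof (cases "fst z \<in> \<Omega> \<and> snd z \<in> E")
          case True
          then have x: "norm (fst z) < R" using R by auto
          have y: "R \<le> norm (snd z)" "norm (snd z) \<le> R + 2" using E True by auto
          then have "snd z \<notin> \<Omega>" using R by auto
          then have "u (snd z) = 0" using elim by simp
          then have g: "(gagliardo s u z)\<^sup>2 = (u (fst z))\<^sup>2 / norm (fst z - snd z) powr p"
            using gagliardo_mult[of s u z u] by (simp add: p_def power2_eq_square)
          have pos: "norm (fst z - snd z) > 0" using x y by auto
          have "norm (fst z - snd z) \<le> 2 * R + 2"
            using x y norm_triangle_ineq4[of "fst z" "snd z"] by linarith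
          then have "norm (fst z - snd z) powr p \<le> D"
            unfolding D_def using p by (intro powr_mono2) auto
          then have "(u (fst z))\<^sup>2 * norm (fst z - snd z) powr p \<le> (u (fst z))\<^sup>2 * D"
            by (intro mult_left_mono) auto
          then show ?thesis using True pos by (simp add: g field_simps)
        next
          case False
          then show ?thesis using elim D by (auto simp: indicator_def)
        qed
      qed
    qed
    also have "\<dots> = D * B u u" by (simp add: H0s_inner_self)
    finally show ?thesis by (simp add: mult.commute)
  qed
  show thesis
  proof (rule that[of "D / measure lebesgue E"])
    show "D / measure lebesgue E > 0" using D mE by simp
    show "(\<integral>x. (u x)\<^sup>2 \<partial>lebesgue) \<le> D / measure lebesgue E * B u u" if "u \<in> V" for u
      using main[OF that] mE(1) by (simp add: field_simps)
  qed
qed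

lemma H0s_inner_zero_imp:
  assumes u: "u \<in> V" and "B u u = 0"
  shows "AE x in lebesgue. u x = 0"
proof -
  have i: "integrable lebesgue (\<lambda>x. (u x)\<^sup>2)" using H0s_D(1)[OF u] by (simp add: sq_integrable_def)
  have "(\<integral>x. (u x)\<^sup>2 \<partial>lebesgue) \<le> 0"
    using Poincare u assms(2) by (metis mult_zero_right)
  then have "(\<integral>x. (u x)\<^sup>2 \<partial>lebesgue) = 0"
    by (meson Bochner_Integration.integral_nonneg antisym zero_le_power2)
  then show ?thesis using integral_nonneg_eq_0_iff_AE[OF i] by simp
qed

end

section \<open>Dyadic cells\<close>

text \<open>The fibres of \<open>cell m\<close> are the half-open dyadic cubes of side \<open>1 / 2 ^ m\<close>; the value labels
the cube by \<open>2 ^ m\<close> times its lower corner. Using this map avoids a separate index set for the grid.\<close>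

definition cell :: "nat \<Rightarrow> 'a::euclidean_space \<Rightarrow> 'a" where
  "cell m x = (\<Sum>b\<in>Basis. of_int \<lfloor>2 ^ m * (x \<bullet> b)\<rfloor> *\<^sub>R b)"

lemma cell_inner: "b \<in> Basis \<Longrightarrow> cell m x \<bullet> b = of_int \<lfloor>2 ^ m * (x \<bullet> b)\<rfloor>"
  by (simp add: cell_def inner_sum_left inner_Basis if_distrib sum.delta cong: if_cong)

lemma cell_measurable [measurable]: "(cell m :: 'a::euclidean_space \<Rightarrow> 'a) \<in> borel_measurable borel"
  unfolding cell_def by measurable

lemma cell_preimage_measurable: "{x::'a::euclidean_space. cell m x = p} \<in> sets borel"
  by measurable

lemma cell_diameter:
  fixes x y :: "'a::euclidean_space"
  assumes "cell m x = cell m y"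
  shows "norm (x - y) \<le> real DIM('a) / 2 ^ m"
proof -
  have "\<bar>(x - y) \<bullet> b\<bar> \<le> 1 / 2 ^ m" if "b \<in> Basis" for b
  proof -
    have "\<lfloor>2 ^ m * (x \<bullet> b)\<rfloor> = \<lfloor>2 ^ m * (y \<bullet> b)\<rfloor>"
      using cell_inner[OF that, of m x] cell_inner[OF that, of m y] assms by simp
    then have "\<bar>2 ^ m * (x \<bullet> b) - 2 ^ m * (y \<bullet> b)\<bar> \<le> 1" by linarith
    then have "2 ^ m * \<bar>(x - y) \<bullet> b\<bar> \<le> 1"
      by (simp add: inner_diff_left abs_mult flip: right_diff_distrib)
    then show ?thesis by (simp add: field_simps)
  qed
  then have "(\<Sum>b\<in>Basis. \<bar>(x - y) \<bullet> b\<bar>) \<le> (\<Sum>b\<in>(Basis::'a set). 1 / 2 ^ m)"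
    by (intro sum_mono) auto
  then show ?thesis using norm_le_l1[of "x - y"] by simp
qed

lemma finite_cells:
  fixes S :: "'a::euclidean_space set"
  assumes "bounded S"
  shows "finite (cell m ` S)"
proof -
  obtain R where R: "\<And>x. x \<in> S \<Longrightarrow> norm x \<le> R" using assms by (auto simp: bounded_iff)
  define K where "K = \<lceil>2 ^ m * \<bar>R\<bar>\<rceil> + 1"
  define F where "F = (Basis :: 'a set) \<rightarrow>\<^sub>E {-K..K}"
  have "finite F" unfolding F_def by (intro finite_PiE) auto
  have "cell m ` S \<subseteq> (\<lambda>f. \<Sum>b\<in>Basis. of_int (f b) *\<^sub>R b) ` F"
  proof safe
    fix x assume x: "x \<in> S"
    let ?f = "\<lambda>b\<in>Basis. \<lfloor>2 ^ m * (x \<bullet> b)\<rfloor>"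
    have "\<lfloor>2 ^ m * (x \<bullet> b)\<rfloor> \<in> {-K..K}" if "b \<in> Basis" for b
    proof -
      have "\<bar>2 ^ m * (x \<bullet> b)\<bar> \<le> 2 ^ m * \<bar>R\<bar>"
        using Basis_le_norm[OF that, of x] R[OF x] by (simp add: abs_mult)
      then have "2 ^ m * (x \<bullet> b) \<le> 2 ^ m * \<bar>R\<bar>" "- (2 ^ m * (x \<bullet> b)) \<le> 2 ^ m * \<bar>R\<bar>"
        by linarith+
      then show ?thesis unfolding K_def atLeastAtMost_iff by linarith
    qed
    then have "?f \<in> F" by (auto simp: F_def)
    moreover have "cell m x = (\<Sum>b\<in>Basis. of_int (?f b) *\<^sub>R b)" by (simp add: cell_def)
    ultimately show "cell m x \<in> (\<lambda>f. \<Sum>b\<in>Basis. of_int (f b) *\<^sub>R b) ` F" by blast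
  qed
  with \<open>finite F\<close> show ?thesis using finite_surj by blast
qed

lemma cell_lmeasurable: "{x::'a::euclidean_space. cell m x = p} \<in> lmeasurable"
proof -
  have "bounded {x::'a. cell m x = p}"
  proof (cases "{x::'a. cell m x = p} = {}")
    case False
    then obtain y :: 'a where y: "cell m y = p" by blast
    show ?thesis
    proof (rule boundedI)
      fix x :: 'a assume "x \<in> {x. cell m x = p}"
      then show "norm x \<le> real DIM('a) / 2 ^ m + norm y"
        using y cell_diameter[of m x y] norm_triangle_ineq2[of x y] by simp
    qed
  qed simp
  then show ?thesis
    using bounded_set_imp_lmeasurable cell_preimage_measurable by fastforce
qed

lemma cell_content_ge:
  "measure lebesgue {x. cell m x = cell m (y::'a::euclidean_space)} \<ge> 1 / 2 ^ (m * DIM('a))"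
proof -
  define c where "c = (1 / 2 ^ m) *\<^sub>R cell m y"
  have sub: "box c (c + (1 / 2 ^ m) *\<^sub>R One) \<subseteq> {x. cell m x = cell m y}"
  proof
    fix x assume x: "x \<in> box c (c + (1 / 2 ^ m) *\<^sub>R One)"
    have "of_int \<lfloor>2 ^ m * (x \<bullet> b)\<rfloor> *\<^sub>R b = (of_int \<lfloor>2 ^ m * (y \<bullet> b)\<rfloor> *\<^sub>R b :: 'a)" if b: "b \<in> Basis" for b
    proof -
      have "c \<bullet> b < x \<bullet> b" "x \<bullet> b < c \<bullet> b + 1 / 2 ^ m"
        using x b by (auto simp: mem_box inner_add_left)
      then have "of_int \<lfloor>2 ^ m * (y \<bullet> b)\<rfloor> < 2 ^ m * (x \<bullet> b)" "2 ^ m * (x \<bullet> b) < of_int \<lfloor>2 ^ m * (y \<bullet> b)\<rfloor> + 1"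
        using b by (simp_all add: c_def cell_inner field_simps)
      then have "\<lfloor>2 ^ m * (x \<bullet> b)\<rfloor> = \<lfloor>2 ^ m * (y \<bullet> b)\<rfloor>" by linarith
      then show ?thesis by simp
    qed
    then show "x \<in> {x. cell m x = cell m y}" unfolding cell_def mem_Collect_eq by (rule sum.cong[OF refl])
  qed
  have "measure lebesgue (box c (c + (1 / 2 ^ m) *\<^sub>R One)) = (\<Prod>b\<in>(Basis::'a set). 1 / 2 ^ m)"
    by (simp add: measure_lborel_box_eq inner_add_left inner_diff_left)
  also have "\<dots> = 1 / 2 ^ (m * DIM('a))" by (simp add: power_one_over power_mult)
  finally show ?thesis
    using measure_mono_fmeasurable[OF sub _ cell_lmeasurable] by simp
qed

context fractional_domain
begin

section \<open>Compactness of the embedding into square-integrable functions\<close>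

abbreviation "Q m p \<equiv> (indicator {x. cell m x = p} :: 'a \<Rightarrow> real)"

lemma cell_integrable:
  assumes "u \<in> V"
  shows "integrable lebesgue (\<lambda>x. Q m p x * u x)" "integrable lebesgue (\<lambda>x. Q m p x * (u x)\<^sup>2)"
proof -
  have "sq_integrable lebesgue (Q m p)"
    using cell_lmeasurable[of m p] unfolding sq_integrable_def
    by (auto simp: fmeasurable_def less_top power2_eq_square indicator_inter_arith[symmetric]
        intro!: borel_measurable_indicator)
  then show "integrable lebesgue (\<lambda>x. Q m p x * u x)"
    by (intro sq_integrable_mult_integrable H0s_D(1)[OF assms])
  show "integrable lebesgue (\<lambda>x. Q m p x * (u x)\<^sup>2)"
    using H0s_D(1)[OF assms] cell_lmeasurable[of m p]
    by (auto simp: sq_integrable_def mult.commute intro!: integrable_real_mult_indicator)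
qed

text \<open>Expanding the square gives the variance of \<open>u\<close> on the cell, up to a factor.\<close>

lemma cell_variance:
  assumes "u \<in> V"
  shows "integrable lebesgue (\<lambda>z. Q m p (fst z) * Q m p (snd z) * (u (fst z) - u (snd z))\<^sup>2)"
    and "(\<integral>z. Q m p (fst z) * Q m p (snd z) * (u (fst z) - u (snd z))\<^sup>2 \<partial>lebesgue)
      = 2 * measure lebesgue {x. cell m x = p} * (\<integral>x. Q m p x * (u x)\<^sup>2 \<partial>lebesgue)
        - 2 * (\<integral>x. Q m p x * u x \<partial>lebesgue)\<^sup>2"
proof -
  note iu = cell_integrable[OF assms, of m p]
  have iQ: "integrable lebesgue (Q m p)" "integral\<^sup>L lebesgue (Q m p) = measure lebesgue {x. cell m x = p}"
    using cell_lmeasurable[of m p] by (auto simp: fmeasurable_def less_top)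
  have eq: "Q m p (fst z) * Q m p (snd z) * (u (fst z) - u (snd z))\<^sup>2 =
     (Q m p (fst z) * (u (fst z))\<^sup>2) * Q m p (snd z) + Q m p (fst z) * (Q m p (snd z) * (u (snd z))\<^sup>2)
     - 2 * ((Q m p (fst z) * u (fst z)) * (Q m p (snd z) * u (snd z)))" for z
    by (simp add: power2_eq_square algebra_simps)
  note t = lebesgue_integral_tensor[OF iu(2) iQ(1)] lebesgue_integral_tensor[OF iQ(1) iu(2)]
    lebesgue_integral_tensor[OF iu(1) iu(1)]
  show "integrable lebesgue (\<lambda>z. Q m p (fst z) * Q m p (snd z) * (u (fst z) - u (snd z))\<^sup>2)"
    unfolding eq using t by (intro Bochner_Integration.integrable_diff Bochner_Integration.integrable_add integrable_mult_right) auto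
  show "(\<integral>z. Q m p (fst z) * Q m p (snd z) * (u (fst z) - u (snd z))\<^sup>2 \<partial>lebesgue)
      = 2 * measure lebesgue {x. cell m x = p} * (\<integral>x. Q m p x * (u x)\<^sup>2 \<partial>lebesgue)
        - 2 * (\<integral>x. Q m p x * u x \<partial>lebesgue)\<^sup>2"
    unfolding eq by (simp add: t iQ(2) power2_eq_square[of "integral\<^sup>L lebesgue _"])
qed

text \<open>On pairs from one cell the kernel is at least a negative power of the cell diameter, so the sum of
the variances over the cells is at most the energy times a power of \<open>1 / 2 ^ m\<close>. After division by the
content of a cell a factor \<open>(1/2) powr (2 * s * m)\<close> remains, which tends to \<open>0\<close>
because \<open>s > 0\<close>; the finitely many cell integrals account for the rest.\<close>

lemma L2_le_cell_averages:
  assumes u: "u \<in> V"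
  shows "(\<integral>x. (u x)\<^sup>2 \<partial>lebesgue) \<le>
    real DIM('a) powr (real DIM('a) + 2 * s) * (1/2) powr (2 * s * real m) * B u u
    + 2 ^ (m * DIM('a)) * (\<Sum>p\<in>cell m ` \<Omega>. (\<integral>x. Q m p x * u x \<partial>lebesgue)\<^sup>2)"
proof -
  define P where "P = cell m ` \<Omega>"
  have fP: "finite P" unfolding P_def by (rule finite_cells[OF bounded_\<Omega>])
  define e where "e = real DIM('a) + 2 * s"
  have e: "e > 0" using s_pos by (simp add: e_def add_nonneg_pos)
  define \<delta> where "\<delta> = real DIM('a) / 2 ^ m"
  have \<delta>: "\<delta> > 0" by (simp add: \<delta>_def)
  let ?c = "\<lambda>p. measure lebesgue {x::'a. cell m x = p}"
  let ?I = "\<lambda>p. \<integral>z. Q m p (fst z) * Q m p (snd z) * (u (fst z) - u (snd z))\<^sup>2 \<partial>lebesgue"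
  let ?a = "\<lambda>p. \<integral>x. Q m p x * u x \<partial>lebesgue"
  have "(\<Sum>p\<in>P. ?I p) = (\<integral>z. (\<Sum>p\<in>P. Q m p (fst z) * Q m p (snd z) * (u (fst z) - u (snd z))\<^sup>2) \<partial>lebesgue)"
    by (simp add: cell_variance(1)[OF u])
  also have "\<dots> \<le> (\<integral>z. \<delta> powr e * (gagliardo s u z)\<^sup>2 \<partial>lebesgue)"
  proof (rule integral_mono)
    show "integrable lebesgue (\<lambda>z. \<Sum>p\<in>P. Q m p (fst z) * Q m p (snd z) * (u (fst z) - u (snd z))\<^sup>2)"
      by (simp add: cell_variance(1)[OF u])
    show "integrable lebesgue (\<lambda>z. \<delta> powr e * (gagliardo s u z)\<^sup>2)"
      using H0s_D(2)[OF u] by (simp add: sq_integrable_def)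
    fix z :: "'a \<times> 'a"
    have "(\<Sum>p\<in>P. Q m p (fst z) * Q m p (snd z) * (u (fst z) - u (snd z))\<^sup>2)
       = (\<Sum>p\<in>P. if p = cell m (fst z) then Q m p (snd z) * (u (fst z) - u (snd z))\<^sup>2 else 0)"
      by (intro sum.cong) (auto simp: indicator_def)
    also have "\<dots> \<le> Q m (cell m (fst z)) (snd z) * (u (fst z) - u (snd z))\<^sup>2"
      using fP by (auto simp: sum.delta')
    also have "\<dots> \<le> \<delta> powr e * (gagliardo s u z)\<^sup>2"
    proof (cases "cell m (snd z) = cell m (fst z) \<and> fst z \<noteq> snd z")
      case True
      then have "norm (fst z - snd z) powr e \<le> \<delta> powr e"
        using cell_diameter[of m "fst z" "snd z"] e by (intro powr_mono2) (auto simp: \<delta>_def)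
      then have "(u (fst z) - u (snd z))\<^sup>2 * norm (fst z - snd z) powr e \<le> (u (fst z) - u (snd z))\<^sup>2 * \<delta> powr e"
        by (intro mult_left_mono) auto
      moreover have "(gagliardo s u z)\<^sup>2 = (u (fst z) - u (snd z))\<^sup>2 / norm (fst z - snd z) powr e"
        using gagliardo_mult[of s u z u] by (simp add: e_def power2_eq_square)
      moreover have "norm (fst z - snd z) powr e > 0" using True by simp
      ultimately show ?thesis using True by (simp add: pos_le_divide_eq mult.commute)
    next
      case False
      then show ?thesis by (auto simp: indicator_def)
    qed
    finally show "(\<Sum>p\<in>P. Q m p (fst z) * Q m p (snd z) * (u (fst z) - u (snd z))\<^sup>2)
       \<le> \<delta> powr e * (gagliardo s u z)\<^sup>2" .
  qed
  also have "\<dots> = \<delta> powr e * B u u" by (simp add: H0s_inner_self)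
  finally have sumI: "(\<Sum>p\<in>P. ?I p) \<le> \<delta> powr e * B u u" .
  have cellwise: "(\<integral>x. Q m p x * (u x)\<^sup>2 \<partial>lebesgue) \<le> 2 ^ (m * DIM('a)) * (?I p + (?a p)\<^sup>2)" if "p \<in> P" for p
  proof -
    have c: "?c p \<ge> 1 / 2 ^ (m * DIM('a))" using that cell_content_ge[of m] unfolding P_def by blast
    have "?I p \<ge> 0" by (intro Bochner_Integration.integral_nonneg) auto
    then have I: "0 \<le> ?I p + (?a p)\<^sup>2" "?I p / 2 \<le> ?I p" by auto
    have c0: "1 \<le> 2 ^ (m * DIM('a)) * ?c p" using c by (simp add: field_simps)
    have "?c p * (\<integral>x. Q m p x * (u x)\<^sup>2 \<partial>lebesgue) = ?I p / 2 + (?a p)\<^sup>2"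
      unfolding cell_variance(2)[OF u] by (simp add: field_simps)
    also have "\<dots> \<le> ?I p + (?a p)\<^sup>2" using I by simp
    finally have le: "?c p * (\<integral>x. Q m p x * (u x)\<^sup>2 \<partial>lebesgue) \<le> ?I p + (?a p)\<^sup>2" .
    have "(\<integral>x. Q m p x * (u x)\<^sup>2 \<partial>lebesgue) \<ge> 0"
      by (intro Bochner_Integration.integral_nonneg) auto
    then have "(\<integral>x. Q m p x * (u x)\<^sup>2 \<partial>lebesgue) \<le> 2 ^ (m * DIM('a)) * ?c p * (\<integral>x. Q m p x * (u x)\<^sup>2 \<partial>lebesgue)"
      using mult_right_mono[OF c0] by fastforce
    also have "\<dots> \<le> 2 ^ (m * DIM('a)) * (?I p + (?a p)\<^sup>2)"
      using le by (simp add: mult.assoc)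
    finally show ?thesis .
  qed
  have "(\<integral>x. (u x)\<^sup>2 \<partial>lebesgue) = (\<integral>x. (\<Sum>p\<in>P. Q m p x * (u x)\<^sup>2) \<partial>lebesgue)"
  proof (rule integral_cong_AE)
    show "AE x in lebesgue. (u x)\<^sup>2 = (\<Sum>p\<in>P. Q m p x * (u x)\<^sup>2)"
      using H0s_D(3)[OF u]
    proof eventually_elim
      case (elim x)
      have "(\<Sum>p\<in>P. Q m p x * (u x)\<^sup>2) = (\<Sum>p\<in>P. if p = cell m x then (u x)\<^sup>2 else 0)"
        by (intro sum.cong) (auto simp: indicator_def)
      also have "\<dots> = (if cell m x \<in> P then (u x)\<^sup>2 else 0)" using fP by (simp add: sum.delta')
      also have "\<dots> = (u x)\<^sup>2" using elim by (auto simp: P_def)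
      finally show ?case by simp
    qed
    show "(\<lambda>x. (u x)\<^sup>2) \<in> borel_measurable lebesgue" using H0s_D(4)[OF u] by simp
    show "(\<lambda>x. \<Sum>p\<in>P. Q m p x * (u x)\<^sup>2) \<in> borel_measurable lebesgue"
      using cell_integrable(2)[OF u] by (intro borel_measurable_sum) auto
  qed
  also have "\<dots> = (\<Sum>p\<in>P. \<integral>x. Q m p x * (u x)\<^sup>2 \<partial>lebesgue)"
    by (simp add: cell_integrable(2)[OF u])
  also have "\<dots> \<le> (\<Sum>p\<in>P. 2 ^ (m * DIM('a)) * (?I p + (?a p)\<^sup>2))"
    by (intro sum_mono cellwise)
  also have "\<dots> = 2 ^ (m * DIM('a)) * (\<Sum>p\<in>P. ?I p) + 2 ^ (m * DIM('a)) * (\<Sum>p\<in>P. (?a p)\<^sup>2)"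
    by (simp add: sum.distrib distrib_left flip: sum_distrib_left)
  also have "\<dots> \<le> 2 ^ (m * DIM('a)) * (\<delta> powr e * B u u) + 2 ^ (m * DIM('a)) * (\<Sum>p\<in>P. (?a p)\<^sup>2)"
    using sumI by (intro add_right_mono mult_left_mono) auto
  also have "2 ^ (m * DIM('a)) * (\<delta> powr e * B u u) =
     real DIM('a) powr e * (1/2) powr (2 * s * real m) * B u u"
  proof -
    have "\<delta> powr e = real DIM('a) powr e * (1 / 2 ^ m) powr e"
      unfolding \<delta>_def by (simp add: powr_divide powr_one_eq_one)
    also have "(1 / 2 ^ m) powr e = (1/2) powr (real m * e)"
      by (simp add: powr_powr[symmetric] powr_realpow power_one_over)
    also have "real m * e = real (m * DIM('a)) + 2 * s * real m" by (simp add: e_def algebra_simps)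
    also have "(1/2 :: real) powr \<dots> = (1/2) ^ (m * DIM('a)) * (1/2) powr (2 * s * real m)"
      by (simp add: powr_add powr_realpow del: of_nat_mult)
    finally show ?thesis by (simp add: power_one_over)
  qed
  finally show ?thesis by (simp add: P_def e_def)
qed

lemma cell_average_bounded:
  assumes "C > 0" "\<And>u. u \<in> V \<Longrightarrow> (\<integral>x. (u x)\<^sup>2 \<partial>lebesgue) \<le> C * B u u"
    and "u \<in> V" "B u u \<le> D"
  shows "\<bar>\<integral>x. Q m p x * u x \<partial>lebesgue\<bar> \<le> sqrt (measure lebesgue {x::'a. cell m x = p}) * sqrt (C * D)"
proof -
  have Q: "sq_integrable lebesgue (Q m p)" "(\<integral>x. (Q m p x)\<^sup>2 \<partial>lebesgue) = measure lebesgue {x::'a. cell m x = p}"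
    using cell_lmeasurable[of m p] unfolding sq_integrable_def
    by (auto simp: fmeasurable_def less_top power2_eq_square indicator_inter_arith[symmetric]
        intro!: borel_measurable_indicator)
  have "(\<integral>x. (u x)\<^sup>2 \<partial>lebesgue) \<le> C * D"
    using assms by (meson mult_le_cancel_left_pos order_trans)
  then have "sqrt (\<integral>x. (Q m p x)\<^sup>2 \<partial>lebesgue) * sqrt (\<integral>x. (u x)\<^sup>2 \<partial>lebesgue)
      \<le> sqrt (measure lebesgue {x::'a. cell m x = p}) * sqrt (C * D)"
    unfolding Q(2) by (intro mult_left_mono real_sqrt_le_mono real_sqrt_ge_zero measure_nonneg)
  then show ?thesis
    using Cauchy_Schwarz_integral[OF Q(1) H0s_D(1)[OF assms(3)]] by linarith
qed

text \<open>Only countably many cells meet \<open>\<Omega>\<close>, so a diagonal subsequence serves all of them.\<close>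

lemma bounded_cell_averages_subsequence:
  assumes u: "\<And>n. u n \<in> V" and bd: "\<And>n. B (u n) (u n) \<le> D"
  obtains r where "strict_mono (r :: nat \<Rightarrow> nat)"
    "\<forall>m. \<forall>p\<in>cell m ` \<Omega>. convergent (\<lambda>n. \<integral>x. Q m p x * u (r n) x \<partial>lebesgue)"
proof -
  obtain C where C: "C > 0" "\<And>u. u \<in> V \<Longrightarrow> (\<integral>x. (u x)\<^sup>2 \<partial>lebesgue) \<le> C * B u u"
    using Poincare by blast
  define a where "a i n = (\<integral>x. Q (fst i) (snd i) x * u n x \<partial>lebesgue)" for i :: "nat \<times> 'a" and n
  define S where "S = insert (0, 0) (SIGMA m:UNIV. cell m ` \<Omega>)"
  have cS: "countable S" "S \<noteq> {}"
    unfolding S_def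
    by (intro countable_insert countable_SIGMA[OF _ countable_finite[OF finite_cells[OF bounded_\<Omega>]]]) auto
  interpret subseqs "\<lambda>k r. convergent (\<lambda>n. a (from_nat_into S k) (r n))"
  proof
    fix k and r :: "nat \<Rightarrow> nat" assume "strict_mono r"
    have "bounded (range (\<lambda>n. a (from_nat_into S k) (r n)))"
    proof (rule boundedI)
      fix t assume "t \<in> range (\<lambda>n. a (from_nat_into S k) (r n))"
      then obtain n where "t = a (from_nat_into S k) (r n)" by blast
      then show "norm t \<le> sqrt (measure lebesgue {x::'a. cell (fst (from_nat_into S k)) x = snd (from_nat_into S k)})
          * sqrt (C * D)"
        unfolding a_def real_norm_def using cell_average_bounded[OF C u bd] by simp
    qed
    then obtain l q where "strict_mono q" "((\<lambda>n. a (from_nat_into S k) (r n)) \<circ> q) \<longlonglongrightarrow> l"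
      using bounded_imp_convergent_subsequence by blast
    then show "\<exists>q. strict_mono q \<and> convergent (\<lambda>n. a (from_nat_into S k) ((r \<circ> q) n))"
      by (auto simp: convergent_def o_def)
  qed
  show thesis
  proof (rule that[OF subseq_diagseq], intro allI ballI)
    fix m p assume "p \<in> cell m ` \<Omega>"
    then have "(m, p) \<in> S" by (auto simp: S_def)
    then obtain k where k: "from_nat_into S k = (m, p)"
      using from_nat_into_surj[OF cS(1)] by blast
    have "convergent (\<lambda>n. a (from_nat_into S k) ((diagseq \<circ> (+) (Suc k)) n))"
    proof (rule diagseq_holds)
      fix r t n assume "strict_mono (r :: nat \<Rightarrow> nat)" "convergent (\<lambda>i. a (from_nat_into S n) (t i))"
      then show "convergent (\<lambda>i. a (from_nat_into S n) ((t \<circ> r) i))"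
        using convergent_subseq_convergent[of "\<lambda>i. a (from_nat_into S n) (t i)" r] by (simp add: o_def)
    qed
    then have "convergent (\<lambda>n. a (m, p) (diagseq (n + Suc k)))" by (simp add: k add.commute)
    then have "convergent (\<lambda>n. a (m, p) (diagseq n))"
      using convergent_ignore_initial_segment[of "\<lambda>n. a (m, p) (diagseq n)" "Suc k"] by blast
    then show "convergent (\<lambda>n. \<integral>x. Q m p x * u (diagseq n) x \<partial>lebesgue)" by (simp add: a_def)
  qed
qed

text \<open>The compact embedding into \<open>L\<^sup>2\<close>, together with the lower semicontinuity of the energy
along the extracted subsequence.\<close>

theorem Rellich:
  assumes u: "\<And>n. u n \<in> V" and bd: "\<And>n. B (u n) (u n) \<le> D"
  obtains r w where "strict_mono (r :: nat \<Rightarrow> nat)" "w \<in> V"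
    "(\<lambda>n. \<integral>x. (u (r n) x - w x)\<^sup>2 \<partial>lebesgue) \<longlonglongrightarrow> 0"
    "\<forall>E. (\<forall>\<^sub>F n in sequentially. B (u (r n)) (u (r n)) \<le> E) \<longrightarrow> B w w \<le> E"
proof -
  obtain r where r: "strict_mono (r :: nat \<Rightarrow> nat)"
    "\<forall>m. \<forall>p\<in>cell m ` \<Omega>. convergent (\<lambda>n. \<integral>x. Q m p x * u (r n) x \<partial>lebesgue)"
    using bounded_cell_averages_subsequence[where u = u, OF u bd] by blast
  define v where "v n = u (r n)" for n
  have v: "v n \<in> V" "B (v n) (v n) \<le> D" for n using u bd by (auto simp: v_def)
  have D: "D \<ge> 0" using v(2)[of 0] H0s_inner_nonneg[of s "v 0"] by linarith
  have vd: "(\<lambda>x. v i x - v j x) \<in> V" "B (\<lambda>x. v i x - v j x) (\<lambda>x. v i x - v j x) \<le> 4 * D" for i j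
    using H0s_diff[OF v(1) v(1)] H0s_inner_diff_le[OF v(1) v(1), of i j] v(2)[of i] v(2)[of j] by auto
  define K where "K = real DIM('a) powr (real DIM('a) + 2 * s)"
  have cauchy: "\<exists>N. \<forall>i\<ge>N. \<forall>j\<ge>N. (\<integral>x. (v i x - v j x)\<^sup>2 \<partial>lebesgue) \<le> e" if e: "e > 0" for e
  proof -
    have "(\<lambda>m. K * ((1/2) powr (2 * s)) ^ m * (4 * D)) \<longlonglongrightarrow> K * 0 * (4 * D)"
      using s_pos powr_less_mono2[of "2 * s" "1/2" "1::real"]
      by (intro tendsto_intros LIMSEQ_power_zero) auto
    then have "\<forall>\<^sub>F m in sequentially. K * ((1/2) powr (2 * s)) ^ m * (4 * D) < e / 2"
      using e by (intro order_tendstoD(2)) auto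
    then obtain m where "K * ((1/2) powr (2 * s)) ^ m * (4 * D) < e / 2"
      using eventually_happens'[OF sequentially_bot] by blast
    then have m: "K * (1/2) powr (2 * s * real m) * (4 * D) < e / 2"
      by (simp add: powr_powr[symmetric] powr_realpow)
    define a where "a p n = (\<integral>x. Q m p x * v n x \<partial>lebesgue)" for p n
    have a: "\<exists>l. a p \<longlonglongrightarrow> l" if "p \<in> cell m ` \<Omega>" for p
      using r(2) that unfolding convergent_def a_def v_def by blast
    then obtain l where l: "\<And>p. p \<in> cell m ` \<Omega> \<Longrightarrow> a p \<longlonglongrightarrow> l p" by metis
    \<comment> \<open>The summand \<open>1\<close> only makes \<open>c\<close> positive when no cell meets \<open>\<Omega>\<close>.\<close>
    define c where "c = 2 ^ (m * DIM('a)) * (\<Sum>p\<in>cell m ` \<Omega>. (1::real)) + 1"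
    have c: "c > 0" unfolding c_def by (simp add: add_nonneg_pos)
    have "\<forall>\<^sub>F n in sequentially. \<forall>p\<in>cell m ` \<Omega>. \<bar>a p n - l p\<bar> < sqrt (e / (2 * c)) / 2"
    proof (intro eventually_ball_finite ballI)
      fix p assume "p \<in> cell m ` \<Omega>"
      then show "\<forall>\<^sub>F n in sequentially. \<bar>a p n - l p\<bar> < sqrt (e / (2 * c)) / 2"
        using tendstoD[OF l, of p "sqrt (e / (2 * c)) / 2"] e c by (simp add: dist_real_def)
    qed (rule finite_cells[OF bounded_\<Omega>])
    then obtain N where N: "\<And>n p. n \<ge> N \<Longrightarrow> p \<in> cell m ` \<Omega> \<Longrightarrow> \<bar>a p n - l p\<bar> < sqrt (e / (2 * c)) / 2"
      unfolding eventually_sequentially by blast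
    have "(\<integral>x. (v i x - v j x)\<^sup>2 \<partial>lebesgue) \<le> e" if "i \<ge> N" "j \<ge> N" for i j
    proof -
      let ?d = "\<lambda>x. v i x - v j x"
      have "(\<integral>x. Q m p x * ?d x \<partial>lebesgue) = a p i - a p j" for p
        using cell_integrable(1)[OF v(1), of m p] by (simp add: a_def right_diff_distrib)
      moreover have "(a p i - a p j)\<^sup>2 \<le> e / (2 * c)" if "p \<in> cell m ` \<Omega>" for p
      proof -
        have "\<bar>a p i - a p j\<bar> \<le> sqrt (e / (2 * c))"
          using N[OF \<open>i \<ge> N\<close> that] N[OF \<open>j \<ge> N\<close> that] by linarith
        then show ?thesis by (metis power2_abs real_sqrt_le_iff real_sqrt_abs)
      qed
      ultimately have "(\<Sum>p\<in>cell m ` \<Omega>. (\<integral>x. Q m p x * ?d x \<partial>lebesgue)\<^sup>2) \<le> (\<Sum>p\<in>cell m ` \<Omega>. e / (2 * c))"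
        by (intro sum_mono) simp
      then have "2 ^ (m * DIM('a)) * (\<Sum>p\<in>cell m ` \<Omega>. (\<integral>x. Q m p x * ?d x \<partial>lebesgue)\<^sup>2)
         \<le> 2 ^ (m * DIM('a)) * (\<Sum>p\<in>cell m ` \<Omega>. e / (2 * c))"
        by (intro mult_left_mono) auto
      also have "\<dots> = 2 ^ (m * DIM('a)) * (\<Sum>p\<in>cell m ` \<Omega>. 1) * (e / (2 * c))"
        by simp
      also have "\<dots> \<le> c * (e / (2 * c))"
        using e c by (intro mult_right_mono) (auto simp: c_def)
      also have "\<dots> = e / 2" using c by simp
      finally have 1: "2 ^ (m * DIM('a)) * (\<Sum>p\<in>cell m ` \<Omega>. (\<integral>x. Q m p x * ?d x \<partial>lebesgue)\<^sup>2) \<le> e / 2" .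
      have "K * (1/2) powr (2 * s * real m) * B ?d ?d \<le> K * (1/2) powr (2 * s * real m) * (4 * D)"
        by (intro mult_left_mono vd) (auto simp: K_def)
      with 1 m L2_le_cell_averages[OF vd(1), of i j m, folded K_def] show ?thesis by linarith
    qed
    then show ?thesis by blast
  qed
  obtain q w where q: "strict_mono (q :: nat \<Rightarrow> nat)" "sq_integrable lebesgue w"
    "AE x in lebesgue. (\<lambda>n. v (q n) x) \<longlonglongrightarrow> w x" "(\<lambda>n. \<integral>x. (v n x - w x)\<^sup>2 \<partial>lebesgue) \<longlonglongrightarrow> 0"
    using L2_complete[where f = v, OF H0s_D(1)[OF v(1)] cauchy] by blast
  have "AE x in lebesgue. \<forall>n. x \<notin> \<Omega> \<longrightarrow> v (q n) x = 0"
    unfolding AE_all_countable using H0s_D(3)[OF v(1)] by blast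
  with q(3) have w0: "AE x in lebesgue. x \<notin> \<Omega> \<longrightarrow> w x = 0"
  proof eventually_elim
    case (elim x)
    then show ?case using LIMSEQ_unique[of "\<lambda>n. v (q n) x"] by auto
  qed
  have wlim: "AE z in lebesgue. (\<lambda>n. gagliardo s (v (q n)) z) \<longlonglongrightarrow> gagliardo s w z"
    using AE_lebesgue_fst[OF q(3), where 'b='a] AE_lebesgue_snd[OF q(3), where 'a='a]
  proof eventually_elim
    case (elim z)
    then show ?case unfolding gagliardo_def divide_inverse
      by (intro tendsto_mult tendsto_diff tendsto_const)
  qed
  have fatou: "sq_integrable lebesgue (gagliardo s w) \<and> B w w \<le> E"
    if "\<forall>\<^sub>F n in sequentially. B (v (q n)) (v (q n)) \<le> E" for E
    unfolding H0s_inner_self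
    by (rule integral_sq_Fatou[OF _ _ wlim])
      (use that v q(2) in \<open>auto simp: H0s_inner_self intro!: gagliardo_measurable H0s_D(2)[of _ \<Omega>]\<close>)
  show thesis
  proof (rule that[of "r \<circ> q" w])
    show "strict_mono (r \<circ> q)" using r(1) q(1) by (rule strict_mono_o)
    show "w \<in> V"
      using fatou[of D] v(2) by (intro H0s_I q(2) w0) auto
    show "(\<lambda>n. \<integral>x. (u ((r \<circ> q) n) x - w x)\<^sup>2 \<partial>lebesgue) \<longlonglongrightarrow> 0"
      using LIMSEQ_subseq_LIMSEQ[OF q(4,1)] by (simp add: o_def v_def)
    show "\<forall>E. (\<forall>\<^sub>F n in sequentially. B (u ((r \<circ> q) n)) (u ((r \<circ> q) n)) \<le> E) \<longrightarrow> B w w \<le> E"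
      using fatou by (simp add: v_def)
  qed
qed

end

section \<open>Maximizing a quadratic form\<close>

lemma quadratic_nonneg_linear_zero:
  fixes d k :: real
  assumes "\<And>t. 0 \<le> 2 * t * d + t\<^sup>2 * k" "0 \<le> k"
  shows "d = 0"
proof (rule ccontr)
  assume "d \<noteq> 0"
  have "2 * (- d / (k + 1)) * d + (- d / (k + 1))\<^sup>2 * k = - (d\<^sup>2 * (k + 2)) / (k + 1)\<^sup>2"
    using assms(2) by (simp add: divide_simps power2_eq_square) (simp add: algebra_simps)
  also have "\<dots> < 0" using \<open>d \<noteq> 0\<close> assms(2) by (simp add: divide_neg_pos)
  finally show False using assms(1)[of "- d / (k + 1)"] by simp
qed

context fractional_domain
begin

text \<open>The first variation: \<open>M * B f f - q f f\<close> is a nonnegative quadratic form that vanishes at \<open>w\<close>,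
so its polar form vanishes there too.\<close>

lemma maximizer_weak_equation:
  assumes sym: "\<And>u v. u \<in> V \<Longrightarrow> v \<in> V \<Longrightarrow> q u v = q v u"
    and lin: "\<And>u v w c. u \<in> V \<Longrightarrow> v \<in> V \<Longrightarrow> w \<in> V \<Longrightarrow> q (\<lambda>x. u x + c * v x) w = q u w + c * q v w"
    and max: "\<And>f. f \<in> V \<Longrightarrow> q f f \<le> M * B f f"
    and w: "w \<in> V" "q w w = M * B w w" and \<phi>: "\<phi> \<in> V"
  shows "q w \<phi> = M * B w \<phi>"
proof -
  have "0 \<le> 2 * t * (M * B w \<phi> - q w \<phi>) + t\<^sup>2 * (M * B \<phi> \<phi> - q \<phi> \<phi>)" for t
  proof -
    let ?f = "\<lambda>x. w x + t * \<phi> x"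
    have f: "?f \<in> V" using w(1) \<phi> by (intro H0s_add H0s_cmult)
    have "q ?f ?f = q w ?f + t * q \<phi> ?f" by (rule lin[OF w(1) \<phi> f])
    also have "q w ?f = q w w + t * q w \<phi>"
      using sym[OF w(1) f] lin[OF w(1) \<phi> w(1)] sym[OF w(1) \<phi>] by simp
    also have "q \<phi> ?f = q w \<phi> + t * q \<phi> \<phi>"
      using sym[OF \<phi> f] lin[OF w(1) \<phi> \<phi>] by simp
    finally show ?thesis
      using max[OF f] w(2) H0s_inner_perturb[OF w(1) \<phi>, of t]
      by (simp add: power2_eq_square algebra_simps)
  qed
  then have "M * B w \<phi> - q w \<phi> = 0"
    using max[OF \<phi>] by (intro quadratic_nonneg_linear_zero) auto
  then show ?thesis by simp
qed

text \<open>The direct method. A maximizing sequence with \<open>B f f = 1\<close> has a limit \<open>w\<close> with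
\<open>B w w \<le> 1\<close>; as the value of \<open>q\<close> passes to the limit and is positive, homogeneity forces equality.\<close>

lemma form_maximizer:
  assumes sym: "\<And>u v. u \<in> V \<Longrightarrow> v \<in> V \<Longrightarrow> q u v = q v u"
    and lin: "\<And>u v w c. u \<in> V \<Longrightarrow> v \<in> V \<Longrightarrow> w \<in> V \<Longrightarrow> q (\<lambda>x. u x + c * v x) w = q u w + c * q v w"
    and bd: "\<And>u. u \<in> V \<Longrightarrow> q u u \<le> C * (\<integral>x. (u x)\<^sup>2 \<partial>lebesgue)" and C: "C \<ge> 0"
    and cont: "\<And>U w. (\<And>n. U n \<in> V) \<Longrightarrow> w \<in> V \<Longrightarrow> (\<lambda>n. \<integral>x. (U n x - w x)\<^sup>2 \<partial>lebesgue) \<longlonglongrightarrow> 0 \<Longrightarrow>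
        (\<lambda>n. q (U n) (U n)) \<longlonglongrightarrow> q w w"
    and pos: "f \<in> V" "q f f > 0"
  shows "\<exists>w\<in>V. B w w = 1 \<and> q w w > 0 \<and> (\<forall>f\<in>V. q f f \<le> q w w * B f f)"
proof -
  obtain P where P: "P > 0" "\<And>u. u \<in> V \<Longrightarrow> (\<integral>x. (u x)\<^sup>2 \<partial>lebesgue) \<le> P * B u u"
    using Poincare by blast
  have qB: "q u u \<le> C * P * B u u" if "u \<in> V" for u
    using bd[OF that] mult_left_mono[OF P(2)[OF that] C] by (simp add: mult.assoc)
  have scale: "q (\<lambda>x. c * u x) (\<lambda>x. c * u x) = c\<^sup>2 * q u u" if u: "u \<in> V" for u c
  proof -
    have e: "(\<lambda>x. c * u x) = (\<lambda>x. u x + (c - 1) * u x)" by (auto simp: algebra_simps)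
    have cu: "(\<lambda>x. c * u x) \<in> V" by (rule H0s_cmult[OF u])
    have 1: "q (\<lambda>x. c * u x) v = c * q u v" if "v \<in> V" for v
      unfolding e using lin[OF u u that, of "c - 1"] by (simp add: algebra_simps)
    show ?thesis using 1[OF cu] 1[OF u] sym[OF u cu] by (simp add: power2_eq_square)
  qed
  have normalized: "\<exists>v\<in>V. B v v = 1 \<and> q v v = q u u / B u u" if u: "u \<in> V" "B u u > 0" for u
  proof
    let ?c = "1 / sqrt (B u u)"
    have c: "?c\<^sup>2 = 1 / B u u" using u(2) by (simp add: power_divide)
    show "(\<lambda>x. ?c * u x) \<in> V" by (rule H0s_cmult[OF u(1)])
    have "B (\<lambda>x. ?c * u x) (\<lambda>x. ?c * u x) = ?c\<^sup>2 * B u u"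
      by (subst H0s_inner_cmult, subst H0s_inner_commute, subst H0s_inner_cmult) (simp add: power2_eq_square)
    then show "B (\<lambda>x. ?c * u x) (\<lambda>x. ?c * u x) = 1 \<and> q (\<lambda>x. ?c * u x) (\<lambda>x. ?c * u x) = q u u / B u u"
      using scale[OF u(1), of ?c] u(2) unfolding c by simp
  qed
  define S where "S = {q v v | v. v \<in> V \<and> B v v = 1}"
  have bdd: "bdd_above S"
    unfolding S_def by (rule bdd_aboveI[of _ "C * P"]) (use qB in force)
  have "B f f > 0" using qB[OF pos(1)] pos(2) H0s_inner_nonneg[of s f]
    by (cases "B f f = 0") auto
  then obtain v where v: "v \<in> V" "B v v = 1" "q v v = q f f / B f f" "q f f / B f f > 0"
    using normalized[OF pos(1)] pos(2) by auto
  define M where "M = Sup S"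
  have "q v v \<in> S" unfolding S_def using v by blast
  then have "q v v \<le> M" unfolding M_def using bdd by (rule cSup_upper)
  then have M: "M > 0" using v by simp
  have max: "q u u \<le> M * B u u" if u: "u \<in> V" for u
  proof (cases "B u u = 0")
    case True
    then show ?thesis using qB[OF u] by simp
  next
    case False
    then have pos: "B u u > 0" using H0s_inner_nonneg[of s u] by simp
    then obtain v where "v \<in> V" "B v v = 1" "q v v = q u u / B u u" using normalized[OF u] by blast
    then have "q u u / B u u \<in> S" by (force simp: S_def)
    then have "q u u / B u u \<le> M" unfolding M_def using bdd by (rule cSup_upper)
    then show ?thesis using pos by (simp add: field_simps)
  qed
  have "\<exists>v. v \<in> V \<and> B v v = 1 \<and> M - 1 / real (Suc n) < q v v" for n
  proof -
    have "M - 1 / real (Suc n) < Sup S" unfolding M_def by simp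
    then obtain x where "x \<in> S" "M - 1 / real (Suc n) < x"
      using less_cSup_iff[OF _ bdd] \<open>q v v \<in> S\<close> by blast
    then show ?thesis by (auto simp: S_def)
  qed
  then obtain U where U: "\<And>n. U n \<in> V" "\<And>n. B (U n) (U n) = 1" "\<And>n. M - 1 / real (Suc n) < q (U n) (U n)"
    by metis
  obtain r w where r: "strict_mono (r :: nat \<Rightarrow> nat)" "w \<in> V"
    "(\<lambda>n. \<integral>x. (U (r n) x - w x)\<^sup>2 \<partial>lebesgue) \<longlonglongrightarrow> 0"
    "\<forall>E. (\<forall>\<^sub>F n in sequentially. B (U (r n)) (U (r n)) \<le> E) \<longrightarrow> B w w \<le> E"
    using Rellich[of U 1] U(1,2) by auto
  have Bw: "B w w \<le> 1" using r(4) U(2) by simp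
  have lim: "(\<lambda>n. q (U (r n)) (U (r n))) \<longlonglongrightarrow> q w w"
    by (rule cont[of "\<lambda>n. U (r n)", OF U(1) r(2,3)])
  have "(\<lambda>n. q (U n) (U n)) \<longlonglongrightarrow> M"
  proof (rule tendsto_sandwich)
    show "(\<lambda>n. M - 1 / real (Suc n)) \<longlonglongrightarrow> M"
      using tendsto_diff[OF tendsto_const LIMSEQ_inverse_real_of_nat, of M] by (simp add: inverse_eq_divide)
    show "\<forall>\<^sub>F n in sequentially. M - 1 / real (Suc n) \<le> q (U n) (U n)"
      using U(3) less_imp_le by (intro always_eventually) blast
    show "\<forall>\<^sub>F n in sequentially. q (U n) (U n) \<le> M"
      using max[OF U(1)] U(2) by (intro always_eventually) simp
  qed simp
  then have "(\<lambda>n. q (U (r n)) (U (r n))) \<longlonglongrightarrow> M"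
    using LIMSEQ_subseq_LIMSEQ[OF _ r(1)] by (fastforce simp: o_def)
  then have qw: "q w w = M" using lim LIMSEQ_unique by blast
  have "1 \<le> B w w" using max[OF r(2)] M unfolding qw by simp
  then have "B w w = 1" using Bw by simp
  then show ?thesis using M r(2) qw max by blast
qed

section \<open>Weighted forms\<close>

abbreviation W :: "('a \<Rightarrow> real) \<Rightarrow> ('a \<Rightarrow> real) \<Rightarrow> ('a \<Rightarrow> real) \<Rightarrow> real" where
  "W \<rho> f g \<equiv> (\<integral>x. \<rho> x * f x * g x \<partial>lebesgue_on \<Omega>)"

lemma \<Omega>_measurable: "\<Omega> \<in> sets lebesgue" "\<Omega> \<inter> space lebesgue \<in> sets lebesgue"
  using open_\<Omega> by auto

text \<open>A weight that is everywhere bounded and measurable on the whole space, so that the integrals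
over \<open>\<Omega>\<close> become \<open>L\<^sup>2\<close> inner products on the whole space.\<close>

lemma Linf_bounded_representative:
  assumes \<rho>: "\<rho> \<in> Linf \<Omega>"
  obtains r C where "r \<in> borel_measurable lebesgue" "C \<ge> 0" "\<And>x. \<bar>r x\<bar> \<le> C"
    "AE x in lebesgue. x \<in> \<Omega> \<longrightarrow> \<rho> x = r x"
proof -
  obtain C where m: "\<rho> \<in> borel_measurable (lebesgue_on \<Omega>)" and C: "AE x in lebesgue_on \<Omega>. \<bar>\<rho> x\<bar> \<le> C"
    using \<rho> by (auto simp: Linf_def)
  define r where "r x = max (- \<bar>C\<bar>) (min \<bar>C\<bar> (indicator \<Omega> x * \<rho> x))" for x
  have "(\<lambda>x. indicator \<Omega> x *\<^sub>R \<rho> x) \<in> borel_measurable lebesgue"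
    using m borel_measurable_restrict_space_iff[OF \<Omega>_measurable(2), of \<rho>] by simp
  then have "(\<lambda>x. indicator \<Omega> x * \<rho> x) \<in> borel_measurable lebesgue" by simp
  then have "r \<in> borel_measurable lebesgue" unfolding r_def by (intro borel_measurable_max borel_measurable_min) auto
  moreover have "\<bar>r x\<bar> \<le> \<bar>C\<bar>" for x unfolding r_def by auto
  moreover have "AE x in lebesgue. x \<in> \<Omega> \<longrightarrow> \<rho> x = r x"
    using C unfolding AE_restrict_space_iff[OF \<Omega>_measurable(2)]
    by eventually_elim (auto simp: r_def)
  ultimately show thesis using that[of r "\<bar>C\<bar>"] by simp
qed

lemma weighted_sq_integrable:
  assumes "r \<in> borel_measurable lebesgue" "\<And>x. \<bar>r x\<bar> \<le> C" "sq_integrable lebesgue f"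
  shows "sq_integrable lebesgue (\<lambda>x. r x * f x)"
  by (rule sq_integrable_bound[OF assms(3) assms(3), of _ C 0])
    (use assms in \<open>auto simp: abs_mult intro!: mult_right_mono borel_measurable_times\<close>)

lemma W_representation:
  assumes r: "r \<in> borel_measurable lebesgue" "\<And>x. \<bar>r x\<bar> \<le> C" "AE x in lebesgue. x \<in> \<Omega> \<longrightarrow> \<rho> x = r x"
    and \<rho>: "\<rho> \<in> Linf \<Omega>" and f: "f \<in> V" and g: "g \<in> V"
  shows "integrable (lebesgue_on \<Omega>) (\<lambda>x. \<rho> x * f x * g x)"
    and "W \<rho> f g = (\<integral>x. (r x * f x) * g x \<partial>lebesgue)"
proof -
  have i: "integrable lebesgue (\<lambda>x. (r x * f x) * g x)"
    by (intro sq_integrable_mult_integrable weighted_sq_integrable[OF r(1,2)] H0s_D(1)[OF f] H0s_D(1)[OF g])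
  have "(\<lambda>x. indicator \<Omega> x *\<^sub>R \<rho> x) \<in> borel_measurable lebesgue"
    using \<rho> borel_measurable_restrict_space_iff[OF \<Omega>_measurable(2), of \<rho>] by (simp add: Linf_def)
  then have "(\<lambda>x. indicator \<Omega> x *\<^sub>R \<rho> x * f x * g x) \<in> borel_measurable lebesgue"
    by (intro borel_measurable_times H0s_D(4)[OF f] H0s_D(4)[OF g])
  then have m: "(\<lambda>x. indicator \<Omega> x *\<^sub>R (\<rho> x * f x * g x)) \<in> borel_measurable lebesgue"
    by (simp add: mult.assoc)
  have ae: "AE x in lebesgue. (r x * f x) * g x = indicator \<Omega> x *\<^sub>R (\<rho> x * f x * g x)"
    using r(3) H0s_D(3)[OF f] by eventually_elim (auto simp: indicator_def)
  show "integrable (lebesgue_on \<Omega>) (\<lambda>x. \<rho> x * f x * g x)"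
    unfolding integrable_restrict_space[OF \<Omega>_measurable(2)]
    using integrable_cong_AE[OF _ m ae] i by auto
  show "W \<rho> f g = (\<integral>x. (r x * f x) * g x \<partial>lebesgue)"
    unfolding integral_restrict_space[OF \<Omega>_measurable(2)]
    using integral_cong_AE[OF _ m ae] i by auto
qed

lemma W_integrable:
  assumes "\<rho> \<in> Linf \<Omega>" "f \<in> V" "g \<in> V"
  shows "integrable (lebesgue_on \<Omega>) (\<lambda>x. \<rho> x * f x * g x)"
  using Linf_bounded_representative[OF assms(1)] W_representation(1)[OF _ _ _ assms] by metis

lemma W_commute: "W \<rho> f g = W \<rho> g f"
  by (simp add: mult_ac)

lemma W_linear:
  assumes "\<rho> \<in> Linf \<Omega>" "f \<in> V" "g \<in> V" "h \<in> V"
  shows "W \<rho> (\<lambda>x. f x + c * g x) h = W \<rho> f h + c * W \<rho> g h"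
proof -
  have "W \<rho> (\<lambda>x. f x + c * g x) h = (\<integral>x. \<rho> x * f x * h x + c * (\<rho> x * g x * h x) \<partial>lebesgue_on \<Omega>)"
    by (simp add: algebra_simps)
  also have "\<dots> = W \<rho> f h + c * W \<rho> g h"
    using W_integrable[OF assms(1,2,4)] W_integrable[OF assms(1,3,4)] by simp
  finally show ?thesis .
qed

lemma W_linear_weight:
  assumes "\<rho> \<in> Linf \<Omega>" "v \<in> Linf \<Omega>" "f \<in> V" "g \<in> V"
  shows "W (\<lambda>x. \<rho> x + t * v x) f g = W \<rho> f g + t * W v f g"
proof -
  have "W (\<lambda>x. \<rho> x + t * v x) f g = (\<integral>x. \<rho> x * f x * g x + t * (v x * f x * g x) \<partial>lebesgue_on \<Omega>)"
    by (simp add: algebra_simps)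
  also have "\<dots> = W \<rho> f g + t * W v f g"
    using W_integrable[OF assms(1,3,4)] W_integrable[OF assms(2,3,4)] by simp
  finally show ?thesis .
qed

lemma Linf_perturb:
  assumes "\<rho> \<in> Linf \<Omega>" "v \<in> Linf \<Omega>"
  shows "(\<lambda>x. \<rho> x + t * v x) \<in> Linf \<Omega>"
proof -
  obtain C D where "AE x in lebesgue_on \<Omega>. \<bar>\<rho> x\<bar> \<le> C" "AE x in lebesgue_on \<Omega>. \<bar>v x\<bar> \<le> D"
    using assms by (auto simp: Linf_def)
  then have "AE x in lebesgue_on \<Omega>. \<bar>\<rho> x + t * v x\<bar> \<le> C + \<bar>t\<bar> * D"
  proof eventually_elim
    case (elim x)
    then show ?case
      using abs_triangle_ineq[of "\<rho> x" "t * v x"] mult_left_mono[of "\<bar>v x\<bar>" D "\<bar>t\<bar>"] by (simp add: abs_mult)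
  qed
  then show ?thesis using assms by (auto simp: Linf_def)
qed

lemma W_abs_le:
  assumes \<rho>: "\<rho> \<in> Linf \<Omega>"
  shows "\<exists>C\<ge>0. \<forall>f\<in>V. \<forall>g\<in>V.
      \<bar>W \<rho> f g\<bar> \<le> C * sqrt (\<integral>x. (f x)\<^sup>2 \<partial>lebesgue) * sqrt (\<integral>x. (g x)\<^sup>2 \<partial>lebesgue)"
proof -
  obtain r C where r: "r \<in> borel_measurable lebesgue" "C \<ge> 0" "\<And>x. \<bar>r x\<bar> \<le> C"
    "AE x in lebesgue. x \<in> \<Omega> \<longrightarrow> \<rho> x = r x"
    using Linf_bounded_representative[OF \<rho>] by metis
  have "\<bar>W \<rho> f g\<bar> \<le> C * sqrt (\<integral>x. (f x)\<^sup>2 \<partial>lebesgue) * sqrt (\<integral>x. (g x)\<^sup>2 \<partial>lebesgue)"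
    if f: "f \<in> V" and g: "g \<in> V" for f g
  proof -
    have rf: "sq_integrable lebesgue (\<lambda>x. r x * f x)"
      by (rule weighted_sq_integrable[OF r(1,3) H0s_D(1)[OF f]])
    have "(\<integral>x. (r x * f x)\<^sup>2 \<partial>lebesgue) \<le> (\<integral>x. C\<^sup>2 * (f x)\<^sup>2 \<partial>lebesgue)"
    proof (rule integral_mono)
      show "(r x * f x)\<^sup>2 \<le> C\<^sup>2 * (f x)\<^sup>2" for x
        using r(3)[of x] r(2) unfolding power_mult_distrib
        by (intro mult_right_mono) (auto simp: abs_le_square_iff[symmetric])
    qed (use rf H0s_D(1)[OF f] in \<open>auto simp: sq_integrable_def\<close>)
    then have "sqrt (\<integral>x. (r x * f x)\<^sup>2 \<partial>lebesgue) \<le> sqrt (C\<^sup>2 * (\<integral>x. (f x)\<^sup>2 \<partial>lebesgue))"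
      by simp
    also have "\<dots> = C * sqrt (\<integral>x. (f x)\<^sup>2 \<partial>lebesgue)"
      using r(2) by (simp add: real_sqrt_mult)
    finally have "sqrt (\<integral>x. (r x * f x)\<^sup>2 \<partial>lebesgue) * sqrt (\<integral>x. (g x)\<^sup>2 \<partial>lebesgue)
        \<le> C * sqrt (\<integral>x. (f x)\<^sup>2 \<partial>lebesgue) * sqrt (\<integral>x. (g x)\<^sup>2 \<partial>lebesgue)"
      by (intro mult_right_mono) auto
    then show ?thesis
      using Cauchy_Schwarz_integral[OF rf H0s_D(1)[OF g]] unfolding W_representation(2)[OF r(1,3,4) \<rho> f g]
      by linarith
  qed
  then show ?thesis using r(2) by blast
qed

lemma W_tendsto:
  assumes \<rho>: "\<rho> \<in> Linf \<Omega>" and f: "\<And>n. f n \<in> V" "f' \<in> V" "(\<lambda>n. \<integral>x. (f n x - f' x)\<^sup>2 \<partial>lebesgue) \<longlonglongrightarrow> 0"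
    and g: "\<And>n. g n \<in> V" "g' \<in> V" "(\<lambda>n. \<integral>x. (g n x - g' x)\<^sup>2 \<partial>lebesgue) \<longlonglongrightarrow> 0"
  shows "(\<lambda>n. W \<rho> (f n) (g n)) \<longlonglongrightarrow> W \<rho> f' g'"
proof -
  obtain r C where r: "r \<in> borel_measurable lebesgue" "C \<ge> 0" "\<And>x. \<bar>r x\<bar> \<le> C"
    "AE x in lebesgue. x \<in> \<Omega> \<longrightarrow> \<rho> x = r x"
    using Linf_bounded_representative[OF \<rho>] by metis
  note rep = W_representation(2)[OF r(1,3,4) \<rho>]
  have fg: "f n \<in> V" "g n \<in> V" for n by (rule f g)+
  have rg: "sq_integrable lebesgue (\<lambda>x. r x * g n x)" "sq_integrable lebesgue (\<lambda>x. r x * g' x)" for n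
    using weighted_sq_integrable[OF r(1,3)] H0s_D(1) g(1,2) by blast+
  have "(\<lambda>n. \<integral>x. (r x * g n x - r x * g' x)\<^sup>2 \<partial>lebesgue) \<longlonglongrightarrow> 0"
  proof (rule Lim_null_comparison[OF always_eventually])
    show "\<forall>n. norm (\<integral>x. (r x * g n x - r x * g' x)\<^sup>2 \<partial>lebesgue) \<le> C\<^sup>2 * (\<integral>x. (g n x - g' x)\<^sup>2 \<partial>lebesgue)"
    proof
      fix n
      have "(\<integral>x. (r x * g n x - r x * g' x)\<^sup>2 \<partial>lebesgue) \<le> (\<integral>x. C\<^sup>2 * (g n x - g' x)\<^sup>2 \<partial>lebesgue)"
      proof (rule integral_mono)
        show "integrable lebesgue (\<lambda>x. (r x * g n x - r x * g' x)\<^sup>2)"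
          using sq_integrable_diff[OF rg] by (simp add: sq_integrable_def)
        show "integrable lebesgue (\<lambda>x. C\<^sup>2 * (g n x - g' x)\<^sup>2)"
          using sq_integrable_diff[OF H0s_D(1)[OF fg(2)] H0s_D(1)[OF g(2)]] by (simp add: sq_integrable_def)
        show "(r x * g n x - r x * g' x)\<^sup>2 \<le> C\<^sup>2 * (g n x - g' x)\<^sup>2" for x
          using r(3)[of x] r(2) unfolding power_mult_distrib right_diff_distrib[symmetric]
          by (intro mult_right_mono) (auto simp: abs_le_square_iff[symmetric])
      qed
      then show "norm (\<integral>x. (r x * g n x - r x * g' x)\<^sup>2 \<partial>lebesgue) \<le> C\<^sup>2 * (\<integral>x. (g n x - g' x)\<^sup>2 \<partial>lebesgue)"
        by simp
    qed
    show "(\<lambda>n. C\<^sup>2 * (\<integral>x. (g n x - g' x)\<^sup>2 \<partial>lebesgue)) \<longlonglongrightarrow> 0"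
      using tendsto_mult[OF tendsto_const g(3), of "C\<^sup>2"] by simp
  qed
  from L2_tendsto_product[where f = f and f' = f' and g = "\<lambda>n x. r x * g n x", OF H0s_D(1)[OF fg(1)] H0s_D(1)[OF f(2)] f(3) rg this]
  have "(\<lambda>n. \<integral>x. f n x * (r x * g n x) \<partial>lebesgue) \<longlonglongrightarrow> (\<integral>x. f' x * (r x * g' x) \<partial>lebesgue)" .
  then show ?thesis unfolding rep[OF fg] rep[OF f(2) g(2)] by (simp add: mult_ac)
qed

section \<open>The first eigenvalue as a maximum\<close>

text \<open>Maximizing the square of the functional \<open>l = W \<rho> f\<close> over the unit ball gives some \<open>w\<close>, and
the weak equation for the rank-one form \<open>l \<phi> * l \<psi>\<close> says that \<open>l w\<close> times \<open>w\<close> represents \<open>l\<close>.\<close>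

lemma Riesz_weighted:
  assumes \<rho>: "\<rho> \<in> Linf \<Omega>" and f: "f \<in> V"
  shows "\<exists>g\<in>V. \<forall>\<phi>\<in>V. B g \<phi> = W \<rho> f \<phi>"
proof (cases "\<forall>\<phi>\<in>V. W \<rho> f \<phi> = 0")
  case True
  have "(\<lambda>x. 0 * f x) \<in> V" by (rule H0s_cmult[OF f])
  moreover have "B (\<lambda>x. 0 * f x) \<phi> = 0" for \<phi> by (subst H0s_inner_cmult) simp
  ultimately show ?thesis using True by metis
next
  case False
  then obtain \<phi>0 where \<phi>0: "\<phi>0 \<in> V" "W \<rho> f \<phi>0 \<noteq> 0" by blast
  define l where "l \<phi> = W \<rho> f \<phi>" for \<phi>
  define q where "q \<phi> \<psi> = l \<phi> * l \<psi>" for \<phi> \<psi>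
  have l_lin: "l (\<lambda>x. u x + c * v x) = l u + c * l v" if "u \<in> V" "v \<in> V" for u v c
    unfolding l_def using W_linear[OF \<rho> that f] by (simp only: W_commute[of _ f])
  have q_lin: "q (\<lambda>x. u x + c * v x) w = q u w + c * q v w" if "u \<in> V" "v \<in> V" for u v w c
    unfolding q_def l_lin[OF that] by (simp add: algebra_simps)
  have q_sym: "q u v = q v u" for u v by (simp add: q_def)
  obtain C where C: "C \<ge> 0" "\<forall>g\<in>V.
      \<bar>W \<rho> f g\<bar> \<le> C * sqrt (\<integral>x. (f x)\<^sup>2 \<partial>lebesgue) * sqrt (\<integral>x. (g x)\<^sup>2 \<partial>lebesgue)"
    using W_abs_le[OF \<rho>] f by blast
  let ?K = "(C * sqrt (\<integral>x. (f x)\<^sup>2 \<partial>lebesgue))\<^sup>2"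
  have q_bd: "q u u \<le> ?K * (\<integral>x. (u x)\<^sup>2 \<partial>lebesgue)" if "u \<in> V" for u
  proof -
    have "(l u)\<^sup>2 \<le> (C * sqrt (\<integral>x. (f x)\<^sup>2 \<partial>lebesgue) * sqrt (\<integral>x. (u x)\<^sup>2 \<partial>lebesgue))\<^sup>2"
      using power_mono[OF C(2)[rule_format, OF that], of 2] by (simp add: l_def)
    then show ?thesis by (simp add: q_def power_mult_distrib power2_eq_square[of "l u"])
  qed
  have q_cont: "(\<lambda>n. q (U n) (U n)) \<longlonglongrightarrow> q w w"
    if U: "\<And>n. U n \<in> V" "w \<in> V" "(\<lambda>n. \<integral>x. (U n x - w x)\<^sup>2 \<partial>lebesgue) \<longlonglongrightarrow> 0" for U w
  proof -
    have "(\<lambda>n. l (U n)) \<longlonglongrightarrow> l w"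
      unfolding l_def using W_tendsto[where f = "\<lambda>n. f" and g = U, OF \<rho> f f _ U] by simp
    then show ?thesis unfolding q_def by (intro tendsto_mult)
  qed
  have "q \<phi>0 \<phi>0 > 0" using \<phi>0(2) unfolding q_def l_def power2_eq_square[symmetric] by simp
  then have "\<exists>w\<in>V. B w w = 1 \<and> q w w > 0 \<and> (\<forall>f\<in>V. q f f \<le> q w w * B f f)"
    by (intro form_maximizer[of q ?K \<phi>0] q_sym q_lin q_bd zero_le_power2 q_cont \<phi>0(1))
  then obtain M w where M: "M > 0" "w \<in> V" "B w w = 1" "q w w = M" "\<forall>f\<in>V. q f f \<le> M * B f f"
    by blast
  have lw: "l w * l w = M" using M(4) by (simp add: q_def)
  then have "l w \<noteq> 0" using M(1) by auto
  have "B (\<lambda>x. l w * w x) \<phi> = l \<phi>" if "\<phi> \<in> V" for \<phi>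
  proof -
    have "q w \<phi> = M * B w \<phi>"
    proof (rule maximizer_weak_equation[of q])
      show "q f f \<le> M * B f f" if "f \<in> V" for f using M(5) that by blast
      show "q w w = M * B w w" using M(3,4) by simp
      show "q (\<lambda>x. a x + c * b x) h = q a h + c * q b h" if "a \<in> V" "b \<in> V" "h \<in> V" for a b h c
        by (rule q_lin[OF that(1,2)])
      show "q a b = q b a" if "a \<in> V" "b \<in> V" for a b by (rule q_sym)
    qed (use M(2) that in simp_all)
    then have "l w * (l w * B w \<phi>) = l w * l \<phi>" using lw by (simp add: q_def mult.assoc[symmetric])
    then show ?thesis using \<open>l w \<noteq> 0\<close> by (simp add: H0s_inner_cmult)
  qed
  then show ?thesis using H0s_cmult[OF M(2), of "l w"] by (auto simp: l_def)
qed

lemma G_op_properties: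
  assumes "\<rho> \<in> Linf \<Omega>" "f \<in> V"
  shows "G_op \<Omega> s \<rho> f \<in> V" "\<And>\<phi>. \<phi> \<in> V \<Longrightarrow> B (G_op \<Omega> s \<rho> f) \<phi> = W \<rho> f \<phi>"
proof -
  have "\<exists>g. g \<in> V \<and> (\<forall>\<phi>\<in>V. B g \<phi> = W \<rho> f \<phi>)"
    using Riesz_weighted[OF assms] by blast
  from someI_ex[OF this]
  show "G_op \<Omega> s \<rho> f \<in> V" "\<And>\<phi>. \<phi> \<in> V \<Longrightarrow> B (G_op \<Omega> s \<rho> f) \<phi> = W \<rho> f \<phi>"
    unfolding G_op_def by auto
qed

text \<open>Replaces the operator given by a choice by the weak equation. In the direction from right to left
the image under the operator and \<open>\<mu>\<close> times \<open>f\<close> have the same inner products, and \<open>B\<close> is definite.\<close>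

lemma eigenfunction_iff:
  assumes \<rho>: "\<rho> \<in> Linf \<Omega>"
  shows "eigenfunction_of \<Omega> s \<rho> \<mu> f \<longleftrightarrow>
    f \<in> V \<and> \<not> (AE x in lebesgue. f x = 0) \<and> (\<forall>\<phi>\<in>V. W \<rho> f \<phi> = \<mu> * B f \<phi>)"
proof -
  have "(AE x in lebesgue. G_op \<Omega> s \<rho> f x = \<mu> * f x) \<longleftrightarrow> (\<forall>\<phi>\<in>V. W \<rho> f \<phi> = \<mu> * B f \<phi>)" if f: "f \<in> V"
  proof -
    note G = G_op_properties[OF \<rho> f]
    have mf: "(\<lambda>x. \<mu> * f x) \<in> V" by (rule H0s_cmult[OF f])
    show ?thesis
    proof
      assume ae: "AE x in lebesgue. G_op \<Omega> s \<rho> f x = \<mu> * f x"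
      show "\<forall>\<phi>\<in>V. W \<rho> f \<phi> = \<mu> * B f \<phi>"
      proof
        fix \<phi> assume \<phi>: "\<phi> \<in> V"
        have "W \<rho> f \<phi> = B (G_op \<Omega> s \<rho> f) \<phi>" using G(2)[OF \<phi>] by simp
        also have "\<dots> = B (\<lambda>x. \<mu> * f x) \<phi>"
          by (rule H0s_inner_cong[OF H0s_D(4)[OF G(1)] H0s_D(4)[OF mf] H0s_D(4)[OF \<phi>] ae])
        finally show "W \<rho> f \<phi> = \<mu> * B f \<phi>" by (simp add: H0s_inner_cmult)
      qed
    next
      assume weak: "\<forall>\<phi>\<in>V. W \<rho> f \<phi> = \<mu> * B f \<phi>"
      let ?d = "\<lambda>x. G_op \<Omega> s \<rho> f x - \<mu> * f x"
      have d: "?d \<in> V" by (rule H0s_diff[OF G(1) mf])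
      have "B ?d ?d = B (G_op \<Omega> s \<rho> f) ?d - B (\<lambda>x. \<mu> * f x) ?d" by (rule H0s_inner_diff[OF G(1) mf d])
      also have "\<dots> = 0" using weak d G(2)[OF d] by (simp add: H0s_inner_cmult)
      finally show "AE x in lebesgue. G_op \<Omega> s \<rho> f x = \<mu> * f x"
        using H0s_inner_zero_imp[OF d] by simp
    qed
  qed
  then show ?thesis by (auto simp: eigenfunction_of_def)
qed

lemma normalized_not_AE_zero:
  assumes "w \<in> V" "B w w = 1"
  shows "\<not> (AE x in lebesgue. w x = 0)"
proof
  assume ae: "AE x in lebesgue. w x = 0"
  have "B w w = B (\<lambda>x. 0 * w x) w"
    by (rule H0s_inner_cong) (use assms ae H0s_D(4)[of w] in auto)
  also have "\<dots> = 0" by (subst H0s_inner_cmult) simp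
  finally show False using assms(2) by simp
qed

text \<open>The maximizer of the quotient is an eigenfunction, and every eigenvalue is the quotient of its
eigenfunction. So the greatest positive eigenvalue exists and is the maximum.\<close>

lemma mu1_maximum:
  assumes \<rho>: "\<rho> \<in> Linf \<Omega>" and f: "f \<in> V" "W \<rho> f f > 0"
  shows "mu1 \<Omega> s \<rho> > 0"
    and "\<exists>w\<in>V. B w w = 1 \<and> W \<rho> w w = mu1 \<Omega> s \<rho>"
    and "\<And>g. g \<in> V \<Longrightarrow> W \<rho> g g \<le> mu1 \<Omega> s \<rho> * B g g"
proof -
  obtain C where C: "C \<ge> 0" "\<forall>f\<in>V. \<forall>g\<in>V.
      \<bar>W \<rho> f g\<bar> \<le> C * sqrt (\<integral>x. (f x)\<^sup>2 \<partial>lebesgue) * sqrt (\<integral>x. (g x)\<^sup>2 \<partial>lebesgue)"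
    using W_abs_le[OF \<rho>] by blast
  have bd: "W \<rho> g g \<le> C * (\<integral>x. (g x)\<^sup>2 \<partial>lebesgue)" if "g \<in> V" for g
    using C(2)[rule_format, OF that that] by (simp add: mult.assoc)
  have cont: "(\<lambda>n. W \<rho> (U n) (U n)) \<longlonglongrightarrow> W \<rho> w w"
    if U: "\<And>n. U n \<in> V" "w \<in> V" "(\<lambda>n. \<integral>x. (U n x - w x)\<^sup>2 \<partial>lebesgue) \<longlonglongrightarrow> 0" for U w
    by (rule W_tendsto[where f = U and g = U, OF \<rho> U U])
  have "\<exists>w\<in>V. B w w = 1 \<and> W \<rho> w w > 0 \<and> (\<forall>f\<in>V. W \<rho> f f \<le> W \<rho> w w * B f f)"
    by (rule form_maximizer[of "W \<rho>", OF W_commute W_linear[OF \<rho>] bd C(1) cont f])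
  then obtain M w where M: "M > 0" "w \<in> V" "B w w = 1" "W \<rho> w w = M" "\<forall>f\<in>V. W \<rho> f f \<le> M * B f f"
    by blast
  have weak: "W \<rho> w \<phi> = M * B w \<phi>" if "\<phi> \<in> V" for \<phi>
  proof (rule maximizer_weak_equation[of "W \<rho>", OF W_commute W_linear[OF \<rho>]])
    show "W \<rho> f f \<le> M * B f f" if "f \<in> V" for f using M(5) that by blast
    show "W \<rho> w w = M * B w w" using M(3,4) by simp
  qed (use M(2) that in simp_all)
  have "mu1 \<Omega> s \<rho> = M" unfolding mu1_def
  proof (rule Greatest_equality)
    show "M > 0 \<and> (\<exists>f. eigenfunction_of \<Omega> s \<rho> M f)"
      using M weak normalized_not_AE_zero[OF M(2,3)] by (auto simp: eigenfunction_iff[OF \<rho>])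
    fix \<mu> assume "\<mu> > 0 \<and> (\<exists>f. eigenfunction_of \<Omega> s \<rho> \<mu> f)"
    then obtain g where g: "g \<in> V" "\<not> (AE x in lebesgue. g x = 0)" "W \<rho> g g = \<mu> * B g g"
      by (auto simp: eigenfunction_iff[OF \<rho>])
    have "B g g > 0" using H0s_inner_zero_imp[OF g(1)] g(2) H0s_inner_nonneg[of s g] by (auto simp: less_le)
    then show "\<mu> \<le> M" using M(5) g by auto
  qed
  then show "mu1 \<Omega> s \<rho> > 0" "\<exists>w\<in>V. B w w = 1 \<and> W \<rho> w w = mu1 \<Omega> s \<rho>"
    "\<And>g. g \<in> V \<Longrightarrow> W \<rho> g g \<le> mu1 \<Omega> s \<rho> * B g g"
    using M by auto
qed

end

section \<open>Lipschitz cutoff functions\<close>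

text \<open>Integrability of a function with a power-like singularity or decay is tested on dyadic balls,
which avoids polar coordinates.\<close>

lemma nn_integral_dyadic_finite:
  fixes h :: "'a::euclidean_space \<Rightarrow> real"
  assumes dom: "\<And>t. h t > 0 \<Longrightarrow> \<exists>k. h t \<le> a k \<and> norm t < R k"
    and a: "\<And>k::nat. a k \<ge> 0" and R: "\<And>k. R k \<ge> 0"
    and summ: "summable (\<lambda>k. a k * R k ^ DIM('a))"
  shows "(\<integral>\<^sup>+t. ennreal (h t) \<partial>lborel) < \<infinity>"
proof -
  have "(\<integral>\<^sup>+t. ennreal (h t) \<partial>lborel)
      \<le> (\<integral>\<^sup>+t. (\<Sum>k. ennreal (a k) * indicator (ball (0::'a) (R k)) t) \<partial>lborel)"
  proof (rule nn_integral_mono)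
    fix t :: 'a
    show "ennreal (h t) \<le> (\<Sum>k. ennreal (a k) * indicator (ball 0 (R k)) t)"
    proof (cases "h t > 0")
      case True
      then obtain k where k: "h t \<le> a k" "norm t < R k" using dom by blast
      have "ennreal (h t) \<le> ennreal (a k) * indicator (ball 0 (R k)) t"
        using k by (simp add: ennreal_leI)
      also have "\<dots> \<le> (\<Sum>k. ennreal (a k) * indicator (ball 0 (R k)) t)"
      proof -
        let ?F = "\<lambda>k. ennreal (a k) * indicator (ball 0 (R k)) t"
        have "sum ?F {k} \<le> suminf ?F" by (rule sum_le_suminf) auto
        moreover have "sum ?F {k} = ?F k" by (subst sum.insert) (simp_all only: finite.emptyI empty_iff not_False_eq_True sum.empty add_0_right)
        ultimately show ?thesis by (simp only:)
      qed
      finally show ?thesis .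
    qed (simp add: ennreal_neg)
  qed
  also have "\<dots> = (\<Sum>k. \<integral>\<^sup>+t. ennreal (a k) * indicator (ball (0::'a) (R k)) t \<partial>lborel)"
    by (rule nn_integral_suminf) (auto intro!: borel_measurable_times_ennreal borel_measurable_indicator)
  also have "\<dots> = (\<Sum>k. ennreal (unit_ball_vol (real DIM('a)) * (a k * R k ^ DIM('a))))"
    using a R by (simp add: nn_integral_cmult_indicator emeasure_ball ennreal_mult'[symmetric] mult_ac)
  also have "\<dots> < \<infinity>"
    using a R summable_mult[OF summ] by (subst suminf_ennreal2) auto
  finally show ?thesis .
qed

lemma dyadic_scale:
  fixes x :: real
  assumes "x \<ge> 1"
  obtains k :: nat where "2 ^ k \<le> x" "x < 2 ^ Suc k"
proof -
  obtain n where n: "x < 2 ^ n" using real_arch_pow[of 2 x] by auto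
  define m where "m = (LEAST n. x < 2 ^ n)"
  have m: "x < 2 ^ m" unfolding m_def using n by (rule LeastI)
  with assms have "m \<noteq> 0" by (cases m) auto
  then obtain k where k: "m = Suc k" using not0_implies_Suc by blast
  then have "\<not> x < 2 ^ k" using not_less_Least[of k "\<lambda>n. x < 2 ^ n"] unfolding m_def by simp
  with m k show thesis by (intro that[of k]) simp_all
qed

text \<open>Near \<open>0\<close> the integrand has order \<open>2 - 2 * s\<close> above the critical power, which is integrable since
\<open>s < 1\<close>; at infinity it has order \<open>2 * s\<close> below it, which is integrable since \<open>s > 0\<close>. The two
ranges give geometric series with ratios \<open>2 powr (2 * s - 2)\<close> and \<open>2 powr (- 2 * s)\<close>.\<close>

lemma Gagliardo_kernel_integrable:
  fixes L s :: real
  assumes s: "0 < s" "s < 1" and L: "L \<ge> 0"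
  shows "(\<integral>\<^sup>+t. ennreal (min (L\<^sup>2 * (norm (t :: 'a::euclidean_space))\<^sup>2) 1 / norm t powr (real DIM('a) + 2 * s)) \<partial>lborel) < \<infinity>"
proof -
  define e where "e = real DIM('a) + 2 * s"
  have e: "e > 0" using s by (simp add: e_def add_nonneg_pos)
  \<comment> \<open>The range of small and the range of large \<open>t\<close> need different dyadic scales.\<close>
  define near where "near t = (if norm t < 1 then L\<^sup>2 * (norm t)\<^sup>2 / norm t powr e else 0)" for t :: 'a
  define far where "far t = (if norm t < 1 then 0 else 1 / norm t powr e)" for t :: 'a
  have powr2: "((2::real) powr x) ^ k = 2 powr (x * real k)" for x and k :: nat
    by (simp add: powr_powr[symmetric] powr_realpow)
  have near: "(\<integral>\<^sup>+t. ennreal (near t) \<partial>lborel) < \<infinity>"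
  proof (rule nn_integral_dyadic_finite)
    let ?a = "\<lambda>k::nat. L\<^sup>2 * 2 powr e * 2 powr (- 2 * real k + e * real k)"
    let ?R = "\<lambda>k::nat. 2 * 2 powr (- real k)"
    show "\<exists>k. near t \<le> ?a k \<and> norm t < ?R k" if "near t > 0" for t
    proof -
      have t: "norm t < 1" "norm t > 0" using that by (auto simp: near_def split: if_splits)
      then obtain k where k: "2 ^ k \<le> 1 / norm t" "1 / norm t < 2 ^ Suc k"
        using dyadic_scale[of "1 / norm t"] by auto
      have up: "norm t \<le> 2 powr (- real k)" and lo: "2 powr (- real k - 1) \<le> norm t"
        using k t by (simp_all add: powr_minus powr_diff powr_realpow field_simps)
      have "(norm t)\<^sup>2 \<le> (2 powr (- real k))\<^sup>2" using up by (intro power_mono) auto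
      also have "\<dots> = 2 powr (- 2 * real k)" by (simp add: powr2 mult.commute)
      finally have 1: "(norm t)\<^sup>2 \<le> 2 powr (- 2 * real k)" .
      have "(2 powr (- real k - 1)) powr e \<le> norm t powr e" using lo e by (intro powr_mono2) auto
      then have "2 powr (- e * real k - e) \<le> norm t powr e" by (simp add: powr_powr algebra_simps)
      then have "1 / norm t powr e \<le> 1 / 2 powr (- e * real k - e)"
        using t by (intro divide_left_mono) auto
      also have "\<dots> = 2 powr (e * real k + e)" by (simp add: powr_minus_divide[symmetric] powr_minus field_simps)
      finally have 2: "1 / norm t powr e \<le> 2 powr (e * real k + e)" .
      have "near t = L\<^sup>2 * ((norm t)\<^sup>2 * (1 / norm t powr e))" using t by (simp add: near_def)
      also have "\<dots> \<le> L\<^sup>2 * (2 powr (- 2 * real k) * 2 powr (e * real k + e))"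
        using 1 2 by (intro mult_left_mono mult_mono) auto
      also have "\<dots> = ?a k" unfolding powr_add by (simp only: mult_ac)
      finally have "near t \<le> ?a k" .
      moreover have "norm t < ?R k"
        using up powr_gt_zero[of 2 "- real k"] by linarith
      ultimately show ?thesis by blast
    qed
    have "?a k * ?R k ^ DIM('a) = L\<^sup>2 * 2 powr e * 2 ^ DIM('a) * (2 powr (2 * s - 2)) ^ k" for k
    proof -
      have "?R k ^ DIM('a) = 2 ^ DIM('a) * 2 powr (- real k * real DIM('a))"
        by (simp add: power_mult_distrib powr2)
      moreover have "2 powr (- 2 * real k + e * real k) * 2 powr (- real k * real DIM('a)) = (2 powr (2 * s - 2)) ^ k"
        unfolding powr2 by (simp add: e_def algebra_simps flip: powr_add)
      ultimately show ?thesis by (simp add: mult_ac)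
    qed
    then have eq: "(\<lambda>k. ?a k * ?R k ^ DIM('a)) = (\<lambda>k. L\<^sup>2 * 2 powr e * 2 ^ DIM('a) * (2 powr (2 * s - 2)) ^ k)"
      by (rule ext)
    have "summable (\<lambda>k. (2 powr (2 * s - 2)) ^ k)"
      using s powr_less_mono[of "2 * s - 2" 0 2] by (intro summable_geometric) auto
    then show "summable (\<lambda>k. ?a k * ?R k ^ DIM('a))" unfolding eq by (rule summable_mult)
  qed auto
  have far: "(\<integral>\<^sup>+t. ennreal (far t) \<partial>lborel) < \<infinity>"
  proof (rule nn_integral_dyadic_finite)
    let ?a = "\<lambda>k::nat. 2 powr (- e * real k)"
    let ?R = "\<lambda>k::nat. (2::real) ^ Suc k"
    show "\<exists>k. far t \<le> ?a k \<and> norm t < ?R k" if "far t > 0" for t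
    proof -
      have t: "norm t \<ge> 1" using that by (auto simp: far_def split: if_splits)
      then have t0: "t \<noteq> 0" by auto
      from t obtain k where k: "2 ^ k \<le> norm t" "norm t < 2 ^ Suc k" using dyadic_scale by blast
      have "(2 powr (real k)) powr e \<le> norm t powr e"
        using k e by (intro powr_mono2) (auto simp: powr_realpow)
      then have "1 / norm t powr e \<le> 1 / 2 powr (e * real k)"
        using t0 by (intro divide_left_mono) (auto simp: powr_powr mult.commute)
      then show ?thesis using k t by (auto simp: far_def powr_minus_divide)
    qed
    have "?a k * ?R k ^ DIM('a) = 2 ^ DIM('a) * (2 powr (- 2 * s)) ^ k" for k
    proof -
      have "?R k ^ DIM('a) = 2 ^ DIM('a) * 2 powr (real k * real DIM('a))"
        by (simp add: power_mult_distrib powr_realpow[symmetric] flip: powr2 power_mult)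
      moreover have "2 powr (- e * real k) * 2 powr (real k * real DIM('a)) = (2 powr (- 2 * s)) ^ k"
        unfolding powr2 by (simp add: e_def algebra_simps flip: powr_add)
      ultimately show ?thesis by (simp add: mult_ac)
    qed
    then have eq: "(\<lambda>k. ?a k * ?R k ^ DIM('a)) = (\<lambda>k. 2 ^ DIM('a) * (2 powr (- 2 * s)) ^ k)"
      by (rule ext)
    have "summable (\<lambda>k. (2 powr (- 2 * s)) ^ k)"
      using s powr_less_mono[of "- 2 * s" 0 2] by (intro summable_geometric) auto
    then show "summable (\<lambda>k. ?a k * ?R k ^ DIM('a))" unfolding eq by (rule summable_mult)
  qed auto
  have "(\<integral>\<^sup>+t. ennreal (min (L\<^sup>2 * (norm (t :: 'a))\<^sup>2) 1 / norm t powr e) \<partial>lborel)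
     \<le> (\<integral>\<^sup>+t. ennreal (near t) + ennreal (far t) \<partial>lborel)"
  proof (rule nn_integral_mono)
    fix t :: 'a
    have "min (L\<^sup>2 * (norm t)\<^sup>2) 1 / norm t powr e \<le> near t + far t"
      unfolding near_def far_def by (auto intro!: divide_right_mono)
    then show "ennreal (min (L\<^sup>2 * (norm t)\<^sup>2) 1 / norm t powr e) \<le> ennreal (near t) + ennreal (far t)"
      by (subst ennreal_plus[symmetric]) (auto simp: near_def far_def intro: ennreal_leI)
  qed
  also have "\<dots> = (\<integral>\<^sup>+t. ennreal (near t) \<partial>lborel) + (\<integral>\<^sup>+t. ennreal (far t) \<partial>lborel)"
    by (rule nn_integral_add) (simp_all add: near_def far_def)
  also have "\<dots> < \<infinity>" using near far by simp
  finally show ?thesis by (simp add: e_def)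
qed

context fractional_domain
begin

lemma emeasure_\<Omega>_finite: "emeasure lborel \<Omega> < \<infinity>" "\<Omega> \<in> lmeasurable"
  using emeasure_bounded_finite[OF bounded_\<Omega>] open_\<Omega> bounded_\<Omega>
  by (auto simp: lmeasurable_open)

text \<open>The energy density at \<open>(x, y)\<close> vanishes unless \<open>x\<close> or \<open>y\<close> lies in \<open>\<Omega>\<close>, and is bounded by a
function of \<open>x - y\<close> that is integrable.\<close>

lemma H0s_Lipschitz:
  fixes f :: "'a \<Rightarrow> real"
  assumes bd: "\<And>x. 0 \<le> f x" "\<And>x. f x \<le> 1" and L: "L \<ge> 0" "\<And>x y. \<bar>f x - f y\<bar> \<le> L * norm (x - y)"
    and supp: "\<And>x. x \<notin> \<Omega> \<Longrightarrow> f x = 0"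
  shows "f \<in> V"
proof (rule H0s_I)
  have cont: "continuous_on UNIV f"
    by (rule lipschitz_on_continuous_on[of L]) (auto intro!: lipschitz_onI simp: dist_real_def dist_norm L)
  then have [measurable]: "f \<in> borel_measurable borel" by (rule borel_measurable_continuous_onI)
  have [measurable]: "\<Omega> \<in> sets borel" using open_\<Omega> by simp
  have f: "f \<in> borel_measurable lebesgue" by (intro measurable_completion) simp
  show "AE x in lebesgue. x \<notin> \<Omega> \<longrightarrow> f x = 0" using supp by simp
  have "integrable lebesgue (\<lambda>x. (f x)\<^sup>2)"
  proof (rule Bochner_Integration.integrable_bound)
    show "integrable lebesgue (indicator \<Omega> :: 'a \<Rightarrow> real)"
      using emeasure_\<Omega>_finite(2) by (auto simp: fmeasurable_def less_top)
    show "(\<lambda>x. (f x)\<^sup>2) \<in> borel_measurable lebesgue" using f by simp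
    show "AE x in lebesgue. norm ((f x)\<^sup>2) \<le> norm (indicator \<Omega> x :: real)"
      using bd supp by (intro AE_I2) (auto simp: indicator_def power_le_one)
  qed
  then show "sq_integrable lebesgue f" using f by (simp add: sq_integrable_def)
  define e where "e = real DIM('a) + 2 * s"
  define h where "h t = min (L\<^sup>2 * (norm t)\<^sup>2) 1 / norm t powr e" for t :: 'a
  have [measurable]: "h \<in> borel_measurable borel" unfolding h_def by measurable
  define H where "H = (\<integral>\<^sup>+t. ennreal (h t) \<partial>lborel)"
  have H: "H < \<infinity>" unfolding H_def h_def e_def by (rule Gagliardo_kernel_integrable[OF s_pos s_lt_1 L(1)])
  have shift: "(\<integral>\<^sup>+y. ennreal (h (x - y)) \<partial>lborel) = H" for x
  proof -
    have "H = (\<integral>\<^sup>+t. ennreal (h t) \<partial>distr lborel borel ((+) (- x)))"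
      unfolding H_def by (simp add: lborel_distr_plus)
    also have "\<dots> = (\<integral>\<^sup>+y. ennreal (h (- x + y)) \<partial>lborel)"
      by (rule nn_integral_distr) auto
    also have "\<dots> = (\<integral>\<^sup>+y. ennreal (h (x - y)) \<partial>lborel)"
      by (intro nn_integral_cong) (simp add: h_def norm_minus_commute)
    finally show ?thesis by simp
  qed
  have shift': "(\<integral>\<^sup>+x. ennreal (h (x - y)) \<partial>lborel) = H" for y
    using shift[of y] by (simp add: h_def norm_minus_commute)
  have pt: "(gagliardo s f z)\<^sup>2 \<le> indicator \<Omega> (fst z) * h (fst z - snd z) + indicator \<Omega> (snd z) * h (fst z - snd z)" for z
  proof -
    let ?x = "fst z" and ?y = "snd z"
    have h0: "h t \<ge> 0" for t by (simp add: h_def)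
    have g: "(gagliardo s f z)\<^sup>2 = (f ?x - f ?y)\<^sup>2 / norm (?x - ?y) powr e"
      using gagliardo_mult[of s f z f] by (simp add: e_def power2_eq_square)
    have "\<bar>f ?x - f ?y\<bar> \<le> 1" using bd[of ?x] bd[of ?y] by linarith
    then have "(f ?x - f ?y)\<^sup>2 \<le> 1" by (simp add: abs_square_le_1)
    moreover have "(f ?x - f ?y)\<^sup>2 \<le> L\<^sup>2 * (norm (?x - ?y))\<^sup>2"
      using power_mono[OF L(2)[of ?x ?y], of 2] by (simp add: power_mult_distrib)
    ultimately have "(gagliardo s f z)\<^sup>2 \<le> h (?x - ?y)"
      unfolding g h_def by (intro divide_right_mono) auto
    moreover have "(gagliardo s f z)\<^sup>2 = 0" if "?x \<notin> \<Omega>" "?y \<notin> \<Omega>"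
      unfolding g using supp that by simp
    ultimately show ?thesis using h0[of "?x - ?y"] by (auto simp: indicator_def)
  qed
  have m1: "(\<lambda>z. ennreal (indicator \<Omega> (fst z) * h (fst z - snd z))) \<in> borel_measurable (lborel \<Otimes>\<^sub>M lborel)"
    and m2: "(\<lambda>z. ennreal (indicator \<Omega> (snd z) * h (fst z - snd z))) \<in> borel_measurable (lborel \<Otimes>\<^sub>M lborel)"
    by measurable
  have i1: "(\<integral>\<^sup>+z. ennreal (indicator \<Omega> (fst z) * h (fst z - snd z)) \<partial>(lborel \<Otimes>\<^sub>M lborel)) = H * emeasure lborel \<Omega>"
    unfolding lborel.nn_integral_fst[OF m1, symmetric]
    by (simp add: ennreal_mult' ennreal_indicator nn_integral_cmult shift nn_integral_multc mult.commute)
  have i2: "(\<integral>\<^sup>+z. ennreal (indicator \<Omega> (snd z) * h (fst z - snd z)) \<partial>(lborel \<Otimes>\<^sub>M lborel)) = H * emeasure lborel \<Omega>"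
    unfolding lborel_pair.nn_integral_snd[OF m2, symmetric]
    by (simp add: ennreal_mult' ennreal_indicator nn_integral_cmult shift' nn_integral_multc mult.commute)
  have "(\<integral>\<^sup>+z. ennreal (norm ((gagliardo s f z)\<^sup>2)) \<partial>lebesgue) = (\<integral>\<^sup>+z. ennreal ((gagliardo s f z)\<^sup>2) \<partial>(lborel \<Otimes>\<^sub>M lborel))"
    by (simp add: nn_integral_completion lborel_prod)
  also have "\<dots> \<le> (\<integral>\<^sup>+z. ennreal (indicator \<Omega> (fst z) * h (fst z - snd z))
      + ennreal (indicator \<Omega> (snd z) * h (fst z - snd z)) \<partial>(lborel \<Otimes>\<^sub>M lborel))"
  proof (rule nn_integral_mono)
    fix z :: "'a \<times> 'a"
    have "0 \<le> indicator \<Omega> (fst z) * h (fst z - snd z)" "0 \<le> indicator \<Omega> (snd z) * h (fst z - snd z)"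
      by (simp_all add: h_def)
    then show "ennreal ((gagliardo s f z)\<^sup>2) \<le> ennreal (indicator \<Omega> (fst z) * h (fst z - snd z))
      + ennreal (indicator \<Omega> (snd z) * h (fst z - snd z))"
      using ennreal_leI[OF pt[of z]] by (simp only: ennreal_plus)
  qed
  also have "\<dots> = H * emeasure lborel \<Omega> + H * emeasure lborel \<Omega>"
    using i1 i2 by (subst nn_integral_add[OF m1 m2]) simp
  also have "\<dots> < \<infinity>" using H emeasure_\<Omega>_finite(1) by (simp add: ennreal_mult_less_top)
  finally have fin: "(\<integral>\<^sup>+z. ennreal (norm ((gagliardo s f z)\<^sup>2)) \<partial>lebesgue) < \<infinity>" .
  have "integrable lebesgue (\<lambda>z. (gagliardo s f z)\<^sup>2)"
    using gagliardo_measurable[OF f, of s] by (intro integrableI_bounded fin) simp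
  then show "sq_integrable lebesgue (gagliardo s f)"
    using gagliardo_measurable[OF f, of s] by (simp add: sq_integrable_def)
qed

text \<open>The functions by which indicator functions of compact sets are approximated within the space.\<close>

lemma cutoff_exists:
  assumes K: "compact K" "K \<noteq> {}" and U: "open U" "K \<subseteq> U" "U \<subseteq> \<Omega>"
  obtains f where "f \<in> V" "\<And>x. 0 \<le> f x" "\<And>x. f x \<le> 1" "\<And>x. x \<in> K \<Longrightarrow> f x = 1" "\<And>x. x \<notin> U \<Longrightarrow> f x = 0"
proof -
  obtain d where d: "d > 0" "{x. infdist x K \<le> d} \<subseteq> U"
    using compact_in_open_separated[OF K(2,1) U(1,2)] .
  define f where "f x = max 0 (1 - infdist x K / d)" for x
  have f: "0 \<le> f x" "f x \<le> 1" "x \<in> K \<Longrightarrow> f x = 1" for x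
    using d(1) infdist_nonneg[of x K] by (auto simp: f_def)
  have f0: "f x = 0" if "x \<notin> U" for x
  proof -
    have "d < infdist x K" using d(2) that by force
    then show ?thesis using d(1) by (simp add: f_def)
  qed
  have "\<bar>f x - f y\<bar> \<le> (1 / d) * norm (x - y)" for x y
  proof -
    have "\<bar>f x - f y\<bar> \<le> \<bar>infdist x K / d - infdist y K / d\<bar>" unfolding f_def by linarith
    also have "\<dots> = \<bar>infdist x K - infdist y K\<bar> / d" using d(1) by (simp flip: diff_divide_distrib)
    also have "\<dots> \<le> dist x y / d" using infdist_triangle_abs d(1) by (intro divide_right_mono) auto
    finally show ?thesis by (simp add: dist_norm)
  qed
  moreover have "f x = 0" if "x \<notin> \<Omega>" for x using f0 U(3) that by blast
  ultimately have "f \<in> V" using f d(1) by (intro H0s_Lipschitz[of f "1 / d"]) simp_all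
  then show thesis using that f f0 by blast
qed

lemma compact_subset_positive_measure:
  assumes E: "E \<in> sets lebesgue" "E \<subseteq> \<Omega>" "emeasure lebesgue E > 0"
  obtains K where "compact K" "K \<subseteq> E" "measure lebesgue K > 0" "K \<noteq> {}"
proof -
  have fin: "E \<in> lmeasurable"
    by (rule fmeasurableI2[OF emeasure_\<Omega>_finite(2) E(2,1)])
  then have pos: "measure lebesgue E > 0" 
    using E(3) by (simp add: emeasure_eq_measure2)
  obtain T where T: "closed T" "T \<subseteq> E" "E - T \<in> lmeasurable" "emeasure lebesgue (E - T) < ennreal (measure lebesgue E)"
    using sets_lebesgue_inner_closed[OF E(1) pos] .
  have "compact T"
    using T(1,2) E(2) bounded_\<Omega> by (meson bounded_subset compact_eq_bounded_closed order_trans)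
  moreover have "measure lebesgue (E - T) < measure lebesgue E"
    using T(3,4) pos by (simp add: emeasure_eq_measure2 ennreal_less_iff)
  then have "measure lebesgue T > 0"
    using measurable_measure_Diff[OF fin _ T(2)] lmeasurable_compact[OF \<open>compact T\<close>] by auto
  moreover from this have "T \<noteq> {}" by auto
  ultimately show thesis using that T(2) by blast
qed

text \<open>Take a compact set \<open>K\<close> on which \<open>\<rho> > 0\<close> and a cutoff that is \<open>1\<close> on \<open>K\<close>. Outside \<open>K\<close> it lives on an
open set that exceeds \<open>K\<close> by so little measure that the negative part of \<open>\<rho>\<close> cannot compensate.\<close>

lemma positive_part_gives_positive_form:
  assumes \<rho>: "\<rho> \<in> Linf \<Omega>" and pos: "emeasure lebesgue {x \<in> \<Omega>. \<rho> x > 0} > 0"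
  shows "\<exists>f\<in>V. W \<rho> f f > 0"
proof -
  obtain r C where r: "r \<in> borel_measurable lebesgue" "C \<ge> 0" "\<And>x. \<bar>r x\<bar> \<le> C"
    "AE x in lebesgue. x \<in> \<Omega> \<longrightarrow> \<rho> x = r x"
    using Linf_bounded_representative[OF \<rho>] by metis
  define E where "E = {x \<in> \<Omega>. r x > 0}"
  have "{x \<in> space lebesgue. r x > 0} \<in> sets lebesgue" using r(1) by measurable
  then have E: "E \<in> sets lebesgue" using \<Omega>_measurable(1) by (auto simp: E_def Collect_conj_eq)
  have "emeasure lebesgue {x \<in> \<Omega>. \<rho> x > 0} \<le> emeasure lebesgue E"
    using r(4) by (intro emeasure_mono_AE E) (auto simp: E_def elim: eventually_mono)
  then have "emeasure lebesgue E > 0" using pos by simp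
  then obtain K where K: "compact K" "K \<subseteq> E" "measure lebesgue K > 0" "K \<noteq> {}"
    using compact_subset_positive_measure[OF E] by (auto simp: E_def)
  have Km: "K \<in> lmeasurable" using K(1) by (rule lmeasurable_compact)
  have iK: "integrable lebesgue (\<lambda>x. indicator K x * r x)"
  proof (rule Bochner_Integration.integrable_bound)
    show "integrable lebesgue (\<lambda>x. C * indicator K x)"
      using Km by (auto simp: fmeasurable_def less_top)
    show "(\<lambda>x. indicator K x * r x) \<in> borel_measurable lebesgue"
      using Km r(1) by (intro borel_measurable_times borel_measurable_indicator) auto
    show "AE x in lebesgue. norm (indicator K x * r x) \<le> norm (C * indicator K x)"
      using r(2,3) by (intro AE_I2) (auto simp: indicator_def)
  qed
  define m where "m = (\<integral>x. indicator K x * r x \<partial>lebesgue)"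
  have nn: "AE x in lebesgue. 0 \<le> indicator K x * r x"
    using K(2) by (intro AE_I2) (auto simp: indicator_def E_def less_imp_le)
  have "m \<noteq> 0"
  proof
    assume "m = 0"
    then have "AE x in lebesgue. indicator K x * r x = 0"
      using integral_nonneg_eq_0_iff_AE[OF iK nn] by (simp add: m_def)
    then have "AE x in lebesgue. x \<notin> K"
      by eventually_elim (use K(2) in \<open>auto simp: indicator_def E_def split: if_splits\<close>)
    then have "emeasure lebesgue K = 0" using Km by (auto simp: AE_iff_measurable[OF _ refl])
    then show False using K(3) by (simp add: measure_def)
  qed
  moreover have "m \<ge> 0" unfolding m_def by (rule integral_nonneg_AE[OF nn])
  ultimately have m: "m > 0" by simp
  obtain T where T: "open T" "K \<subseteq> T" "T - K \<in> lmeasurable" "emeasure lebesgue (T - K) < ennreal (m / (C + 1))"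
    using sets_lebesgue_outer_open[of K "m / (C + 1)"] Km m r(2) by auto
  have mT: "measure lebesgue (T - K) < m / (C + 1)"
    using T(3,4) m r(2) by (simp add: emeasure_eq_measure2 ennreal_less_iff)
  have KT: "K \<subseteq> T \<inter> \<Omega>" using K(2) T(2) by (auto simp: E_def)
  obtain f where f: "f \<in> V" "\<And>x. 0 \<le> f x" "\<And>x. f x \<le> 1" "\<And>x. x \<in> K \<Longrightarrow> f x = 1" "\<And>x. x \<notin> T \<inter> \<Omega> \<Longrightarrow> f x = 0"
    using cutoff_exists[OF K(1,4) _ KT] T(1) open_\<Omega> by blast
  have iT: "integrable lebesgue (indicator (T - K) :: 'a \<Rightarrow> real)" "integral\<^sup>L lebesgue (indicator (T - K)) = measure lebesgue (T - K)"
    using T(3) by (auto simp: fmeasurable_def less_top)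
  have "m - C * measure lebesgue (T - K) = (\<integral>x. indicator K x * r x - C * indicator (T - K) x \<partial>lebesgue)"
    using iK iT by (simp add: m_def)
  also have "\<dots> \<le> (\<integral>x. (r x * f x) * f x \<partial>lebesgue)"
  proof (rule integral_mono)
    show "integrable lebesgue (\<lambda>x. indicator K x * r x - C * indicator (T - K) x)" using iK iT by simp
    show "integrable lebesgue (\<lambda>x. (r x * f x) * f x)"
      by (intro sq_integrable_mult_integrable weighted_sq_integrable[OF r(1,3)] H0s_D(1)[OF f(1)])
    fix x
    have "\<bar>r x * f x * f x\<bar> \<le> C * 1 * 1"
      unfolding abs_mult using r(2,3) f(2,3)[of x] by (intro mult_mono) auto
    then have "- C \<le> r x * f x * f x" by linarith
    then show "indicator K x * r x - C * indicator (T - K) x \<le> (r x * f x) * f x"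
      using f(4,5)[of x] r(2) by (auto simp: indicator_def)
  qed
  finally have "m - C * measure lebesgue (T - K) \<le> W \<rho> f f"
    unfolding W_representation(2)[OF r(1,3,4) \<rho> f(1) f(1)] .
  moreover have "C * measure lebesgue (T - K) < m"
  proof -
    have "(C + 1) * measure lebesgue (T - K) < m" using mT r(2) by (simp add: field_simps)
    then show ?thesis using measure_nonneg[of lebesgue "T - K"] unfolding distrib_right mult_1 by linarith
  qed
  ultimately show ?thesis using f(1) by force
qed

section \<open>First eigenfunctions\<close>

lemma H0s_integrable:
  assumes "w \<in> V"
  shows "integrable lebesgue w"
proof -
  have I: "sq_integrable lebesgue (indicator \<Omega> :: 'a \<Rightarrow> real)"
    using emeasure_\<Omega>_finite(2) unfolding sq_integrable_def
    by (auto simp: fmeasurable_def less_top power2_eq_square indicator_inter_arith[symmetric]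
        intro!: borel_measurable_indicator)
  have i: "integrable lebesgue (\<lambda>x. indicator \<Omega> x * w x)"
    by (rule sq_integrable_mult_integrable[OF I H0s_D(1)[OF assms]])
  have "AE x in lebesgue. indicator \<Omega> x * w x = w x"
    using H0s_D(3)[OF assms] by eventually_elim (auto simp: indicator_def)
  then show ?thesis using integrable_cong_AE[OF _ H0s_D(4)[OF assms]] i by blast
qed

text \<open>If \<open>w x > 0 > w y\<close>, then \<open>\<bar>w\<bar>\<close> has a strictly smaller increment between \<open>x\<close> and \<open>y\<close>. So
equal energies force the set of such pairs to be null; it is the product of the sets where
\<open>w > 0\<close> and \<open>w < 0\<close>, so one of these is null.\<close>

lemma one_sign_if_abs_energy:
  assumes w: "w \<in> V" and eq: "B w w \<le> B (\<lambda>x. \<bar>w x\<bar>) (\<lambda>x. \<bar>w x\<bar>)"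
  shows "(AE x in lebesgue. 0 \<le> w x) \<or> (AE x in lebesgue. w x \<le> 0)"
proof -
  have aw: "(\<lambda>x. \<bar>w x\<bar>) \<in> V" by (rule H0s_abs[OF w])
  let ?a = "\<lambda>z. (gagliardo s w z)\<^sup>2" and ?b = "\<lambda>z. (gagliardo s (\<lambda>x. \<bar>w x\<bar>) z)\<^sup>2"
  have i: "integrable lebesgue ?a" "integrable lebesgue ?b"
    using H0s_D(2)[OF w] H0s_D(2)[OF aw] by (simp_all add: sq_integrable_def)
  have nn: "0 \<le> ?a z - ?b z" for z using gagliardo_abs_le[of s w z] by simp
  have "(\<integral>z. ?a z - ?b z \<partial>lebesgue) = B w w - B (\<lambda>x. \<bar>w x\<bar>) (\<lambda>x. \<bar>w x\<bar>)"
    using i by (simp add: H0s_inner_self)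
  moreover have "(\<integral>z. ?a z - ?b z \<partial>lebesgue) \<ge> 0" using nn by (intro Bochner_Integration.integral_nonneg)
  ultimately have "(\<integral>z. ?a z - ?b z \<partial>lebesgue) = 0" using eq by linarith
  then have "AE z in lebesgue. ?a z - ?b z = 0"
    using integral_nonneg_eq_0_iff_AE[of lebesgue "\<lambda>z. ?a z - ?b z"] i nn by simp
  then have prod: "AE z in lebesgue. max 0 (w (fst z)) * max 0 (- w (snd z)) = 0"
  proof eventually_elim
    case (elim z)
    show ?case
    proof (rule ccontr)
      assume "max 0 (w (fst z)) * max 0 (- w (snd z)) \<noteq> 0"
      then have pos: "w (fst z) > 0" "w (snd z) < 0" by (auto simp: max_def split: if_splits)
      then have "norm (fst z - snd z) > 0" by auto
      then have n: "norm (fst z - snd z) powr (real DIM('a) + 2 * s) > 0" by simp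
      have "(w (fst z) - w (snd z)) * (w (fst z) - w (snd z))
          = (\<bar>w (fst z)\<bar> - \<bar>w (snd z)\<bar>) * (\<bar>w (fst z)\<bar> - \<bar>w (snd z)\<bar>)"
        using elim n unfolding power2_eq_square gagliardo_mult by simp
      then have "w (fst z) * w (snd z) = 0" using pos by (simp add: algebra_simps)
      then show False using pos by simp
    qed
  qed
  have ip: "integrable lebesgue (\<lambda>x. max 0 (w x))" by (intro H0s_integrable H0s_pos_part w)
  have "(\<lambda>x. (- 1) * w x) \<in> V" by (rule H0s_cmult[OF w])
  then have "(\<lambda>x. - w x) \<in> V" by simp
  then have im: "integrable lebesgue (\<lambda>x. max 0 (- w x))" by (intro H0s_integrable H0s_pos_part)
  have "(\<integral>x. max 0 (w x) \<partial>lebesgue) * (\<integral>x. max 0 (- w x) \<partial>lebesgue) = 0"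
    unfolding lebesgue_integral_tensor(2)[OF ip im, symmetric]
    using prod by (rule integral_eq_zero_AE)
  then consider "(\<integral>x. max 0 (w x) \<partial>lebesgue) = 0" | "(\<integral>x. max 0 (- w x) \<partial>lebesgue) = 0" by auto
  then show ?thesis
  proof cases
    case 1
    then have "AE x in lebesgue. max 0 (w x) = 0"
      using integral_nonneg_eq_0_iff_AE[OF ip] by simp
    then have "AE x in lebesgue. w x \<le> 0" by eventually_elim (simp add: max_def split: if_splits)
    then show ?thesis ..
  next
    case 2
    then have "AE x in lebesgue. max 0 (- w x) = 0"
      using integral_nonneg_eq_0_iff_AE[OF im] by simp
    then have "AE x in lebesgue. 0 \<le> w x" by eventually_elim (simp add: max_def split: if_splits)
    then show ?thesis ..
  qed
qed

lemma one_sign_zero_integral: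
  assumes "w \<in> V" "(AE x in lebesgue. 0 \<le> w x) \<or> (AE x in lebesgue. w x \<le> 0)"
    and "(\<integral>x. w x \<partial>lebesgue) = 0"
  shows "AE x in lebesgue. w x = 0"
  using assms(2)
proof
  assume "AE x in lebesgue. 0 \<le> w x"
  then show ?thesis using integral_nonneg_eq_0_iff_AE[OF H0s_integrable[OF assms(1)]] assms(3) by simp
next
  assume "AE x in lebesgue. w x \<le> 0"
  then show ?thesis
    using integral_nonneg_eq_0_iff_AE[of lebesgue "\<lambda>x. - w x"] H0s_integrable[OF assms(1)] assms(3) by simp
qed

text \<open>The maximizers of the quotient with maximum \<open>M\<close>. The zero function is admitted, which makes
them closed under linear combinations.\<close>

definition extremal :: "('a \<Rightarrow> real) \<Rightarrow> real \<Rightarrow> ('a \<Rightarrow> real) \<Rightarrow> bool" where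
  "extremal \<rho> M w \<longleftrightarrow> \<rho> \<in> Linf \<Omega> \<and> M > 0 \<and> (\<forall>g\<in>V. W \<rho> g g \<le> M * B g g) \<and> w \<in> V \<and> W \<rho> w w = M * B w w"

lemma extremal_weak:
  assumes "extremal \<rho> M w" "\<phi> \<in> V"
  shows "W \<rho> w \<phi> = M * B w \<phi>"
proof -
  note e = assms(1)[unfolded extremal_def]
  have \<rho>: "\<rho> \<in> Linf \<Omega>" using e by simp
  show ?thesis
    by (rule maximizer_weak_equation[of "W \<rho>", OF W_commute W_linear[OF \<rho>]]) (use e assms(2) in simp_all)
qed

lemma extremal_combination:
  assumes u: "extremal \<rho> M u" and v: "extremal \<rho> M v"
  shows "extremal \<rho> M (\<lambda>x. u x + c * v x)"
proof -
  have mem: "u \<in> V" "v \<in> V" "\<rho> \<in> Linf \<Omega>" using u v by (auto simp: extremal_def)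
  have cv: "(\<lambda>x. c * v x) \<in> V" by (rule H0s_cmult[OF mem(2)])
  have d: "(\<lambda>x. u x + c * v x) \<in> V" (is "?d \<in> V") by (rule H0s_add[OF mem(1) cv])
  have "W \<rho> ?d ?d = W \<rho> u ?d + c * W \<rho> v ?d" by (rule W_linear[OF mem(3,1,2) d])
  also have "\<dots> = M * (B u ?d + c * B v ?d)"
    using extremal_weak[OF u d] extremal_weak[OF v d] by (simp add: algebra_simps)
  also have "B u ?d + c * B v ?d = B ?d ?d"
    by (simp add: H0s_inner_add[OF mem(1) cv d] H0s_inner_cmult)
  finally show ?thesis using u d by (simp add: extremal_def)
qed

lemma extremal_abs:
  assumes w: "extremal \<rho> M w"
  shows "extremal \<rho> M (\<lambda>x. \<bar>w x\<bar>)" "B (\<lambda>x. \<bar>w x\<bar>) (\<lambda>x. \<bar>w x\<bar>) = B w w"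
    "(AE x in lebesgue. 0 \<le> w x) \<or> (AE x in lebesgue. w x \<le> 0)"
proof -
  note e = w[unfolded extremal_def]
  have V: "w \<in> V" "(\<lambda>x. \<bar>w x\<bar>) \<in> V" using e H0s_abs by auto
  have max: "\<forall>g\<in>V. W \<rho> g g \<le> M * B g g" using e by simp
  have "W \<rho> (\<lambda>x. \<bar>w x\<bar>) (\<lambda>x. \<bar>w x\<bar>) = W \<rho> w w"
    by (simp add: mult.assoc)
  then have Wa: "W \<rho> (\<lambda>x. \<bar>w x\<bar>) (\<lambda>x. \<bar>w x\<bar>) = M * B w w" using e by simp
  have "W \<rho> (\<lambda>x. \<bar>w x\<bar>) (\<lambda>x. \<bar>w x\<bar>) \<le> M * B (\<lambda>x. \<bar>w x\<bar>) (\<lambda>x. \<bar>w x\<bar>)"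
    using bspec[OF max V(2)] .
  then have ge: "B w w \<le> B (\<lambda>x. \<bar>w x\<bar>) (\<lambda>x. \<bar>w x\<bar>)" using e Wa by simp
  have le: "B (\<lambda>x. \<bar>w x\<bar>) (\<lambda>x. \<bar>w x\<bar>) \<le> B w w"
    unfolding H0s_inner_self
    using H0s_D(2)[OF V(1)] H0s_D(2)[OF V(2)]
    by (intro integral_mono gagliardo_abs_le) (simp_all add: sq_integrable_def)
  from ge le show eq: "B (\<lambda>x. \<bar>w x\<bar>) (\<lambda>x. \<bar>w x\<bar>) = B w w" by simp
  show "extremal \<rho> M (\<lambda>x. \<bar>w x\<bar>)" unfolding extremal_def using e V(2) Wa eq by simp
  show "(AE x in lebesgue. 0 \<le> w x) \<or> (AE x in lebesgue. w x \<le> 0)"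
    by (rule one_sign_if_abs_energy[OF V(1) ge])
qed

text \<open>The combination of \<open>u\<close> and \<open>v\<close> with integral zero is again a maximizer, hence has one sign, hence
vanishes. So \<open>u\<close> is a multiple of \<open>v\<close>, and the normalization leaves only the sign undetermined.\<close>

lemma extremal_simple:
  assumes u: "extremal \<rho> M u" "B u u = 1" and v: "extremal \<rho> M v" "B v v = 1"
  shows "AE x in lebesgue. (u x)\<^sup>2 = (v x)\<^sup>2"
proof -
  have V: "u \<in> V" "v \<in> V" using u v by (auto simp: extremal_def)
  have Iv: "(\<integral>x. v x \<partial>lebesgue) \<noteq> 0"
    using one_sign_zero_integral[OF V(2) extremal_abs(3)[OF v(1)]] normalized_not_AE_zero[OF V(2) v(2)] by blast
  define c where "c = - (\<integral>x. u x \<partial>lebesgue) / (\<integral>x. v x \<partial>lebesgue)"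
  let ?d = "\<lambda>x. u x + c * v x"
  have d: "extremal \<rho> M ?d" by (rule extremal_combination[OF u(1) v(1)])
  have "(\<integral>x. ?d x \<partial>lebesgue) = (\<integral>x. u x \<partial>lebesgue) + c * (\<integral>x. v x \<partial>lebesgue)"
    using H0s_integrable[OF V(1)] H0s_integrable[OF V(2)] by simp
  also have "\<dots> = 0" using Iv by (simp add: c_def)
  finally have "AE x in lebesgue. ?d x = 0"
    using one_sign_zero_integral[OF _ extremal_abs(3)[OF d]] d by (simp add: extremal_def)
  then have ae: "AE x in lebesgue. u x = (- c) * v x" by eventually_elim simp
  have cv: "(\<lambda>x. (- c) * v x) \<in> V" by (rule H0s_cmult[OF V(2)])
  have "1 = B (\<lambda>x. (- c) * v x) u"
    using H0s_inner_cong[OF H0s_D(4)[OF V(1)] H0s_D(4)[OF cv] H0s_D(4)[OF V(1)] ae] u(2) by simp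
  also have "\<dots> = (- c) * B u v" unfolding H0s_inner_cmult by (simp add: H0s_inner_commute)
  also have "B u v = B (\<lambda>x. (- c) * v x) v"
    by (rule H0s_inner_cong[OF H0s_D(4)[OF V(1)] H0s_D(4)[OF cv] H0s_D(4)[OF V(2)] ae])
  also have "\<dots> = - c" unfolding H0s_inner_cmult using v(2) by simp
  finally have c: "c\<^sup>2 = 1" by (simp add: power2_eq_square)
  show ?thesis using ae by eventually_elim (simp add: power_mult_distrib c)
qed

end

section \<open>Strict positivity\<close>

text \<open>With \<open>d\<close> the increment of the positive part of \<open>p - a\<close>, the left-hand side equals
\<open>(p - q) * d - d\<^sup>2\<close>. The products on the left are the cross terms between the positive and negative
parts, which in a nonlocal energy do not vanish.\<close>

lemma truncation_inequality:
  fixes a b p q :: real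
  shows "(a - b) * (max 0 (p - a) - max 0 (q - b))
    + (max 0 (a - p) * max 0 (q - b) + max 0 (b - q) * max 0 (p - a)) \<le> (p - q)\<^sup>2 / 4"
proof -
  define g where "g = p - a"
  define h where "h = q - b"
  define d where "d = max 0 g - max 0 h"
  have "(g - h) * d = d\<^sup>2 + (max 0 (- g) * max 0 h + max 0 (- h) * max 0 g)"
    unfolding d_def by (auto simp: max_def power2_eq_square algebra_simps)
  then have "(a - b) * d + (max 0 (- g) * max 0 h + max 0 (- h) * max 0 g) = (p - q) * d - d\<^sup>2"
    unfolding g_def h_def by (simp add: algebra_simps)
  also have "\<dots> \<le> (p - q)\<^sup>2 / 4"
    using zero_le_power2[of "(p - q) / 2 - d"] by (simp add: power2_eq_square field_simps)
  finally show ?thesis by (simp add: d_def g_def h_def)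
qed

context fractional_domain
begin

text \<open>Integrated form of the preceding inequality. On \<open>\<Omega> \<times> \<Omega>\<close> the kernel is bounded below,
so the cross terms dominate a multiple of the product of the two integrals.\<close>

lemma truncation_energy:
  shows "\<exists>k>0. \<forall>u\<in>V. \<forall>\<eta>\<in>V. (\<forall>x. x \<notin> \<Omega> \<longrightarrow> u x = 0) \<longrightarrow> (\<forall>x. x \<notin> \<Omega> \<longrightarrow> \<eta> x = 0) \<longrightarrow>
      B u (\<lambda>x. max 0 (\<eta> x - u x))
      + k * (\<integral>x. max 0 (u x - \<eta> x) \<partial>lebesgue) * (\<integral>x. max 0 (\<eta> x - u x) \<partial>lebesgue) \<le> B \<eta> \<eta> / 4"
proof -
  obtain R where R: "R > 0" "\<Omega> \<subseteq> ball 0 R"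
    using bounded_subset_ballD[OF bounded_\<Omega>, of 0] by auto
  define e where "e = real DIM('a) + 2 * s"
  have e: "e > 0" using s_pos by (simp add: e_def add_nonneg_pos)
  define k where "k = 1 / (2 * R) powr e"
  have k: "k > 0" using R by (simp add: k_def)
  have "B u (\<lambda>x. max 0 (\<eta> x - u x))
      + 2 * k * (\<integral>x. max 0 (u x - \<eta> x) \<partial>lebesgue) * (\<integral>x. max 0 (\<eta> x - u x) \<partial>lebesgue) \<le> B \<eta> \<eta> / 4"
    if u: "u \<in> V" and \<eta>: "\<eta> \<in> V" and u0: "\<And>x. x \<notin> \<Omega> \<Longrightarrow> u x = 0" and \<eta>0: "\<And>x. x \<notin> \<Omega> \<Longrightarrow> \<eta> x = 0" for u \<eta>
  proof -
    define \<phi> where "\<phi> x = max 0 (\<eta> x - u x)" for x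
    define \<psi> where "\<psi> x = max 0 (u x - \<eta> x)" for x
    have \<phi>: "\<phi> \<in> V" unfolding \<phi>_def by (intro H0s_pos_part H0s_diff u \<eta>)
    have \<psi>: "\<psi> \<in> V" unfolding \<psi>_def by (intro H0s_pos_part H0s_diff u \<eta>)
    have i: "integrable lebesgue \<phi>" "integrable lebesgue \<psi>" using \<phi> \<psi> H0s_integrable by auto
    note t = lebesgue_integral_tensor[OF i(2,1)] lebesgue_integral_tensor[OF i(1,2)]
    have "B u \<phi> + 2 * k * (\<integral>x. \<psi> x \<partial>lebesgue) * (\<integral>x. \<phi> x \<partial>lebesgue) =
      (\<integral>z. gagliardo s u z * gagliardo s \<phi> z + k * (\<psi> (fst z) * \<phi> (snd z) + \<phi> (fst z) * \<psi> (snd z)) \<partial>lebesgue)"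
      using gagliardo_mult_integrable[OF u \<phi>] t by (simp add: H0s_inner_gagliardo algebra_simps)
    also have "\<dots> \<le> (\<integral>z. (gagliardo s \<eta> z)\<^sup>2 / 4 \<partial>lebesgue)"
    proof (rule integral_mono)
      show "integrable lebesgue (\<lambda>z. gagliardo s u z * gagliardo s \<phi> z + k * (\<psi> (fst z) * \<phi> (snd z) + \<phi> (fst z) * \<psi> (snd z)))"
        using gagliardo_mult_integrable[OF u \<phi>] t by simp
      show "integrable lebesgue (\<lambda>z. (gagliardo s \<eta> z)\<^sup>2 / 4)"
        using H0s_D(2)[OF \<eta>] by (simp add: sq_integrable_def)
      fix z :: "'a \<times> 'a"
      let ?x = "fst z" and ?y = "snd z"
      let ?n = "norm (?x - ?y) powr e"
      let ?S = "\<psi> ?x * \<phi> ?y + \<phi> ?x * \<psi> ?y"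
      have S0: "?S \<ge> 0" by (simp add: \<phi>_def \<psi>_def)
      have kS: "k * ?S \<le> ?S / ?n"
      proof (cases "?x \<in> \<Omega> \<and> ?y \<in> \<Omega> \<and> ?x \<noteq> ?y")
        case True
        then have "norm ?x < R" "norm ?y < R" using R by auto
        then have "norm (?x - ?y) \<le> 2 * R" using norm_triangle_ineq4[of ?x ?y] by linarith
        then have "?n \<le> (2 * R) powr e" using e by (intro powr_mono2) auto
        then have "?S / (2 * R) powr e \<le> ?S / ?n" using True S0 R by (intro divide_left_mono) auto
        then show ?thesis by (simp add: k_def)
      next
        case False
        have "?S = 0"
        proof (cases "?x = ?y")
          case True
          then show ?thesis by (auto simp: \<phi>_def \<psi>_def max_def)
        next
          case False
          then show ?thesis using \<open>\<not> (?x \<in> \<Omega> \<and> ?y \<in> \<Omega> \<and> ?x \<noteq> ?y)\<close> u0 \<eta>0 by (auto simp: \<phi>_def \<psi>_def)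
        qed
        then show ?thesis by simp
      qed
      have "gagliardo s u z * gagliardo s \<phi> z + k * ?S \<le> ((u ?x - u ?y) * (\<phi> ?x - \<phi> ?y) + ?S) / ?n"
        using kS by (simp add: gagliardo_mult e_def add_divide_distrib)
      also have "\<dots> \<le> ((\<eta> ?x - \<eta> ?y)\<^sup>2 / 4) / ?n"
        using truncation_inequality[of "u ?x" "u ?y" "\<eta> ?x" "\<eta> ?y"]
        by (intro divide_right_mono) (auto simp: \<phi>_def \<psi>_def mult.commute)
      also have "\<dots> = (gagliardo s \<eta> z)\<^sup>2 / 4"
        by (simp add: power2_eq_square gagliardo_mult e_def)
      finally show "gagliardo s u z * gagliardo s \<phi> z + k * ?S \<le> (gagliardo s \<eta> z)\<^sup>2 / 4" .
    qed
    also have "\<dots> = B \<eta> \<eta> / 4" by (simp add: H0s_inner_self)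
    finally show ?thesis by (simp add: \<phi>_def[abs_def] \<psi>_def[abs_def])
  qed
  then show ?thesis using k by (intro exI[of _ "2 * k"]) simp
qed

text \<open>The strong maximum principle. Let \<open>\<eta>\<close> be a cutoff that is \<open>1\<close> on \<open>K\<close>, and test the equation with
\<open>\<phi> = max 0 (\<epsilon> \<eta> - u)\<close>. Where \<open>\<phi> > 0\<close> both \<open>u\<close> and \<open>\<phi>\<close> are at most \<open>\<epsilon> \<eta>\<close>, so \<open>W \<rho> u \<phi>\<close> is
of order \<open>\<epsilon>\<^sup>2\<close>, and so is the bound in \<open>truncation_energy\<close>. But \<open>\<phi> = \<epsilon>\<close> on \<open>K\<close>, so the product of the two
integrals in that bound is at least of order \<open>\<epsilon>\<close>, unless the integral of \<open>u\<close> is zero.\<close>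

lemma weak_solution_vanishing_on_compact:
  assumes \<rho>: "\<rho> \<in> Linf \<Omega>" and M: "M > 0" and u: "u \<in> V"
    and weak: "\<And>\<phi>. \<phi> \<in> V \<Longrightarrow> W \<rho> u \<phi> = M * B u \<phi>"
    and u_nonneg: "\<And>x. 0 \<le> u x" and u0: "\<And>x. x \<notin> \<Omega> \<Longrightarrow> u x = 0"
    and K: "compact K" "K \<subseteq> {x \<in> \<Omega>. u x = 0}" "measure lebesgue K > 0" "K \<noteq> {}"
  shows "AE x in lebesgue. u x = 0"
proof -
  obtain k where k: "k > 0"
    "\<forall>u\<in>V. \<forall>\<eta>\<in>V. (\<forall>x. x \<notin> \<Omega> \<longrightarrow> u x = 0) \<longrightarrow> (\<forall>x. x \<notin> \<Omega> \<longrightarrow> \<eta> x = 0) \<longrightarrow>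
      B u (\<lambda>x. max 0 (\<eta> x - u x))
      + k * (\<integral>x. max 0 (u x - \<eta> x) \<partial>lebesgue) * (\<integral>x. max 0 (\<eta> x - u x) \<partial>lebesgue) \<le> B \<eta> \<eta> / 4"
    using truncation_energy by blast
  have "K \<subseteq> \<Omega>" using K(2) by blast
  obtain \<eta> where \<eta>: "\<eta> \<in> V" "\<And>x. 0 \<le> \<eta> x" "\<And>x. \<eta> x \<le> 1" "\<And>x. x \<in> K \<Longrightarrow> \<eta> x = 1" "\<And>x. x \<notin> \<Omega> \<Longrightarrow> \<eta> x = 0"
    using cutoff_exists[OF K(1,4) open_\<Omega> \<open>K \<subseteq> \<Omega>\<close> order_refl] by blast
  obtain r C where r: "r \<in> borel_measurable lebesgue" "C \<ge> 0" "\<And>x. \<bar>r x\<bar> \<le> C"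
    "AE x in lebesgue. x \<in> \<Omega> \<longrightarrow> \<rho> x = r x"
    using Linf_bounded_representative[OF \<rho>] by metis
  define I where "I = (\<integral>x. u x \<partial>lebesgue)"
  define J where "J = (\<integral>x. \<eta> x \<partial>lebesgue)"
  define m where "m = measure lebesgue K"
  define N where "N = (\<integral>x. (\<eta> x)\<^sup>2 \<partial>lebesgue)"
  define D where "D = B \<eta> \<eta> / 4 + C * N / M"
  have iu: "integrable lebesgue u" and i\<eta>: "integrable lebesgue \<eta>" using H0s_integrable u \<eta>(1) by auto
  have main: "k * (I - \<epsilon> * J) * m \<le> \<epsilon> * D" if \<epsilon>: "\<epsilon> > 0" "I - \<epsilon> * J \<ge> 0" for \<epsilon>
  proof -
    let ?\<eta> = "\<lambda>x. \<epsilon> * \<eta> x"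
    have \<epsilon>\<eta>: "?\<eta> \<in> V" by (rule H0s_cmult[OF \<eta>(1)])
    define \<phi> where "\<phi> x = max 0 (?\<eta> x - u x)" for x
    define \<psi> where "\<psi> x = max 0 (u x - ?\<eta> x)" for x
    have \<phi>: "\<phi> \<in> V" unfolding \<phi>_def by (intro H0s_pos_part H0s_diff u \<epsilon>\<eta>)
    have \<psi>: "\<psi> \<in> V" unfolding \<psi>_def by (intro H0s_pos_part H0s_diff u \<epsilon>\<eta>)
    have energy: "B u \<phi> + k * (\<integral>x. \<psi> x \<partial>lebesgue) * (\<integral>x. \<phi> x \<partial>lebesgue) \<le> \<epsilon>\<^sup>2 * (B \<eta> \<eta> / 4)"
    proof -
      have "B ?\<eta> ?\<eta> = \<epsilon>\<^sup>2 * B \<eta> \<eta>"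
        by (subst H0s_inner_cmult, subst H0s_inner_commute, subst H0s_inner_cmult) (simp add: power2_eq_square)
      then show ?thesis using bspec[OF bspec[OF k(2) u] \<epsilon>\<eta>] u0 \<eta>(5) by (simp add: \<phi>_def[abs_def] \<psi>_def[abs_def])
    qed
    have "(\<integral>x. - (C * \<epsilon>\<^sup>2) * (\<eta> x)\<^sup>2 \<partial>lebesgue) \<le> (\<integral>x. (r x * u x) * \<phi> x \<partial>lebesgue)"
    proof (rule integral_mono)
      show "integrable lebesgue (\<lambda>x. - (C * \<epsilon>\<^sup>2) * (\<eta> x)\<^sup>2)"
        using H0s_D(1)[OF \<eta>(1)] by (simp add: sq_integrable_def)
      show "integrable lebesgue (\<lambda>x. (r x * u x) * \<phi> x)"
        by (intro sq_integrable_mult_integrable weighted_sq_integrable[OF r(1,3)] H0s_D(1)[OF u] H0s_D(1)[OF \<phi>])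
      fix x
      have "u x * \<phi> x \<le> ?\<eta> x * ?\<eta> x"
        using u_nonneg[of x] \<eta>(2)[of x] \<epsilon>(1) by (auto simp: \<phi>_def max_def intro!: mult_mono)
      moreover have "0 \<le> u x * \<phi> x" using u_nonneg[of x] by (simp add: \<phi>_def)
      ultimately have "\<bar>r x * (u x * \<phi> x)\<bar> \<le> C * (?\<eta> x * ?\<eta> x)"
        unfolding abs_mult[of "r x"] using r(2,3) by (intro mult_mono) auto
      then show "- (C * \<epsilon>\<^sup>2) * (\<eta> x)\<^sup>2 \<le> (r x * u x) * \<phi> x"
        by (simp add: power2_eq_square mult_ac abs_le_iff)
    qed
    then have "- (C * \<epsilon>\<^sup>2) * N \<le> M * B u \<phi>"
      using weak[OF \<phi>] W_representation(2)[OF r(1,3,4) \<rho> u \<phi>] by (simp add: N_def)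
    then have "- (C * \<epsilon>\<^sup>2) * N / M \<le> B u \<phi>" using M by (simp add: field_simps)
    with energy have 1: "k * (\<integral>x. \<psi> x \<partial>lebesgue) * (\<integral>x. \<phi> x \<partial>lebesgue) \<le> \<epsilon>\<^sup>2 * D"
      by (simp add: D_def algebra_simps)
    have "I - \<epsilon> * J = (\<integral>x. u x - ?\<eta> x \<partial>lebesgue)" using iu i\<eta> by (simp add: I_def J_def)
    also have "\<dots> \<le> (\<integral>x. \<psi> x \<partial>lebesgue)"
      using iu i\<eta> H0s_integrable[OF \<psi>] by (intro integral_mono) (auto simp: \<psi>_def)
    finally have 2: "I - \<epsilon> * J \<le> (\<integral>x. \<psi> x \<partial>lebesgue)" .
    have iK: "integrable lebesgue (indicator K :: 'a \<Rightarrow> real)" "integral\<^sup>L lebesgue (indicator K) = m"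
      using lmeasurable_compact[OF K(1)] by (auto simp: fmeasurable_def less_top m_def)
    have "\<epsilon> * m = (\<integral>x. \<epsilon> * indicator K x \<partial>lebesgue)" using iK by simp
    also have "\<dots> \<le> (\<integral>x. \<phi> x \<partial>lebesgue)"
    proof (rule integral_mono)
      show "\<epsilon> * indicator K x \<le> \<phi> x" for x
        using K(2) \<eta>(4)[of x] by (auto simp: \<phi>_def indicator_def)
    qed (use iK H0s_integrable[OF \<phi>] in auto)
    finally have 3: "\<epsilon> * m \<le> (\<integral>x. \<phi> x \<partial>lebesgue)" .
    have "k * (I - \<epsilon> * J) * (\<epsilon> * m) \<le> k * (\<integral>x. \<psi> x \<partial>lebesgue) * (\<integral>x. \<phi> x \<partial>lebesgue)"
      using 2 3 k(1) \<epsilon> by (intro mult_mono) (auto simp: m_def)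
    then have "\<epsilon> * (k * (I - \<epsilon> * J) * m) \<le> \<epsilon> * (\<epsilon> * D)"
      using 1 by (simp add: power2_eq_square mult_ac)
    then show ?thesis using \<epsilon>(1) by simp
  qed
  have "I \<ge> 0" unfolding I_def using u_nonneg by (intro Bochner_Integration.integral_nonneg)
  have "J \<ge> 0" unfolding J_def using \<eta>(2) by (intro Bochner_Integration.integral_nonneg)
  have "I = 0"
  proof (rule ccontr)
    assume "I \<noteq> 0"
    then have I: "I > 0" using \<open>I \<ge> 0\<close> by simp
    have m: "m > 0" using K(3) by (simp add: m_def)
    \<comment> \<open>With \<open>\<epsilon>\<close> of this size, \<open>\<epsilon>\<close> times \<open>S\<close> is half of the leading term, so the lower-order terms cannot reach it.\<close>
    define S where "S = \<bar>D\<bar> + k * J * m + k * m"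
    have den: "S > 0" using k(1) m \<open>J \<ge> 0\<close> by (simp add: S_def add_nonneg_pos)
    define \<epsilon> where "\<epsilon> = k * I * m / (2 * S)"
    have \<epsilon>: "\<epsilon> > 0" unfolding \<epsilon>_def using k(1) I m den by simp
    have "\<epsilon> * S = k * I * m / 2" using den by (simp add: \<epsilon>_def)
    then have s: "\<epsilon> * \<bar>D\<bar> + \<epsilon> * (k * J * m) + \<epsilon> * (k * m) = k * I * m / 2"
      by (simp add: S_def distrib_left)
    have nn: "0 \<le> \<epsilon> * \<bar>D\<bar>" "0 \<le> \<epsilon> * (k * J * m)" "0 < \<epsilon> * (k * m)" "0 < k * I * m" "\<epsilon> * D \<le> \<epsilon> * \<bar>D\<bar>"
      using \<epsilon> k(1) m I \<open>J \<ge> 0\<close> by (simp_all add: mult_left_mono)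
    have e: "k * (I - \<epsilon> * J) * m = k * I * m - \<epsilon> * (k * J * m)" by (simp add: algebra_simps)
    then have "k * (I - \<epsilon> * J) * m > 0" using s nn by linarith
    then have "I - \<epsilon> * J \<ge> 0" using k(1) m by (simp add: zero_less_mult_iff)
    then have "k * I * m - \<epsilon> * (k * J * m) \<le> \<epsilon> * D" using main[OF \<epsilon>] e by simp
    then show False using s nn by linarith
  qed
  then show ?thesis
    using integral_nonneg_eq_0_iff_AE[OF iu] u_nonneg by (simp add: I_def)
qed

lemma extremal_positive:
  assumes w: "extremal \<rho> M w" and w_nonneg: "AE x in lebesgue. 0 \<le> w x" and nz: "\<not> (AE x in lebesgue. w x = 0)"
  shows "AE x in lebesgue_on \<Omega>. w x > 0"
proof -
  note e = w[unfolded extremal_def]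
  have wV: "w \<in> V" using e by simp
  define u where "u x = indicator \<Omega> x * max 0 (w x)" for x
  have ae: "AE x in lebesgue. w x = u x"
    using w_nonneg H0s_D(3)[OF wV] by eventually_elim (auto simp: u_def indicator_def)
  have u: "u \<in> V" using H0s_cong[OF _ ae] e by blast
  have weak: "W \<rho> u \<phi> = M * B u \<phi>" if "\<phi> \<in> V" for \<phi>
  proof -
    have "W \<rho> u \<phi> = W \<rho> w \<phi>"
    proof (rule integral_cong_AE)
      show "AE x in lebesgue_on \<Omega>. \<rho> x * u x * \<phi> x = \<rho> x * w x * \<phi> x"
        unfolding AE_restrict_space_iff[OF \<Omega>_measurable(2)] using ae by eventually_elim simp
    qed (use W_integrable[of \<rho>] e u that in auto)
    also have "\<dots> = M * B w \<phi>" by (rule extremal_weak[OF w that])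
    also have "B w \<phi> = B u \<phi>"
      by (rule H0s_inner_cong) (use e u that ae H0s_D(4) in auto)
    finally show ?thesis .
  qed
  define Z where "Z = {x \<in> \<Omega>. u x = 0}"
  have "{x \<in> space lebesgue. u x = 0} \<in> sets lebesgue" using H0s_D(4)[OF u] by measurable
  then have Z: "Z \<in> sets lebesgue" "Z \<subseteq> \<Omega>" using \<Omega>_measurable(1) by (auto simp: Z_def Collect_conj_eq)
  have "emeasure lebesgue Z = 0"
  proof (rule ccontr)
    assume "emeasure lebesgue Z \<noteq> 0"
    then have "emeasure lebesgue Z > 0" by (simp add: zero_less_iff_neq_zero)
    from compact_subset_positive_measure[OF Z this]
    obtain K where K: "compact K" "K \<subseteq> Z" "measure lebesgue K > 0" "K \<noteq> {}" .
    have "AE x in lebesgue. u x = 0"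
      by (rule weak_solution_vanishing_on_compact[of \<rho> M u K])
        (use e u weak K in \<open>auto simp: u_def Z_def\<close>)
    with ae have "AE x in lebesgue. w x = 0" by eventually_elim simp
    with nz show False ..
  qed
  then have "Z \<in> null_sets lebesgue" using Z(1) by (intro null_setsI)
  then have "AE x in lebesgue. x \<notin> Z" by (rule AE_not_in)
  with ae have "AE x in lebesgue. x \<in> \<Omega> \<longrightarrow> w x > 0"
    by eventually_elim (auto simp: Z_def u_def max_def indicator_def split: if_splits)
  then show ?thesis unfolding AE_restrict_space_iff[OF \<Omega>_measurable(2)] .
qed

text \<open>The absolute value of a normalized maximizer satisfies the description of \<open>u_first\<close>, so the choice is
made from a nonempty set.\<close>

lemma u_first_properties:
  assumes \<rho>: "\<rho> \<in> Linf \<Omega>" and f: "f \<in> V" "W \<rho> f f > 0"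
  shows "extremal \<rho> (mu1 \<Omega> s \<rho>) (u_first \<Omega> s \<rho>)" "B (u_first \<Omega> s \<rho>) (u_first \<Omega> s \<rho>) = 1"
proof -
  let ?M = "mu1 \<Omega> s \<rho>"
  note mu = mu1_maximum[OF \<rho> f]
  obtain w where w: "w \<in> V" "B w w = 1" "W \<rho> w w = ?M" using mu(2) by blast
  have "extremal \<rho> ?M w" unfolding extremal_def using \<rho> mu w by simp
  then have a: "extremal \<rho> ?M (\<lambda>x. \<bar>w x\<bar>)" "B (\<lambda>x. \<bar>w x\<bar>) (\<lambda>x. \<bar>w x\<bar>) = 1"
    using extremal_abs w(2) by auto
  have aV: "(\<lambda>x. \<bar>w x\<bar>) \<in> V" by (rule H0s_abs[OF w(1)])
  have nz: "\<not> (AE x in lebesgue. \<bar>w x\<bar> = 0)" by (rule normalized_not_AE_zero[OF aV a(2)])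
  have "eigenfunction_of \<Omega> s \<rho> ?M (\<lambda>x. \<bar>w x\<bar>)"
    unfolding eigenfunction_iff[OF \<rho>] using aV nz extremal_weak[OF a(1)] by blast
  moreover have "AE x in lebesgue_on \<Omega>. \<bar>w x\<bar> > 0"
    by (rule extremal_positive[OF a(1) _ nz]) simp
  moreover have "H0s_norm s (\<lambda>x. \<bar>w x\<bar>) = 1" using a(2) by (simp add: H0s_norm_def)
  ultimately have "\<exists>u. eigenfunction_of \<Omega> s \<rho> ?M u \<and> (AE x in lebesgue_on \<Omega>. u x > 0) \<and> H0s_norm s u = 1"
    by blast
  from someI_ex[OF this] have u: "eigenfunction_of \<Omega> s \<rho> ?M (u_first \<Omega> s \<rho>)" "H0s_norm s (u_first \<Omega> s \<rho>) = 1"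
    unfolding u_first_def by auto
  then show "B (u_first \<Omega> s \<rho>) (u_first \<Omega> s \<rho>) = 1" by (simp add: H0s_norm_def)
  show "extremal \<rho> ?M (u_first \<Omega> s \<rho>)"
    using u(1) \<rho> mu unfolding eigenfunction_iff[OF \<rho>] extremal_def by simp
qed

section \<open>Differentiability of the first eigenvalue\<close>

text \<open>If \<open>\<rho> \<le> 0\<close> almost everywhere in \<open>\<Omega>\<close>, then \<open>W \<rho> f f\<close> cannot be positive.\<close>

lemma mu1_tilde_eq_mu1:
  assumes \<rho>: "\<rho> \<in> Linf \<Omega>" and f: "f \<in> V" "W \<rho> f f > 0"
  shows "mu1_tilde \<Omega> s \<rho> = mu1 \<Omega> s \<rho>"
proof -
  have [measurable]: "\<rho> \<in> borel_measurable (lebesgue_on \<Omega>)" using \<rho> by (simp add: Linf_def)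
  have "{x \<in> space (lebesgue_on \<Omega>). \<rho> x > 0} \<in> sets (lebesgue_on \<Omega>)" by measurable
  then have m: "{x \<in> \<Omega>. \<rho> x > 0} \<in> sets lebesgue"
    using sets_restrict_space_iff[OF \<Omega>_measurable(2)] by simp
  have "emeasure lebesgue {x \<in> \<Omega>. \<rho> x > 0} \<noteq> 0"
  proof
    assume "emeasure lebesgue {x \<in> \<Omega>. \<rho> x > 0} = 0"
    then have "{x \<in> \<Omega>. \<rho> x > 0} \<in> null_sets lebesgue" using m by (intro null_setsI)
    then have "AE x in lebesgue. x \<notin> {x \<in> \<Omega>. \<rho> x > 0}" by (rule AE_not_in)
    then have "AE x in lebesgue_on \<Omega>. 0 \<le> - (\<rho> x * f x * f x)"
      unfolding AE_restrict_space_iff[OF \<Omega>_measurable(2)]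
      by eventually_elim (auto simp: not_less mult_nonpos_nonneg mult.assoc)
    then have "0 \<le> (\<integral>x. - (\<rho> x * f x * f x) \<partial>lebesgue_on \<Omega>)" by (rule integral_nonneg_AE)
    then show False using f(2) by simp
  qed
  then have "emeasure lebesgue {x \<in> \<Omega>. \<rho> x > 0} > 0" by (simp add: zero_less_iff_neq_zero)
  then show ?thesis by (simp add: mu1_tilde_def)
qed

text \<open>Otherwise there are maximizers \<open>w n\<close> for \<open>\<rho> + t n v\<close> with \<open>t n \<longlonglongrightarrow> 0\<close> that violate the bound.
They have a limit \<open>z\<close> in \<open>L\<^sup>2\<close>. Comparing \<open>w n\<close> with \<open>u\<close> and passing to the limit gives
\<open>W \<rho> z z \<ge> M\<close>, so \<open>z\<close> is a normalized maximizer for \<open>\<rho>\<close>, and \<open>z\<^sup>2 = u\<^sup>2\<close> by simplicity.\<close>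

lemma extremal_stability:
  assumes u: "extremal \<rho> M u" "B u u = 1" and v: "v \<in> Linf \<Omega>" and \<epsilon>: "\<epsilon> > 0"
  shows "\<exists>\<delta>>0. \<forall>t M' w. \<bar>t\<bar> < \<delta> \<longrightarrow> extremal (\<lambda>x. \<rho> x + t * v x) M' w \<longrightarrow> B w w = 1 \<longrightarrow>
    \<bar>W v w w - W v u u\<bar> < \<epsilon>"
proof (rule ccontr)
  assume "\<not> ?thesis"
  then have neg: "\<exists>t M' w. \<bar>t\<bar> < \<delta> \<and> extremal (\<lambda>x. \<rho> x + t * v x) M' w \<and> B w w = 1 \<and>
    \<not> \<bar>W v w w - W v u u\<bar> < \<epsilon>" if "\<delta> > 0" for \<delta>
    using that by blast
  define bad where "bad n t M' w \<longleftrightarrow> \<bar>t\<bar> < 1 / real (Suc n) \<and> extremal (\<lambda>x. \<rho> x + t * v x) M' w \<and>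
    B w w = 1 \<and> \<not> \<bar>W v w w - W v u u\<bar> < \<epsilon>" for n t M' w
  have "\<exists>t M' w. bad n t M' w" for n
    unfolding bad_def by (rule neg) simp
  then obtain t M' w where bad: "\<And>n. bad n (t n) (M' n) (w n)"
    by metis
  have w: "\<bar>t n\<bar> < 1 / real (Suc n)"
    "extremal (\<lambda>x. \<rho> x + t n * v x) (M' n) (w n)" "B (w n) (w n) = 1"
    "\<not> \<bar>W v (w n) (w n) - W v u u\<bar> < \<epsilon>" for n
    using bad[of n, unfolded bad_def] by blast+
  have \<rho>: "\<rho> \<in> Linf \<Omega>" "u \<in> V" "M > 0" using u by (auto simp: extremal_def)
  have wV: "w n \<in> V" for n using w(2)[of n] by (simp add: extremal_def)
  obtain r z where r: "strict_mono (r :: nat \<Rightarrow> nat)" "z \<in> V"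
    "(\<lambda>n. \<integral>x. (w (r n) x - z x)\<^sup>2 \<partial>lebesgue) \<longlonglongrightarrow> 0"
    "\<forall>E. (\<forall>\<^sub>F n in sequentially. B (w (r n)) (w (r n)) \<le> E) \<longrightarrow> B z z \<le> E"
    using Rellich[of w 1] wV w(3) by auto
  have Bz: "B z z \<le> 1" using r(4) w(3) by simp
  have lim: "(\<lambda>n. W \<sigma> (w (r n)) (w (r n))) \<longlonglongrightarrow> W \<sigma> z z" if "\<sigma> \<in> Linf \<Omega>" for \<sigma>
    by (rule W_tendsto[where f = "\<lambda>n. w (r n)" and g = "\<lambda>n. w (r n)", OF that wV r(2,3) wV r(2,3)])
  have "t \<longlonglongrightarrow> 0"
  proof (rule Lim_null_comparison[OF always_eventually])
    show "\<forall>n. norm (t n) \<le> 1 / real (Suc n)" using w(1) less_imp_le by (simp only: real_norm_def) blast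
    show "(\<lambda>n. 1 / real (Suc n)) \<longlonglongrightarrow> 0" using LIMSEQ_inverse_real_of_nat by (simp add: inverse_eq_divide)
  qed
  then have tr: "(\<lambda>n. t (r n)) \<longlonglongrightarrow> 0" using LIMSEQ_subseq_LIMSEQ[OF _ r(1)] by (fastforce simp: o_def)
  have ge: "M + t n * W v u u \<le> W \<rho> (w n) (w n) + t n * W v (w n) (w n)" for n
  proof -
    note e = w(2)[of n, unfolded extremal_def]
    have "M + t n * W v u u = W (\<lambda>x. \<rho> x + t n * v x) u u"
      using u W_linear_weight[OF \<rho>(1) v \<rho>(2,2)] by (simp add: extremal_def)
    also have "\<dots> \<le> M' n * B u u" using e \<rho>(2) by blast
    also have "\<dots> = W (\<lambda>x. \<rho> x + t n * v x) (w n) (w n)" using e w(3)[of n] u(2) by simp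
    also have "\<dots> = W \<rho> (w n) (w n) + t n * W v (w n) (w n)" by (rule W_linear_weight[OF \<rho>(1) v wV wV])
    finally show ?thesis .
  qed
  have "M + 0 * W v u u \<le> W \<rho> z z + 0 * W v z z"
  proof (rule LIMSEQ_le)
    show "(\<lambda>n. M + t (r n) * W v u u) \<longlonglongrightarrow> M + 0 * W v u u" by (intro tendsto_add tendsto_mult tendsto_const tr)
    show "(\<lambda>n. W \<rho> (w (r n)) (w (r n)) + t (r n) * W v (w (r n)) (w (r n))) \<longlonglongrightarrow> W \<rho> z z + 0 * W v z z"
      by (intro tendsto_add tendsto_mult tr lim \<rho> v)
  qed (use ge in blast)
  then have Mz: "M \<le> W \<rho> z z" by simp
  have zle: "W \<rho> z z \<le> M * B z z" using u(1) r(2) by (simp add: extremal_def)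
  have "M * 1 \<le> M * B z z" using Mz zle by simp
  then have Bz1: "B z z = 1" using \<rho>(3) Bz by simp
  have "extremal \<rho> M z" using u(1) r(2) Mz zle Bz1 by (simp add: extremal_def)
  then have ae: "AE x in lebesgue. (z x)\<^sup>2 = (u x)\<^sup>2" by (rule extremal_simple[OF _ Bz1 u])
  have "W v z z = W v u u"
  proof (rule integral_cong_AE)
    show "AE x in lebesgue_on \<Omega>. v x * z x * z x = v x * u x * u x"
      unfolding AE_restrict_space_iff[OF \<Omega>_measurable(2)]
      using ae by eventually_elim (simp add: power2_eq_square mult.assoc)
  qed (use W_integrable[OF v r(2,2)] W_integrable[OF v \<rho>(2,2)] in auto)
  then have "(\<lambda>n. W v (w (r n)) (w (r n))) \<longlonglongrightarrow> W v u u" using lim[OF v] by simp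
  from tendstoD[OF this \<epsilon>] have "\<forall>\<^sub>F n in sequentially. \<bar>W v (w (r n)) (w (r n)) - W v u u\<bar> < \<epsilon>"
    unfolding dist_real_def .
  then show False using w(4) by simp
qed

text \<open>Testing each of the two maxima with the maximizer of the other encloses the difference quotient
between \<open>W v u u\<close> and \<open>W v w w\<close>, where \<open>w\<close> is the first eigenfunction for \<open>\<rho> + t v\<close>.\<close>

lemma mu1_tilde_directional_derivative:
  assumes \<rho>: "\<rho> \<in> Linf \<Omega>" and f: "f \<in> V" "W \<rho> f f > 0" and v: "v \<in> Linf \<Omega>"
  defines "u \<equiv> u_first \<Omega> s \<rho>"
  shows "((\<lambda>t. (mu1_tilde \<Omega> s (\<lambda>x. \<rho> x + t * v x) - mu1_tilde \<Omega> s \<rho>) / t) \<longlongrightarrow> W v u u) (at 0)"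
proof (rule tendstoI)
  fix \<epsilon> :: real assume \<epsilon>: "\<epsilon> > 0"
  define M where "M = mu1 \<Omega> s \<rho>"
  define L where "L = W v u u"
  have u: "extremal \<rho> M u" "B u u = 1" unfolding u_def M_def using u_first_properties[OF \<rho> f] by auto
  have uV: "u \<in> V" and M: "M > 0" and Wu: "W \<rho> u u = M" using u by (auto simp: extremal_def)
  obtain \<delta> where \<delta>: "\<delta> > 0" "\<And>t M' w. \<bar>t\<bar> < \<delta> \<Longrightarrow> extremal (\<lambda>x. \<rho> x + t * v x) M' w \<Longrightarrow> B w w = 1 \<Longrightarrow>
    \<bar>W v w w - L\<bar> < \<epsilon>"
    using extremal_stability[OF u v \<epsilon>] unfolding L_def by blast
  \<comment> \<open>The second bound keeps \<open>W (\<rho> + t v) u u = M + t L\<close> positive, so that the perturbed maximum exists.\<close>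
  define d where "d = min \<delta> (M / (\<bar>L\<bar> + 1))"
  have d: "d > 0" using \<delta>(1) M by (simp add: d_def add_nonneg_pos)
  have close: "\<bar>(mu1_tilde \<Omega> s (\<lambda>x. \<rho> x + t * v x) - mu1_tilde \<Omega> s \<rho>) / t - L\<bar> < \<epsilon>" if t: "t \<noteq> 0" "\<bar>t\<bar> < d" for t
  proof -
    let ?\<rho> = "\<lambda>x. \<rho> x + t * v x"
    have \<rho>t: "?\<rho> \<in> Linf \<Omega>" by (rule Linf_perturb[OF \<rho> v])
    have Wt: "W ?\<rho> g g = W \<rho> g g + t * W v g g" if "g \<in> V" for g
      by (rule W_linear_weight[OF \<rho> v that that])
    have "\<bar>t * L\<bar> < M"
    proof -
      have "\<bar>t\<bar> * (\<bar>L\<bar> + 1) < M" using t(2) by (simp add: d_def field_simps)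
      moreover have "\<bar>t\<bar> * (\<bar>L\<bar> + 1) = \<bar>t * L\<bar> + \<bar>t\<bar>" by (simp add: abs_mult algebra_simps)
      ultimately show ?thesis by linarith
    qed
    then have post: "W ?\<rho> u u > 0" unfolding Wt[OF uV] Wu L_def[symmetric] by linarith
    define w where "w = u_first \<Omega> s ?\<rho>"
    define Mt where "Mt = mu1 \<Omega> s ?\<rho>"
    have w: "extremal ?\<rho> Mt w" "B w w = 1"
      unfolding w_def Mt_def using u_first_properties[OF \<rho>t uV post] by auto
    have wV: "w \<in> V" using w(1) by (simp add: extremal_def)
    have near: "\<bar>W v w w - L\<bar> < \<epsilon>" using \<delta>(2)[OF _ w] t(2) by (simp add: d_def)
    have eq: "mu1_tilde \<Omega> s ?\<rho> - mu1_tilde \<Omega> s \<rho> = Mt - M"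
      unfolding mu1_tilde_eq_mu1[OF \<rho> f] mu1_tilde_eq_mu1[OF \<rho>t uV post] by (simp add: Mt_def M_def)
    have "W ?\<rho> u u \<le> Mt * B u u" using w(1) uV by (simp add: extremal_def)
    then have lo: "t * L \<le> Mt - M" unfolding Wt[OF uV] Wu u(2) by (simp add: L_def)
    have "W \<rho> w w \<le> M * B w w" using u(1) wV by (simp add: extremal_def)
    moreover have "W ?\<rho> w w = Mt" using w by (simp add: extremal_def)
    ultimately have hi: "Mt - M \<le> t * W v w w" unfolding Wt[OF wV] w(2) by simp
    have "\<bar>(Mt - M) / t - L\<bar> \<le> \<bar>W v w w - L\<bar>"
    proof (cases "t > 0")
      case True
      then have "L \<le> (Mt - M) / t" "(Mt - M) / t \<le> W v w w" using lo hi by (simp_all add: field_simps)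
      then show ?thesis by linarith
    next
      case False
      then have "t < 0" using t(1) by simp
      then have "(Mt - M) / t \<le> L" "W v w w \<le> (Mt - M) / t" using lo hi by (simp_all add: field_simps)
      then show ?thesis by linarith
    qed
    then show ?thesis using near unfolding eq by linarith
  qed
  show "\<forall>\<^sub>F t in at 0. dist ((mu1_tilde \<Omega> s (\<lambda>x. \<rho> x + t * v x) - mu1_tilde \<Omega> s \<rho>) / t) (W v u u) < \<epsilon>"
    unfolding eventually_at dist_real_def L_def[symmetric]
  proof (intro exI[of _ d] conjI ballI impI)
    fix t assume "t \<noteq> 0 \<and> \<bar>t - 0\<bar> < d"
    then show "\<bar>(mu1_tilde \<Omega> s (\<lambda>x. \<rho> x + t * v x) - mu1_tilde \<Omega> s \<rho>) / t - L\<bar> < \<epsilon>"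
      by (intro close) simp_all
  qed (rule d)
qed

end

theorem theorem4p3:
  fixes \<Omega> :: "'a::euclidean_space set" and s :: real and \<rho> :: "'a \<Rightarrow> real"
  assumes "DIM('a) \<ge> 2"
    and "0 < s" and "s < 1"
    and "bounded_C2_domain \<Omega>"
    and "\<rho> \<in> Linf \<Omega>"
    and "mu1_tilde \<Omega> s \<rho> > 0"
  shows "has_gateaux_differential \<Omega> (mu1_tilde \<Omega> s) \<rho> (\<lambda>x. (u_first \<Omega> s \<rho> x)\<^sup>2)"
proof -
  interpret fractional_domain \<Omega> s
    using assms(2,3,4) by unfold_locales (auto simp: bounded_C2_domain_def)
  note \<rho> = \<open>\<rho> \<in> Linf \<Omega>\<close>
  have "emeasure lebesgue {x \<in> \<Omega>. \<rho> x > 0} > 0"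
    using assms(6) by (simp add: mu1_tilde_def split: if_splits)
  then obtain f where f: "f \<in> V" "W \<rho> f f > 0"
    using positive_part_gives_positive_form[OF \<rho>] by blast
  let ?u = "u_first \<Omega> s \<rho>"
  have u: "?u \<in> V" using u_first_properties(1)[OF \<rho> f] by (simp add: extremal_def)
  \<comment> \<open>The weight \<open>1\<close> gives the integrability of the square.\<close>
  have "(\<lambda>x. 1) \<in> Linf \<Omega>" by (auto simp: Linf_def)
  from W_integrable[OF this u u] have "integrable (lebesgue_on \<Omega>) (\<lambda>x. (?u x)\<^sup>2)"
    by (simp add: power2_eq_square)
  moreover have "((\<lambda>t. (mu1_tilde \<Omega> s (\<lambda>x. \<rho> x + t * v x) - mu1_tilde \<Omega> s \<rho>) / t)
      \<longlongrightarrow> (\<integral>x. (?u x)\<^sup>2 * v x \<partial>lebesgue_on \<Omega>)) (at 0)" if "v \<in> Linf \<Omega>" for v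
    using mu1_tilde_directional_derivative[OF \<rho> f that] by (simp add: power2_eq_square mult_ac)
  ultimately show ?thesis unfolding has_gateaux_differential_def by blast
qed

end
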